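(* Let $1<p\le2$, let $k\ge1$, and let $(f,g)\in C_0^2(\mathbb{R}^2)\times C_0^1(\mathbb{R}^2)$ satisfy $\mathrm{supp}(f,g)\subset\{x\in\mathbb{R}^2:|x|\le k\}$. Assume that $f(x)+g(x)\equiv0$, and that either (i) $1<p<2$ and $f\ge0$ with $f\not\equiv0$; or (ii) $p=2$ and $\int_{\mathbb{R}^2}f(x)\,dx<0$. Then there exist a positive constant $\varepsilon_1=\varepsilon_1(f,g,p,k)$ and a positive constant $c$ independent of $\varepsilon$ such that, for every $0<\varepsilon\le\varepsilon_1$, the integral equation (I) has no solution $u\in C^1(\mathbb{R}^2\times[0,T))$ with $\mathrm{supp}\,u\subset\{(x,t)\in\mathbb{R}^2\times[0,\infty):|x|\le t+k\}$ whenever $T$ satisfies $$ T\ge\begin{cases} c\,\varepsilon^{-2p(p-1)/\gamma(p,4)} & \text{in case (i)},\\ \exp(c\,\varepsilon^{-2/3}) & \text{in case (ii)}.\end{cases} $$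
   Context: $\gamma(p,n)=2+(n+1)p-(n-1)p^2$, so $\gamma(p,4)=2+5p-3p^2$. The integral equation (I) is $$u(x,t)=\varepsilon u_L(x,t)+L(|u|^p)(x,t),\qquad (x,t)\in\mathbb{R}^2\times[0,T),$$ where $$u_L(x,t)=\frac{\partial}{\partial t}R(f|x,t)+R(f+g|x,t),\qquad R(\phi|x,t)=\frac{t}{2\pi}\int_{|\xi|\le1}\frac{\phi(x+t\xi)}{\sqrt{1-|\xi|^2}}\,d\xi,$$ and $$L(F)(x,t)=\frac1{2\pi}\int_0^t\frac{t-\tau}{(1+\tau)^{p-1}}\,d\tau\int_{|\xi|\le1}\frac{F(x+(t-\tau)\xi,\tau)}{\sqrt{1-|\xi|^2}}\,d\xi .$$ It is the integral equation associated with the initial value problem $$ u_{tt}-\Delta u=\frac{|u|^p}{(1+t)^{p-1}}\ \text{ in }\mathbb{R}^2\times[0,T),\qquad u(x,0)=\varepsilon f(x),\quad u_t(x,0)=\varepsilon\{f(x)+g(x)\}, $$ which arises via $u=(1+t)v$ from $v_{tt}-\Delta v+\frac{2}{1+t}v_t=|v|^p$, $v(x,0)=\varepsilon f(x)$, $v_t(x,0)=\varepsilon g(x)$. *)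

theory Defs
  imports "HOL-Analysis.Analysis"
begin

text \<open>The derivative is taken within \<open>S\<close>, so on \<open>UNIV \<times> {0..<T}\<close> it is one-sided at the initial
  time and is required to be continuous up to it.\<close>

definition C1_on :: "('a::real_normed_vector \<Rightarrow> 'b::real_normed_vector) \<Rightarrow> 'a set \<Rightarrow> bool" where
  "C1_on f S \<longleftrightarrow> (\<exists>f' :: 'a \<Rightarrow> 'a \<Rightarrow>\<^sub>L 'b.
     (\<forall>x\<in>S. (f has_derivative blinfun_apply (f' x)) (at x within S)) \<and> continuous_on S f')"

definition C2_on :: "('a::real_normed_vector \<Rightarrow> 'b::real_normed_vector) \<Rightarrow> 'a set \<Rightarrow> bool" where
  "C2_on f S \<longleftrightarrow> (\<exists>f' :: 'a \<Rightarrow> 'a \<Rightarrow>\<^sub>L 'b.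
     (\<forall>x\<in>S. (f has_derivative blinfun_apply (f' x)) (at x within S)) \<and> C1_on f' S)"

definition supp :: "('a::topological_space \<Rightarrow> 'b::monoid_add) \<Rightarrow> 'a set \<Rightarrow> 'a set" where
  "supp f S = closure (support_on S f)"

definition C1_compact_supp :: "('a::real_normed_vector \<Rightarrow> real) \<Rightarrow> bool" where
  "C1_compact_supp f \<longleftrightarrow> C1_on f UNIV \<and> compact (supp f UNIV)"

definition C2_compact_supp :: "('a::real_normed_vector \<Rightarrow> real) \<Rightarrow> bool" where
  "C2_compact_supp f \<longleftrightarrow> C2_on f UNIV \<and> compact (supp f UNIV)"

definition strauss_gamma :: "real \<Rightarrow> nat \<Rightarrow> real" where
  "strauss_gamma p n = 2 + (real n + 1) * p - (real n - 1) * p\<^sup>2"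

text \<open>In the two kernels below, the weight \<open>1 / sqrt (1 - |\<xi>|\<^sup>2)\<close> takes the value \<open>0\<close> on the unit
  circle by division by zero; the circle is a null set.\<close>

definition wave_R :: "(real^2 \<Rightarrow> real) \<Rightarrow> real^2 \<Rightarrow> real \<Rightarrow> real" where
  "wave_R \<phi> x t = t / (2 * pi) *
     (LINT \<xi>:cball 0 1|lborel. \<phi> (x + t *\<^sub>R \<xi>) / sqrt (1 - (norm \<xi>)\<^sup>2))"

text \<open>The formula for \<open>wave_R\<close> makes sense, and is odd, for negative times too. For continuously
  differentiable \<open>\<phi>\<close> it is differentiable in time everywhere, so at \<open>t = 0\<close> the two-sided
  derivative agrees with the one-sided one.\<close>

definition wave_free :: "(real^2 \<Rightarrow> real) \<Rightarrow> (real^2 \<Rightarrow> real) \<Rightarrow> real^2 \<Rightarrow> real \<Rightarrow> real" where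
  "wave_free f g x t = deriv (\<lambda>s. wave_R f x s) t + wave_R (\<lambda>y. f y + g y) x t"

definition wave_L :: "real \<Rightarrow> ((real^2) \<times> real \<Rightarrow> real) \<Rightarrow> real^2 \<Rightarrow> real \<Rightarrow> real" where
  "wave_L p F x t = 1 / (2 * pi) *
     (LINT \<tau>:{0..t}|lborel. (t - \<tau>) / (1 + \<tau>) powr (p - 1) *
        (LINT \<xi>:cball 0 1|lborel. F (x + (t - \<tau>) *\<^sub>R \<xi>, \<tau>) / sqrt (1 - (norm \<xi>)\<^sup>2)))"

definition solves_integral_equation ::
  "real \<Rightarrow> real \<Rightarrow> (real^2 \<Rightarrow> real) \<Rightarrow> (real^2 \<Rightarrow> real) \<Rightarrow> real \<Rightarrow> ((real^2) \<times> real \<Rightarrow> real) \<Rightarrow> bool" where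
  "solves_integral_equation p \<epsilon> f g T u \<longleftrightarrow>
     (\<forall>x. \<forall>t\<in>{0..<T}. u (x, t) = \<epsilon> * wave_free f g x t + wave_L p (\<lambda>z. \<bar>u z\<bar> powr p) x t)"

end

theory Submission
  imports Defs
begin

text \<open>
  Put \<open>\<rho> = sqrt (t\<^sup>2 - |x|\<^sup>2)\<close>, \<open>m = \<integral>f\<close>, and let \<open>I(s)\<close> be the integral of \<open>|u|\<^sup>p / (1 + \<tau>) powr (p - 1)\<close> over
  the cone \<open>|y| + \<tau> < s\<close>. For \<open>s = t - |x| \<ge> k\<close>, the kernel of \<open>wave_L\<close> is at least \<open>1 / (2 \<rho>)\<close> on the part of
  that cone that meets the support of \<open>u\<close>, so the nonlinear term is at least \<open>I(t - |x|) / (4 \<pi> \<rho>)\<close>. In the interior of the light cone the free solution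
  is close to \<open>- (m / 2 \<pi>) t / \<rho>\<^sup>3\<close>. It is nonnegative there if \<open>m < 0\<close>, and it is dominated by the
  nonlinear term for large \<open>t - |x|\<close> if \<open>m > 0\<close>. Hence \<open>u \<ge> I(t - |x|) / (8 \<pi> \<rho>)\<close>, and inserting this bound
  into \<open>I\<close> gives an integral inequality for \<open>I\<close> alone.

  The inequality is started by \<open>\<integral>|u(\<cdot>, t)|\<^sup>p \<ge> c \<epsilon>\<^sup>p t powr (1 - p / 2)\<close>. For \<open>m < 0\<close> this is the contribution of an
  annulus \<open>s0 \<le> t - |x| < 2 s0\<close>. For \<open>m > 0\<close> the free solution has total mass \<open>\<ge> 0\<close> but mass \<open>\<le> - c sqrt t\<close> in
  the interior, so the outer shell carries mass \<open>\<ge> c sqrt t\<close>, and \<open>u \<ge> \<epsilon> \<cdot> free\<close> transfers this to \<open>u\<close>.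

  Finally \<open>I\<close> is bounded below by geometrically growing constants at increasing points \<open>b j\<close> that stay bounded,
  \<open>b j = S (2 - 2\<^sup>-\<^sup>j)\<close> with \<open>S = T / 3\<close> for \<open>p < 2\<close> and \<open>b j = exp (\<Sigma> (2 - 2\<^sup>-\<^sup>j))\<close> with \<open>\<Sigma> = ln T / 3\<close> for \<open>p = 2\<close>,
  which contradicts the finiteness of \<open>u (0, 2 S)\<close> or \<open>u (0, exp (2 \<Sigma>))\<close>.
\<close>

section \<open>Integration in the plane\<close>

text \<open>The mean value theorem turns the bound on \<open>f'\<close> into the bound
  \<open>g\<close> on all difference quotients, so dominated convergence applies along every
  sequence tending to \<open>t\<close>. Measurability of \<open>\<lambda>x. f' x t\<close> follows
  as well, since it is a pointwise limit of measurable quotients.\<close>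

lemma has_real_derivative_integral_dominated:
  fixes f f' :: "'a \<Rightarrow> real \<Rightarrow> real"
  assumes "0 < d"
    and int: "\<And>s. s \<in> ball t d \<Longrightarrow> integrable M (\<lambda>x. f x s)"
    and der: "\<And>x s. \<lbrakk>x \<in> space M; s \<in> ball t d\<rbrakk> \<Longrightarrow> (f x has_real_derivative f' x s) (at s)"
    and bound: "\<And>x s. \<lbrakk>x \<in> space M; s \<in> ball t d\<rbrakk> \<Longrightarrow> \<bar>f' x s\<bar> \<le> g x"
    and g: "integrable M g"
  shows "((\<lambda>s. LINT x|M. f x s) has_real_derivative (LINT x|M. f' x t)) (at t)"
    and "integrable M (\<lambda>x. f' x t)"
proof -
  have lip: "\<bar>f x s - f x t\<bar> \<le> g x * \<bar>s - t\<bar>" if "x \<in> space M" "s \<in> ball t d" for x s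
  proof -
    have "norm (f x s - f x t) \<le> g x * norm (s - t)"
    proof (rule field_differentiable_bound[where S="ball t d" and f'="f' x"])
      fix z assume "z \<in> ball t d"
      then show "(f x has_field_derivative f' x z) (at z within ball t d)" "norm (f' x z) \<le> g x"
        using that der bound by (auto intro: has_field_derivative_at_within)
    qed (use that \<open>0 < d\<close> in auto)
    then show ?thesis by simp
  qed
  have *: "(\<lambda>n. LINT x|M. (f x (X n) - f x t) / (X n - t)) \<longlonglongrightarrow> (LINT x|M. f' x t) \<and> integrable M (\<lambda>x. f' x t)"
    if X: "\<And>n. X n \<in> ball t d - {t}" "X \<longlonglongrightarrow> t" for X
  proof -
    have lim: "(\<lambda>n. (f x (X n) - f x t) / (X n - t)) \<longlonglongrightarrow> f' x t" if "x \<in> space M" for x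
    proof -
      have "((\<lambda>s. (f x s - f x t) / (s - t)) \<longlongrightarrow> f' x t) (at t)"
        using der[OF that, of t] \<open>0 < d\<close> by (simp add: has_field_derivative_iff)
      moreover have "filterlim X (at t) sequentially"
        using X by (auto simp: filterlim_at)
      ultimately show ?thesis by (rule filterlim_compose)
    qed
    have meas: "(\<lambda>x. (f x (X n) - f x t) / (X n - t)) \<in> borel_measurable M" for n
      using int[of "X n"] int[of t] X(1)[of n] \<open>0 < d\<close> by auto
    have bd: "norm ((f x (X n) - f x t) / (X n - t)) \<le> g x" if "x \<in> space M" for x n
      using lip[OF that, of "X n"] X(1)[of n] by (auto simp: divide_simps)
    have meas': "(\<lambda>x. f' x t) \<in> borel_measurable M"
      by (rule borel_measurable_LIMSEQ_metric[OF meas lim])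
    have lim': "AE x in M. (\<lambda>n. (f x (X n) - f x t) / (X n - t)) \<longlonglongrightarrow> f' x t"
      using lim by (rule AE_I2)
    have bd': "AE x in M. norm ((f x (X n) - f x t) / (X n - t)) \<le> g x" for n
      using bd by (rule AE_I2)
    show ?thesis
      using integral_dominated_convergence[OF meas' meas g lim' bd']
        integrable_dominated_convergence[OF meas' meas g lim' bd'] by blast
  qed
  have **: "(LINT x|M. (f x s - f x t) / (s - t)) = ((LINT x|M. f x s) - (LINT x|M. f x t)) / (s - t)"
    if "s \<in> ball t d" for s
    using int[OF that] int[of t] \<open>0 < d\<close> by simp
  \<comment> \<open>Integrability of the limit needs one concrete sequence. The shift by 2 keeps
    even its first term strictly inside the ball.\<close>
  have "(\<lambda>n. t + d / (real n + 2)) \<longlonglongrightarrow> t" by real_asymp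
  moreover have "d / (real n + 2) < d" for n
    using \<open>0 < d\<close> by (simp add: field_simps add_pos_nonneg)
  ultimately show "integrable M (\<lambda>x. f' x t)"
    using *[of "\<lambda>n. t + d / (real n + 2)"] \<open>0 < d\<close> by (auto simp: dist_norm add_pos_pos)
  show "((\<lambda>s. LINT x|M. f x s) has_real_derivative (LINT x|M. f' x t)) (at t)"
    unfolding has_field_derivative_iff tendsto_at_iff_sequentially comp_def
  proof (intro allI impI)
    fix X assume X: "\<forall>i. X i \<in> UNIV - {t}" "X \<longlonglongrightarrow> t"
    then have "eventually (\<lambda>n. X n \<in> ball t d) sequentially"
      using \<open>0 < d\<close> by (intro topological_tendstoD[OF X(2)]) auto
    then obtain N where N: "\<And>n. n \<ge> N \<Longrightarrow> X n \<in> ball t d"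
      by (auto simp: eventually_sequentially)
    have "(\<lambda>n. LINT x|M. (f x (X (n + N)) - f x t) / (X (n + N) - t)) \<longlonglongrightarrow> (LINT x|M. f' x t)"
      using N X LIMSEQ_ignore_initial_segment[OF X(2)] by (intro conjunct1[OF *]) auto
    then have "(\<lambda>n. ((LINT x|M. f x (X (n + N))) - (LINT x|M. f x t)) / (X (n + N) - t)) \<longlonglongrightarrow> (LINT x|M. f' x t)"
      using N by (subst (asm) **) auto
    then show "(\<lambda>n. ((LINT x|M. f x (X n)) - (LINT x|M. f x t)) / (X n - t)) \<longlonglongrightarrow> (LINT x|M. f' x t)"
      by (rule LIMSEQ_offset)
  qed
qed

text \<open>The image of Lebesgue measure under the norm has density \<open>2 * pi * r\<close> on
  \<open>r \<ge> 0\<close>: both measures give \<open>{..a}\<close> the area of the disc of radius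
  \<open>a\<close>, and the half-lines are an intersection-stable generator of the Borel
  sets.\<close>

lemma nn_integral_radial:
  fixes g :: "real \<Rightarrow> ennreal"
  assumes [measurable]: "g \<in> borel_measurable borel"
  shows "(\<integral>\<^sup>+x. g (norm (x :: real^2)) \<partial>lborel) = (\<integral>\<^sup>+r. ennreal (2 * pi * r) * indicator {0..} r * g r \<partial>lborel)"
proof -
  let ?M = "distr lborel borel (norm :: real^2 \<Rightarrow> real)"
  let ?N = "density lborel (\<lambda>r. ennreal (2 * pi * r) * indicator {0..} r)"
  have M: "emeasure ?M {..a} = (if 0 \<le> a then ennreal (pi * a\<^sup>2) else 0)" for a
  proof -
    have "emeasure ?M {..a} = emeasure lborel (cball (0::real^2) a)"
      by (subst emeasure_distr) (auto intro!: arg_cong[where f="emeasure lborel"])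
    then show ?thesis by (auto simp: emeasure_cball unit_ball_vol_2)
  qed
  have N: "emeasure ?N {..a} = (if 0 \<le> a then ennreal (pi * a\<^sup>2) else 0)" for a
  proof -
    have "emeasure ?N {..a} = (\<integral>\<^sup>+r. ennreal (2 * pi * r) * indicator {0..a} r \<partial>lborel)"
      by (subst emeasure_density) (auto intro!: nn_integral_cong split: split_indicator)
    also have "\<dots> = (if 0 \<le> a then ennreal (pi * a\<^sup>2) else 0)"
    proof (cases "0 \<le> a")
      case True
      have "(\<integral>\<^sup>+r. ennreal (2 * pi * r) * indicator {0..a} r \<partial>lborel) = ennreal (pi * a\<^sup>2 - pi * 0\<^sup>2)"
        by (rule nn_integral_FTC_Icc) (use True in \<open>auto intro!: derivative_eq_intros\<close>)
      then show ?thesis using True by simp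
    qed auto
    finally show ?thesis .
  qed
  have "?M = ?N"
  proof (rule measure_eqI_generator_eq[where E="range atMost" and \<Omega>=UNIV and A="\<lambda>i. {..real i}"])
    show "Int_stable (range atMost :: real set set)"
      by (auto simp: Int_stable_def)
    show "(\<Union>i. {..real i}) = UNIV"
      by (auto simp: real_arch_simple)
  qed (auto simp: M N borel_eq_atMost[symmetric], auto simp: borel_eq_atMost)
  then have "(\<integral>\<^sup>+r. g r \<partial>?M) = (\<integral>\<^sup>+r. g r \<partial>?N)" by simp
  then show ?thesis
    by (simp add: nn_integral_distr nn_integral_density)
qed

lemma nn_integral_affine:
  fixes g :: "'a::euclidean_space \<Rightarrow> ennreal"
  assumes [measurable]: "g \<in> borel_measurable borel" and "c \<noteq> 0"
  shows "(\<integral>\<^sup>+y. g y \<partial>lborel) = ennreal (\<bar>c\<bar> ^ DIM('a)) * (\<integral>\<^sup>+\<xi>. g (x + c *\<^sub>R \<xi>) \<partial>lborel)"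
  by (subst lborel_affine[OF \<open>c \<noteq> 0\<close>, of x])
     (simp add: nn_integral_density nn_integral_distr nn_integral_cmult)

lemma integral_affine:
  fixes g :: "'a::euclidean_space \<Rightarrow> real"
  assumes [measurable]: "g \<in> borel_measurable borel" and "c \<noteq> 0"
  shows "(LINT y|lborel. g y) = \<bar>c\<bar> ^ DIM('a) * (LINT \<xi>|lborel. g (x + c *\<^sub>R \<xi>))"
  by (subst lborel_affine[OF \<open>c \<noteq> 0\<close>, of x])
     (simp add: integral_density integral_distr)

text \<open>The indicator is built into the weight, so that integrals over the unit disc become
  integrals over the whole plane, where substitution and Fubini apply directly.\<close>

definition wave_weight :: "real^2 \<Rightarrow> real" where
  "wave_weight \<xi> = indicator (cball 0 1) \<xi> / sqrt (1 - (norm \<xi>)\<^sup>2)"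

lemma wave_weight_nonneg [simp]: "0 \<le> wave_weight \<xi>"
  by (auto simp: wave_weight_def indicator_def power_le_one abs_square_le_1)

lemma wave_weight_measurable [measurable]: "wave_weight \<in> borel_measurable borel"
  unfolding wave_weight_def
  by (intro borel_measurable_divide borel_measurable_indicator borel_closed
      borel_measurable_continuous_onI continuous_intros) auto

text \<open>In polar coordinates the integrand is \<open>2 * pi * r / sqrt (1 - r\<^sup>2)\<close>,
  and its primitive \<open>- 2 * pi * sqrt (1 - r\<^sup>2)\<close> has a finite limit at the
  singular end \<open>r = 1\<close>.\<close>

lemma integrable_wave_weight: "integrable lborel wave_weight"
proof (rule integrableI_nonneg)
  let ?g = "\<lambda>r::real. ennreal (indicator {..1} r / sqrt (1 - r\<^sup>2))"
  have "(\<integral>\<^sup>+\<xi>. ennreal (wave_weight \<xi>) \<partial>lborel) = (\<integral>\<^sup>+\<xi>. ?g (norm (\<xi> :: real^2)) \<partial>lborel)"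
    by (auto intro!: nn_integral_cong simp: wave_weight_def split: split_indicator)
  also have "\<dots> = (\<integral>\<^sup>+r. ennreal (2 * pi * r) * indicator {0..} r * ?g r \<partial>lborel)"
    by (rule nn_integral_radial) measurable
  \<comment> \<open>Passing to the open interval changes nothing, as the integrand is 0 at both ends
    (at \<open>r = 1\<close> by division by zero), and it allows the improper form of the
    fundamental theorem of calculus.\<close>
  also have "\<dots> = (\<integral>\<^sup>+r. ennreal (norm (indicator (einterval 0 1) r *\<^sub>R (2 * pi * r / sqrt (1 - r\<^sup>2)))) \<partial>lborel)"
  proof (rule nn_integral_cong)
    fix r :: real
    have "r\<^sup>2 \<le> 1" if "0 \<le> r" "r \<le> 1" using that by (simp add: power_le_one)
    then show "ennreal (2 * pi * r) * indicator {0..} r * ?g r =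
        ennreal (norm (indicator (einterval 0 1) r *\<^sub>R (2 * pi * r / sqrt (1 - r\<^sup>2))))"
      by (cases "r = 0"; cases "r = 1")
         (auto simp: indicator_def einterval_def ennreal_mult'[symmetric] less_le zero_ereal_def one_ereal_def)
  qed
  also have "\<dots> < \<infinity>"
  proof -
    have "set_integrable lborel (einterval 0 1) (\<lambda>r. 2 * pi * r / sqrt (1 - r\<^sup>2))"
    proof (rule interval_integral_FTC_nonneg(1)[where F="\<lambda>r. - 2 * pi * sqrt (1 - r\<^sup>2)" and A="- 2 * pi" and B=0])
      fix r :: real assume "0 < ereal r" "ereal r < 1"
      then have r: "0 < r" "r\<^sup>2 < 1" by (auto simp: abs_square_less_1 zero_ereal_def one_ereal_def)
      show "((\<lambda>r. - 2 * pi * sqrt (1 - r\<^sup>2)) has_real_derivative 2 * pi * r / sqrt (1 - r\<^sup>2)) (at r)"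
        using r by (auto intro!: derivative_eq_intros simp: field_simps)
      show "isCont (\<lambda>r. 2 * pi * r / sqrt (1 - r\<^sup>2)) r"
        using r by (auto intro!: continuous_intros)
    next
      show "(((\<lambda>r. - 2 * pi * sqrt (1 - r\<^sup>2)) \<circ> real_of_ereal) \<longlongrightarrow> - 2 * pi) (at_right 0)"
        unfolding zero_ereal_def ereal_tendsto_simps1 by (auto intro!: tendsto_eq_intros)
      show "(((\<lambda>r. - 2 * pi * sqrt (1 - r\<^sup>2)) \<circ> real_of_ereal) \<longlongrightarrow> 0) (at_left 1)"
        unfolding one_ereal_def ereal_tendsto_simps1 by (auto intro!: tendsto_eq_intros)
    qed (auto intro!: AE_I2 simp: power_le_one)
    then show ?thesis
      unfolding set_integrable_def integrable_iff_bounded by simp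
  qed
  finally show "(\<integral>\<^sup>+\<xi>. ennreal (wave_weight \<xi>) \<partial>lborel) < \<infinity>" .
qed auto

section \<open>The nonlinear term\<close>

text \<open>With values in \<open>ennreal\<close> no finiteness has to be shown: the iteration only
  handles lower bounds. No upper limit for \<open>\<tau>\<close> is needed because the ball is empty
  for \<open>\<tau> \<ge> s\<close>.\<close>

definition cone_mass :: "real \<Rightarrow> ((real^2) \<times> real \<Rightarrow> real) \<Rightarrow> real \<Rightarrow> ennreal" where
  "cone_mass p F s = (\<integral>\<^sup>+\<tau>. indicator {0..} \<tau> * ennreal (1 / (1 + \<tau>) powr (p - 1)) *
     (\<integral>\<^sup>+y. ennreal (F (y, \<tau>)) * indicator (ball 0 (s - \<tau>)) y \<partial>lborel) \<partial>lborel)"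

lemma borel_measurable_slice:
  fixes F :: "(real^2) \<times> real \<Rightarrow> real"
  assumes "continuous_on (UNIV \<times> S) F" "\<tau> \<in> S"
  shows "(\<lambda>y. F (y, \<tau>)) \<in> borel_measurable borel"
  by (intro borel_measurable_continuous_onI continuous_on_compose2[OF assms(1)] continuous_intros)
     (use assms in auto)

text \<open>With \<open>y = x + (t - \<tau>) \<xi>\<close> the kernel of \<open>wave_L\<close> becomes \<open>((t - \<tau>)\<^sup>2 - |x - y|\<^sup>2) powr (- 1 / 2)\<close>.
  Where \<open>\<tau> + |y| < t - |x|\<close> and \<open>|y| \<le> \<tau> + k\<close>, it is at least \<open>1 / (2 * sqrt (t\<^sup>2 - |x|\<^sup>2))\<close>.\<close>

lemma wave_L_ge:
  fixes F :: "(real^2) \<times> real \<Rightarrow> real"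
  assumes F: "continuous_on (UNIV \<times> {0..t}) F" "\<And>z. 0 \<le> F z"
    and supp: "\<And>y \<tau>. \<lbrakk>0 \<le> \<tau>; \<tau> \<le> t; \<tau> + k < norm y\<rbrakk> \<Longrightarrow> F (y, \<tau>) = 0"
    and x: "norm x < t" "k \<le> t - norm x"
    and M: "0 \<le> M" "ennreal M \<le> cone_mass p F (t - norm x)"
  shows "M / (4 * pi * sqrt (t\<^sup>2 - (norm x)\<^sup>2)) \<le> wave_L p F x t"
proof -
  define \<rho> where "\<rho> = 2 * sqrt (t\<^sup>2 - (norm x)\<^sup>2)"
  \<comment> \<open>Truncation to the closed slab makes \<open>F\<close>, known to be continuous
    only there, jointly Borel measurable on the whole space.\<close>
  define Fe where "Fe = (\<lambda>z. indicator (UNIV \<times> {0..t}) z *\<^sub>R F z)"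
  have "0 < t" using x norm_ge_zero[of x] by linarith
  have \<rho>: "0 < \<rho>" unfolding \<rho>_def using x by (simp add: power_strict_mono)
  have [measurable]: "Fe \<in> borel_measurable (borel \<Otimes>\<^sub>M borel)"
    unfolding Fe_def borel_prod
    by (intro borel_measurable_continuous_on_indicator borel_closed closed_Times F) auto
  have Fe_nonneg: "0 \<le> Fe z" for z using F by (simp add: Fe_def)
  have "compact (F ` (cball 0 (norm x + t) \<times> {0..t}))"
    by (intro compact_continuous_image continuous_on_subset[OF F(1)] compact_Times) auto
  then have "bdd_above (F ` (cball 0 (norm x + t) \<times> {0..t}))"
    by (intro bounded_imp_bdd_above compact_imp_bounded)
  then obtain B where B: "\<And>y \<tau>. \<lbrakk>norm y \<le> norm x + t; \<tau> \<in> {0..t}\<rbrakk> \<Longrightarrow> F (y, \<tau>) \<le> B"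
    by (force simp: bdd_above_def)
  have "0 \<le> B" using B[of 0 0] F(2)[of "(0,0)"] \<open>0 < t\<close> by (auto intro: order_trans)
  define N where "N \<tau> = (LINT \<xi>|lborel. Fe (x + (t - \<tau>) *\<^sub>R \<xi>, \<tau>) * wave_weight \<xi>)" for \<tau>
  define W where "W = (LINT \<xi>|lborel. wave_weight \<xi>)"
  have "0 \<le> W" unfolding W_def by simp
  \<comment> \<open>For \<open>|\<xi>| \<le> 1\<close> the point
    \<open>x + (t - \<tau>) \<xi>\<close> stays in the disc of radius \<open>|x| + t\<close>, so
    only values of \<open>F\<close> on a compact cylinder enter.\<close>
  have bound: "Fe (x + (t - \<tau>) *\<^sub>R \<xi>, \<tau>) * wave_weight \<xi> \<le> B * wave_weight \<xi>" for \<tau> \<xi>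
  proof (cases "\<tau> \<in> {0..t} \<and> norm \<xi> \<le> 1")
    case True
    then have "norm (x + (t - \<tau>) *\<^sub>R \<xi>) \<le> norm x + (t - \<tau>) * norm \<xi>"
      by (intro order_trans[OF norm_triangle_ineq]) auto
    also have "\<dots> \<le> norm x + t" using True \<open>0 < t\<close>
      by (intro add_left_mono order_trans[OF mult_mono[of "t - \<tau>" t "norm \<xi>" 1]]) auto
    finally show ?thesis using B True by (intro mult_right_mono) (auto simp: Fe_def)
  next
    case False
    then have "Fe (x + (t - \<tau>) *\<^sub>R \<xi>, \<tau>) * wave_weight \<xi> = 0"
      by (auto simp: Fe_def wave_weight_def indicator_def)
    moreover have "0 \<le> B * wave_weight \<xi>" using \<open>0 \<le> B\<close> by simp
    ultimately show ?thesis by linarith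
  qed
  have intN: "integrable lborel (\<lambda>\<xi>. Fe (x + (t - \<tau>) *\<^sub>R \<xi>, \<tau>) * wave_weight \<xi>)" for \<tau>
    by (rule Bochner_Integration.integrable_bound[of _ "\<lambda>\<xi>. B * wave_weight \<xi>"])
       (use bound Fe_nonneg integrable_wave_weight \<open>0 \<le> B\<close> in \<open>auto simp: abs_mult intro!: AE_I2\<close>)
  have N_nonneg: "0 \<le> N \<tau>" for \<tau>
    unfolding N_def using Fe_nonneg by (intro Bochner_Integration.integral_nonneg) auto
  have N_le: "N \<tau> \<le> B * W" for \<tau>
  proof -
    have "N \<tau> \<le> (LINT \<xi>|lborel. B * wave_weight \<xi>)"
      unfolding N_def by (intro integral_mono intN bound) (simp add: integrable_wave_weight)
    then show ?thesis by (simp add: W_def)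
  qed
  have [measurable]: "N \<in> borel_measurable borel"
    unfolding N_def by measurable
  define G where "G \<tau> = indicator {0..t} \<tau> * ((t - \<tau>) / (1 + \<tau>) powr (p - 1) * N \<tau>)" for \<tau>
  have G_nonneg: "0 \<le> G \<tau>" for \<tau> using N_nonneg by (auto simp: G_def indicator_def)
  have L: "wave_L p F x t = 1 / (2 * pi) * (LINT \<tau>|lborel. G \<tau>)"
    unfolding wave_L_def set_lebesgue_integral_def G_def N_def
    by (intro arg_cong2[where f="(*)"] refl Bochner_Integration.integral_cong)
       (auto simp: Fe_def wave_weight_def indicator_def if_distrib cong: if_cong
             intro!: Bochner_Integration.integral_cong)
  have "compact ((\<lambda>\<tau>. (t - \<tau>) / (1 + \<tau>) powr (p - 1)) ` {0..t})"
    by (intro compact_continuous_image continuous_intros) auto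
  then have "bdd_above ((\<lambda>\<tau>. (t - \<tau>) / (1 + \<tau>) powr (p - 1)) ` {0..t})"
    by (intro bounded_imp_bdd_above compact_imp_bounded)
  then obtain C where C: "\<And>\<tau>. \<tau> \<in> {0..t} \<Longrightarrow> (t - \<tau>) / (1 + \<tau>) powr (p - 1) \<le> C"
    by (force simp: bdd_above_def)
  have "0 \<le> C" using C[of 0] \<open>0 < t\<close> by auto
  have [measurable]: "G \<in> borel_measurable borel"
    unfolding G_def by measurable
  have intG: "integrable lborel G"
  proof (rule integrableI_bounded_set[where A="{0..t}" and B="C * (B * W)"])
    show "AE \<tau> in lborel. \<tau> \<in> {0..t} \<longrightarrow> norm (G \<tau>) \<le> C * (B * W)"
    proof (intro AE_I2 impI)
      fix \<tau> assume "\<tau> \<in> {0..t}"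
      then have "(t - \<tau>) / (1 + \<tau>) powr (p - 1) * N \<tau> \<le> C * (B * W)"
        using C N_le N_nonneg \<open>0 \<le> C\<close> by (intro mult_mono) auto
      then show "norm (G \<tau>) \<le> C * (B * W)"
        using G_nonneg[of \<tau>] \<open>\<tau> \<in> {0..t}\<close> by (simp add: G_def)
    qed
  qed (use \<open>0 < t\<close> in \<open>auto simp: G_def\<close>)
  \<comment> \<open>From here the time integral of \<open>G\<close> is bounded below by
    \<open>M / \<rho>\<close>. The factor 2 in \<open>\<rho>\<close> and the prefactor
    \<open>1 / (2 * pi)\<close> together make up the constant \<open>4 * pi\<close>.\<close>
  have "ennreal (M / \<rho>) \<le> ennreal (1 / \<rho>) * cone_mass p F (t - norm x)"
  proof -
    have "ennreal (M / \<rho>) = ennreal (1 / \<rho>) * ennreal M" using M \<rho> by (simp add: ennreal_mult'[symmetric])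
    then show ?thesis using M by (simp add: mult_left_mono)
  qed
  also have "\<dots> = (\<integral>\<^sup>+\<tau>. ennreal (1 / \<rho>) * (indicator {0..} \<tau> * ennreal (1 / (1 + \<tau>) powr (p - 1)) *
     (\<integral>\<^sup>+y. ennreal (F (y, \<tau>)) * indicator (ball 0 (t - norm x - \<tau>)) y \<partial>lborel)) \<partial>lborel)"
    unfolding cone_mass_def 
  proof (rule nn_integral_cmult[symmetric])
    \<comment> \<open>Measurability in \<open>\<tau>\<close> is read off from the globally
      measurable \<open>Fe\<close>. The integrands agree, since
      \<open>|y| + \<tau> < t - |x|\<close> has no solution \<open>y\<close> when
      \<open>\<tau> > t\<close>.\<close>
    have "(\<lambda>\<tau>. indicator {0..} \<tau> * ennreal (1 / (1 + \<tau>) powr (p - 1)) *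
      (\<integral>\<^sup>+y. ennreal (F (y, \<tau>)) * indicator (ball 0 (t - norm x - \<tau>)) y \<partial>lborel)) =
      (\<lambda>\<tau>. indicator {0..} \<tau> * ennreal (1 / (1 + \<tau>) powr (p - 1)) *
      (\<integral>\<^sup>+y. ennreal (Fe (y, \<tau>)) * indicator {z. norm (fst z) + snd z < t - norm x} (y, \<tau>) \<partial>lborel))"
      (is "?l = ?r")
    proof
      fix \<tau>
      have "ennreal (F (y, \<tau>)) * indicator (ball 0 (t - norm x - \<tau>)) y =
        ennreal (Fe (y, \<tau>)) * indicator {z. norm (fst z) + snd z < t - norm x} (y, \<tau>)" if "0 \<le> \<tau>" for y
      proof (cases "\<tau> \<le> t")
        case False
        then have "\<not> norm y + \<tau> < t - norm x"
          using norm_ge_zero[of x] norm_ge_zero[of y] by linarith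
        then show ?thesis by (auto simp: indicator_def)
      qed (use that in \<open>auto simp: Fe_def indicator_def\<close>)
      then show "?l \<tau> = ?r \<tau>" by (cases "0 \<le> \<tau>") auto
    qed
    also have "\<dots> \<in> borel_measurable lborel" by measurable
    finally show "?l \<in> borel_measurable lborel" .
  qed
  also have "\<dots> \<le> (\<integral>\<^sup>+\<tau>. ennreal (G \<tau>) \<partial>lborel)"
  proof (rule nn_integral_mono)
    fix \<tau> :: real
    let ?I = "\<integral>\<^sup>+y. ennreal (F (y, \<tau>)) * indicator (ball 0 (t - norm x - \<tau>)) y \<partial>lborel"
    show "ennreal (1 / \<rho>) * (indicator {0..} \<tau> * ennreal (1 / (1 + \<tau>) powr (p - 1)) * ?I) \<le> ennreal (G \<tau>)"
    proof (cases "0 \<le> \<tau> \<and> \<tau> < t - norm x")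
      case True
      define \<sigma> where "\<sigma> = t - \<tau>"
      have "\<tau> < t" using True norm_ge_zero[of x] by linarith
      then have \<sigma>: "0 < \<sigma>" "\<tau> \<in> {0..t}" using True by (auto simp: \<sigma>_def)
      define h where "h = (\<lambda>y. F (y, \<tau>))"
      have [measurable]: "h \<in> borel_measurable borel"
        unfolding h_def using F(1) \<sigma>(2) by (rule borel_measurable_slice)
      have [measurable]: "ball (0::real^2) (t - norm x - \<tau>) \<in> sets borel" by simp
      have "?I = (\<integral>\<^sup>+y. ennreal (h y) * indicator (ball 0 (t - norm x - \<tau>)) y \<partial>lborel)"
        by (simp add: h_def)
      also have "\<dots> = ennreal (\<sigma>\<^sup>2) * (\<integral>\<^sup>+\<xi>. ennreal (h (x + \<sigma> *\<^sub>R \<xi>)) *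
          indicator (ball 0 (t - norm x - \<tau>)) (x + \<sigma> *\<^sub>R \<xi>) \<partial>lborel)"
        by (subst nn_integral_affine[where c=\<sigma> and x=x]) (use \<sigma> in auto)
      finally have "ennreal (1 / \<rho>) * ?I = (\<integral>\<^sup>+\<xi>. ennreal (1 / \<rho>) * ennreal (\<sigma>\<^sup>2) * (ennreal (h (x + \<sigma> *\<^sub>R \<xi>)) *
          indicator (ball 0 (t - norm x - \<tau>)) (x + \<sigma> *\<^sub>R \<xi>)) \<partial>lborel)"
        by (subst nn_integral_cmult) (auto simp: mult.assoc)
      also have "\<dots> \<le> (\<integral>\<^sup>+\<xi>. ennreal \<sigma> * ennreal (Fe (x + (t - \<tau>) *\<^sub>R \<xi>, \<tau>) * wave_weight \<xi>) \<partial>lborel)"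
      proof (rule nn_integral_mono)
        fix \<xi> :: "real^2"
        show "ennreal (1 / \<rho>) * ennreal (\<sigma>\<^sup>2) * (ennreal (h (x + \<sigma> *\<^sub>R \<xi>)) *
          indicator (ball 0 (t - norm x - \<tau>)) (x + \<sigma> *\<^sub>R \<xi>)) \<le>
          ennreal \<sigma> * ennreal (Fe (x + (t - \<tau>) *\<^sub>R \<xi>, \<tau>) * wave_weight \<xi>)"
        proof (cases "norm (x + \<sigma> *\<^sub>R \<xi>) < t - norm x - \<tau> \<and> F (x + \<sigma> *\<^sub>R \<xi>, \<tau>) \<noteq> 0")
          case in_ball: True
          have "\<sigma> * norm \<xi> = norm ((x + \<sigma> *\<^sub>R \<xi>) - x)" using \<sigma> by simp
          also have "\<dots> \<le> norm (x + \<sigma> *\<^sub>R \<xi>) + norm x" by (rule norm_triangle_ineq4)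
          also have "\<dots> < \<sigma>" using in_ball by (simp add: \<sigma>_def)
          finally have \<xi>: "norm \<xi> < 1" using \<sigma> by simp
          then have "(norm \<xi>)\<^sup>2 < 1" by (simp add: abs_square_less_1)
          \<comment> \<open>For \<open>y = x + \<sigma> \<xi>\<close> the left side is
            \<open>\<sigma>\<^sup>2 - |y - x|\<^sup>2\<close>, hence at most
            \<open>\<sigma>\<^sup>2 - (|y| - |x|)\<^sup>2\<close>. This splits into a factor at most
            \<open>t + |x|\<close> and a factor at most \<open>2 (t - |x|)\<close>; the latter bound
            rests on \<open>|y| - \<tau> \<le> k \<le> t - |x|\<close>.\<close>
          have le: "\<sigma>\<^sup>2 * (1 - (norm \<xi>)\<^sup>2) \<le> 2 * (t\<^sup>2 - (norm x)\<^sup>2)"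
          proof -
            define y where "y = x + \<sigma> *\<^sub>R \<xi>"
            have y: "norm y + norm x + \<tau> < t" "norm y \<le> \<tau> + k"
              using in_ball supp[of \<tau> y] \<sigma> by (auto simp: y_def not_le[symmetric])
            have "\<sigma>\<^sup>2 * (norm \<xi>)\<^sup>2 = (norm (y - x))\<^sup>2" using \<sigma> by (simp add: y_def power_mult_distrib)
            moreover have "(norm y - norm x)\<^sup>2 \<le> (norm (y - x))\<^sup>2"
              by (metis abs_le_square_iff abs_norm_cancel norm_triangle_ineq3)
            ultimately have "\<sigma>\<^sup>2 * (1 - (norm \<xi>)\<^sup>2) \<le> \<sigma>\<^sup>2 - (norm y - norm x)\<^sup>2"
              by (simp add: algebra_simps)
            also have "\<dots> = (t + norm x - (\<tau> + norm y)) * (t - norm x - (\<tau> - norm y))"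
              by (simp add: \<sigma>_def power2_eq_square algebra_simps)
            also have "\<dots> \<le> (t + norm x) * (2 * (t - norm x))"
            proof (rule mult_mono)
              have "0 \<le> \<tau>" using \<sigma>(2) by simp
              then show "t + norm x - (\<tau> + norm y) \<le> t + norm x" using norm_ge_zero[of y] by linarith
              show "0 \<le> t + norm x" using \<open>0 < t\<close> by simp
              have "norm y - \<tau> \<le> t - norm x" using y(2) x(2) by linarith
              then show "t - norm x - (\<tau> - norm y) \<le> 2 * (t - norm x)" by simp
              show "0 \<le> t - norm x - (\<tau> - norm y)" using y(1) norm_ge_zero[of y] by linarith
            qed
            also have "\<dots> = 2 * (t\<^sup>2 - (norm x)\<^sup>2)" by (simp add: power2_eq_square algebra_simps)
            finally show ?thesis .
          qed
          have "\<sigma> * sqrt (1 - (norm \<xi>)\<^sup>2) \<le> \<rho>"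
          proof (rule power2_le_imp_le)
            show "(\<sigma> * sqrt (1 - (norm \<xi>)\<^sup>2))\<^sup>2 \<le> \<rho>\<^sup>2"
            proof -
              have "(norm x)\<^sup>2 \<le> t\<^sup>2" using x by (intro power_mono) auto
              then show ?thesis using le \<open>(norm \<xi>)\<^sup>2 < 1\<close> by (simp add: \<rho>_def power_mult_distrib)
            qed
          qed (use \<rho> in simp)
          then have "\<sigma> / \<rho> \<le> 1 / sqrt (1 - (norm \<xi>)\<^sup>2)"
            using \<rho> \<open>(norm \<xi>)\<^sup>2 < 1\<close> by (simp add: field_simps)
          then have "\<sigma> / \<rho> \<le> wave_weight \<xi>" using \<xi> by (simp add: wave_weight_def)
          then have "\<sigma> * F (x + \<sigma> *\<^sub>R \<xi>, \<tau>) * (\<sigma> / \<rho>) \<le> \<sigma> * F (x + \<sigma> *\<^sub>R \<xi>, \<tau>) * wave_weight \<xi>"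
            using \<sigma> F by (intro mult_left_mono) auto
          then have "1 / \<rho> * \<sigma>\<^sup>2 * F (x + \<sigma> *\<^sub>R \<xi>, \<tau>) \<le> \<sigma> * (F (x + \<sigma> *\<^sub>R \<xi>, \<tau>) * wave_weight \<xi>)"
            by (simp add: power2_eq_square mult_ac)
          then show ?thesis
            using in_ball \<sigma> F \<rho> by (simp add: h_def Fe_def \<sigma>_def[symmetric] ennreal_mult'[symmetric] ennreal_leI)
        qed (auto simp: h_def indicator_def)
      qed
      also have "\<dots> = ennreal (\<sigma> * N \<tau>)"
      proof -
        have "(\<integral>\<^sup>+\<xi>. ennreal (Fe (x + (t - \<tau>) *\<^sub>R \<xi>, \<tau>) * wave_weight \<xi>) \<partial>lborel) = ennreal (N \<tau>)"
          unfolding N_def using intN[of \<tau>] Fe_nonneg by (intro nn_integral_eq_integral) auto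
        moreover have "(\<lambda>\<xi>. ennreal (Fe (x + (t - \<tau>) *\<^sub>R \<xi>, \<tau>) * wave_weight \<xi>)) \<in> borel_measurable lborel"
          by measurable
        ultimately show ?thesis using \<sigma> by (simp only: nn_integral_cmult ennreal_mult' less_imp_le)
      qed
      finally have "ennreal (1 / (1 + \<tau>) powr (p - 1)) * (ennreal (1 / \<rho>) * ?I) \<le>
          ennreal (1 / (1 + \<tau>) powr (p - 1)) * ennreal (\<sigma> * N \<tau>)"
        by (rule mult_left_mono) simp
      then show ?thesis
        using True \<sigma> N_nonneg by (simp add: G_def \<sigma>_def ennreal_mult'[symmetric] mult_ac)
    next
      case False
      then have "?I = 0 \<or> indicator {0..} \<tau> = (0::ennreal)"
        by (auto simp: ball_empty)
      then show ?thesis by auto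
    qed
  qed
  also have "\<dots> = ennreal (LINT \<tau>|lborel. G \<tau>)"
    using intG G_nonneg by (intro nn_integral_eq_integral) auto
  finally have "M / \<rho> \<le> (LINT \<tau>|lborel. G \<tau>)"
    using G_nonneg by (simp add: Bochner_Integration.integral_nonneg)
  then show ?thesis using \<rho> by (simp add: L \<rho>_def field_simps)
qed

section \<open>The cone mass\<close>

lemma cone_mass_mono: "s \<le> s' \<Longrightarrow> cone_mass p F s \<le> cone_mass p F s'"
  unfolding cone_mass_def
  by (intro nn_integral_mono mult_left_mono) (auto split: split_indicator)

lemma cone_mass_ge_slices:
  assumes "0 \<le> a"
    and h: "\<And>\<tau>. \<tau> \<in> {a..c} \<Longrightarrow> 0 \<le> h \<tau>"
    and slice: "\<And>\<tau>. \<tau> \<in> {a..c} \<Longrightarrow> ennreal (h \<tau>) \<le> (\<integral>\<^sup>+y. ennreal (F (y, \<tau>)) * indicator (ball 0 (s - \<tau>)) y \<partial>lborel)"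
  shows "(\<integral>\<^sup>+\<tau>. ennreal (h \<tau> / (1 + \<tau>) powr (p - 1)) * indicator {a..c} \<tau> \<partial>lborel) \<le> cone_mass p F s"
  unfolding cone_mass_def
proof (rule nn_integral_mono)
  fix \<tau> :: real
  let ?I = "\<integral>\<^sup>+y. ennreal (F (y, \<tau>)) * indicator (ball 0 (s - \<tau>)) y \<partial>lborel"
  show "ennreal (h \<tau> / (1 + \<tau>) powr (p - 1)) * indicator {a..c} \<tau> \<le>
      indicator {0..} \<tau> * ennreal (1 / (1 + \<tau>) powr (p - 1)) * ?I"
  proof (cases "\<tau> \<in> {a..c}")
    case True
    have "ennreal (h \<tau> / (1 + \<tau>) powr (p - 1)) = ennreal (1 / (1 + \<tau>) powr (p - 1)) * ennreal (h \<tau>)"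
      using h[OF True] by (simp add: ennreal_mult'[symmetric])
    also have "\<dots> \<le> ennreal (1 / (1 + \<tau>) powr (p - 1)) * ?I"
      by (intro mult_left_mono slice True) simp
    finally show ?thesis using True \<open>0 \<le> a\<close> by simp
  qed simp
qed

text \<open>Since \<open>1 \<le> p\<close> the weight decreases in time, and its value at the end
  \<open>c\<close> serves for the whole interval.\<close>

lemma cone_mass_ge_const:
  assumes "0 \<le> a" "a \<le> c" "0 \<le> K" "1 \<le> p"
    and slice: "\<And>\<tau>. \<tau> \<in> {a..c} \<Longrightarrow> ennreal K \<le> (\<integral>\<^sup>+y. ennreal (F (y, \<tau>)) * indicator (ball 0 (s - \<tau>)) y \<partial>lborel)"
  shows "ennreal (K / (1 + c) powr (p - 1) * (c - a)) \<le> cone_mass p F s"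
proof -
  have "ennreal (K / (1 + c) powr (p - 1) * (c - a)) =
      (\<integral>\<^sup>+\<tau>. ennreal (K / (1 + c) powr (p - 1)) * indicator {a..c} \<tau> \<partial>lborel)"
    using assms by (simp add: nn_integral_cmult_indicator ennreal_mult'[symmetric])
  also have "\<dots> \<le> (\<integral>\<^sup>+\<tau>. ennreal (K / (1 + \<tau>) powr (p - 1)) * indicator {a..c} \<tau> \<partial>lborel)"
  proof (rule nn_integral_mono)
    fix \<tau> :: real
    show "ennreal (K / (1 + c) powr (p - 1)) * indicator {a..c} \<tau> \<le> ennreal (K / (1 + \<tau>) powr (p - 1)) * indicator {a..c} \<tau>"
      using assms by (auto split: split_indicator intro!: ennreal_leI divide_left_mono powr_mono2 mult_pos_pos)
  qed
  also have "\<dots> \<le> cone_mass p F s"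
    by (rule cone_mass_ge_slices) (use assms in auto)
  finally show ?thesis .
qed

section \<open>One step of the iteration\<close>

lemma emeasure_cball_real2: "0 \<le> r \<Longrightarrow> emeasure lborel (cball (x::real^2) r) = ennreal (pi * r\<^sup>2)"
  by (simp add: emeasure_cball unit_ball_vol_2)

text \<open>For \<open>\<tau>\<close> in the second quarter of \<open>[b, s]\<close>, the disc of
  radius \<open>(s - b) / 4\<close> lies both in the region of the lower bound and in the cone of
  height \<open>s\<close>, and there \<open>sqrt (\<tau>\<^sup>2 - |y|\<^sup>2) \<le> 2 * S\<close>.
  Area times duration gives \<open>(pi / 64) * (s - b) ^ 3\<close>, and
  \<open>1 + \<tau> \<le> 4 * S\<close> controls the weight.\<close>

lemma cone_mass_step_subcritical:
  assumes lower: "\<And>y \<tau>. \<lbrakk>b \<le> \<tau> - norm y; \<tau> \<le> s\<rbrakk> \<Longrightarrow> (N / sqrt (\<tau>\<^sup>2 - (norm y)\<^sup>2)) powr p \<le> F (y, \<tau>)"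
    and "1 \<le> p" "1 \<le> S" "S \<le> b" "b < s" "s \<le> 2 * S" "0 \<le> N"
  shows "ennreal ((N / (2 * S)) powr p * (pi / 64) * (s - b) ^ 3 / (4 * S) powr (p - 1)) \<le> cone_mass p F s"
proof -
  define K where "K = (N / (2 * S)) powr p * (pi * ((s - b) / 4)\<^sup>2)"
  have "ennreal (K / (1 + (s + b) / 2) powr (p - 1) * ((s + b) / 2 - (s + 3 * b) / 4)) \<le> cone_mass p F s"
  proof (rule cone_mass_ge_const)
    fix \<tau> assume \<tau>: "\<tau> \<in> {(s + 3 * b) / 4..(s + b) / 2}"
    then have \<tau>': "b < \<tau>" "\<tau> < s" "(s - b) / 4 \<le> \<tau> - b" "\<tau> - b \<le> s - \<tau>" "(s - b) / 4 < s - \<tau>"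
      using assms by auto
    have "ennreal K = (\<integral>\<^sup>+y. ennreal ((N / (2 * S)) powr p) * indicator (cball (0::real^2) ((s - b) / 4)) y \<partial>lborel)"
      using assms by (simp add: K_def nn_integral_cmult_indicator emeasure_cball_real2 ennreal_mult)
    also have "\<dots> \<le> (\<integral>\<^sup>+y. ennreal (F (y, \<tau>)) * indicator (ball 0 (s - \<tau>)) y \<partial>lborel)"
    proof (rule nn_integral_mono)
      fix y :: "real^2"
      show "ennreal ((N / (2 * S)) powr p) * indicator (cball 0 ((s - b) / 4)) y \<le>
          ennreal (F (y, \<tau>)) * indicator (ball 0 (s - \<tau>)) y"
      proof (cases "norm y \<le> (s - b) / 4")
        case True
        have y: "b \<le> \<tau> - norm y" "norm y < s - \<tau>" using True \<tau>' by linarith+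
        then have "norm y < \<tau>" using assms by linarith
        then have pos: "0 < sqrt (\<tau>\<^sup>2 - (norm y)\<^sup>2)" by (simp add: power_strict_mono)
        have "sqrt (\<tau>\<^sup>2 - (norm y)\<^sup>2) \<le> sqrt (\<tau>\<^sup>2)" by (rule real_sqrt_le_mono) simp
        also have "\<dots> \<le> 2 * S" using \<tau>' assms by simp
        finally have "N / (2 * S) \<le> N / sqrt (\<tau>\<^sup>2 - (norm y)\<^sup>2)"
          using assms pos by (intro divide_left_mono) auto
        then have "(N / (2 * S)) powr p \<le> (N / sqrt (\<tau>\<^sup>2 - (norm y)\<^sup>2)) powr p"
          using assms by (intro powr_mono2) auto
        also have "\<dots> \<le> F (y, \<tau>)" using y \<tau>' by (intro lower) auto
        finally show ?thesis using True y by (simp add: ennreal_leI)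
      qed simp
    qed
    finally show "ennreal K \<le> (\<integral>\<^sup>+y. ennreal (F (y, \<tau>)) * indicator (ball 0 (s - \<tau>)) y \<partial>lborel)" .
  qed (use assms in \<open>auto simp: K_def\<close>)
  moreover have "(N / (2 * S)) powr p * (pi / 64) * (s - b) ^ 3 / (4 * S) powr (p - 1) \<le>
      K / (1 + (s + b) / 2) powr (p - 1) * ((s + b) / 2 - (s + 3 * b) / 4)"
  proof -
    have "(N / (2 * S)) powr p * (pi / 64) * (s - b) ^ 3 = K * ((s + b) / 2 - (s + 3 * b) / 4)"
      by (simp add: K_def power2_eq_square power3_eq_cube field_simps)
    moreover have "(1 + (s + b) / 2) powr (p - 1) \<le> (4 * S) powr (p - 1)"
    proof (rule powr_mono2)
      show "1 + (s + b) / 2 \<le> 4 * S" using assms(3,5,6) by (simp add: field_simps)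
    qed (use assms in auto)
    moreover have "0 \<le> K * ((s + b) / 2 - (s + 3 * b) / 4)"
      using assms by (auto simp: K_def intro!: mult_nonneg_nonneg)
    moreover have "0 < 1 + (s + b) / 2"
    proof -
      have "0 < b" "0 < s" using assms(3-5) by linarith+
      then show ?thesis by (intro add_pos_pos divide_pos_pos) auto
    qed
    ultimately have "(N / (2 * S)) powr p * (pi / 64) * (s - b) ^ 3 / (4 * S) powr (p - 1) \<le>
      K * ((s + b) / 2 - (s + 3 * b) / 4) / (1 + (s + b) / 2) powr (p - 1)"
      using assms by (auto intro!: divide_left_mono mult_pos_pos)
    then show ?thesis by simp
  qed
  ultimately show ?thesis
    by (meson ennreal_leI order_trans)
qed

text \<open>In polar coordinates \<open>- pi * ln (\<tau>\<^sup>2 - r\<^sup>2)\<close> is a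
  primitive of the integrand.\<close>

lemma nn_integral_cball_inverse:
  assumes "0 \<le> R" "R < \<tau>"
  shows "(\<integral>\<^sup>+y. ennreal (1 / (\<tau>\<^sup>2 - (norm y)\<^sup>2)) * indicator (cball (0::real^2) R) y \<partial>lborel) =
    ennreal (pi * (ln (\<tau>\<^sup>2) - ln (\<tau>\<^sup>2 - R\<^sup>2)))"
proof -
  let ?g = "\<lambda>r. ennreal (1 / (\<tau>\<^sup>2 - r\<^sup>2)) * indicator {..R} r"
  have pos: "0 < \<tau>\<^sup>2 - r\<^sup>2" if "r \<in> {0..R}" for r
    using that assms by (simp add: power_strict_mono)
  have "(\<integral>\<^sup>+y. ennreal (1 / (\<tau>\<^sup>2 - (norm y)\<^sup>2)) * indicator (cball (0::real^2) R) y \<partial>lborel) =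
      (\<integral>\<^sup>+y. ?g (norm (y::real^2)) \<partial>lborel)"
    by (auto intro!: nn_integral_cong split: split_indicator)
  also have "\<dots> = (\<integral>\<^sup>+r. ennreal (2 * pi * r) * indicator {0..} r * ?g r \<partial>lborel)"
    by (rule nn_integral_radial) measurable
  also have "\<dots> = (\<integral>\<^sup>+r. ennreal (2 * pi * r / (\<tau>\<^sup>2 - r\<^sup>2)) * indicator {0..R} r \<partial>lborel)"
    by (intro nn_integral_cong) (auto split: split_indicator simp: ennreal_mult'[symmetric])
  also have "\<dots> = ennreal (- pi * ln (\<tau>\<^sup>2 - R\<^sup>2) - - pi * ln (\<tau>\<^sup>2 - 0\<^sup>2))"
  proof (rule nn_integral_FTC_Icc)
    fix r assume r: "r \<in> {0..R}"
    show "((\<lambda>r. - pi * ln (\<tau>\<^sup>2 - r\<^sup>2)) has_real_derivative 2 * pi * r / (\<tau>\<^sup>2 - r\<^sup>2)) (at r)"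
      using pos[OF r] by (auto intro!: derivative_eq_intros)
    show "0 \<le> 2 * pi * r / (\<tau>\<^sup>2 - r\<^sup>2)" using pos[OF r] r by simp
  qed (use assms in auto)
  finally show ?thesis by (simp add: algebra_simps)
qed

text \<open>Up to the factor \<open>pi\<close>, the right side is the preceding disc integral for
  \<open>R = \<tau> (1 - exp (- x))\<close>. It is quadratic for small \<open>x\<close> and linear
  for large \<open>x\<close>, hence the minimum.\<close>

lemma ln_kernel_ge:
  fixes x :: real
  assumes "0 < x"
  shows "min x (x\<^sup>2) / 4 \<le> - ln (1 - (1 - exp (- x))\<^sup>2)"
proof -
  define w where "w = exp (- x)"
  have w: "0 < w" "w < 1" using assms by (auto simp: w_def)
  have eq: "1 - (1 - w)\<^sup>2 = w * (2 - w)" by (simp add: power2_eq_square algebra_simps)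
  then have pos: "0 < 1 - (1 - w)\<^sup>2" using w by simp
  show ?thesis
  proof (cases "x \<le> 1")
    \<comment> \<open>Here \<open>1 - exp (- x) \<ge> x / 2\<close>, and
      \<open>- ln (1 - z) \<ge> z\<close> gives the quadratic bound.\<close>
    case True
    have "w \<le> 1 - x / 2"
    proof -
      have "1 + x \<le> exp x" by (rule exp_ge_add_one_self)
      then have "w \<le> 1 / (1 + x)" using assms by (simp add: w_def exp_minus field_simps)
      also have "\<dots> \<le> 1 - x / 2"
      proof -
        have "x * x \<le> x * 1" using True assms by (intro mult_left_mono) auto
        then show ?thesis using assms by (simp add: field_simps)
      qed
      finally show ?thesis .
    qed
    then have "(x / 2)\<^sup>2 \<le> (1 - w)\<^sup>2" using assms by (intro power_mono) auto
    moreover have "ln (1 - (1 - w)\<^sup>2) \<le> (1 - (1 - w)\<^sup>2) - 1" using pos by (rule ln_le_minus_one)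
    ultimately have "x\<^sup>2 / 4 \<le> - ln (1 - (1 - w)\<^sup>2)" by (simp add: power_divide)
    then show ?thesis by (simp add: w_def min_def split: if_splits)
  next
    \<comment> \<open>Here \<open>w (2 - w) \<le> 2 w\<close> gives at least
      \<open>x - ln 2\<close>, and \<open>x - 3/4 \<ge> x / 4\<close> because
      \<open>x > 1\<close>.\<close>
    case False
    have "ln (1 - (1 - w)\<^sup>2) \<le> ln (2 * w)" using pos w by (intro ln_mono) (auto simp: eq)
    also have "\<dots> = ln 2 - x" using w by (simp add: ln_mult w_def)
    also have "\<dots> \<le> 3/4 - x" using ln2_le_25_over_36 by simp
    finally have "x / 4 \<le> - ln (1 - (1 - w)\<^sup>2)" using False by simp
    then show ?thesis by (simp add: w_def min_def split: if_splits)
  qed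
qed

text \<open>For \<open>p = 2\<close> the whole disc \<open>|y| \<le> \<tau> - b\<close> is kept: its
  contribution is controlled by the logarithm of \<open>\<tau> / b\<close>. Time is measured
  logarithmically too: between \<open>b * exp (d / 4)\<close> and \<open>b * exp (d / 2)\<close> the
  weight is at least \<open>1 / (2 * \<tau>)\<close>, which integrates to
  \<open>d / 8\<close>.\<close>

lemma cone_mass_step_critical:
  assumes lower: "\<And>y \<tau>. \<lbrakk>b \<le> \<tau> - norm y; \<tau> \<le> s\<rbrakk> \<Longrightarrow> N\<^sup>2 / (\<tau>\<^sup>2 - (norm y)\<^sup>2) \<le> F (y, \<tau>)"
    and "1 \<le> b" "s = b * exp d" "0 < d"
  shows "ennreal (N\<^sup>2 * pi * (min (d / 4) ((d / 4)\<^sup>2) / 4) * (d / 8)) \<le> cone_mass 2 F s"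
proof -
  define K where "K = N\<^sup>2 * (pi * (min (d / 4) ((d / 4)\<^sup>2) / 4))"
  let ?a = "b * exp (d / 4)" and ?c = "b * exp (d / 2)"
  \<comment> \<open>Positivity of \<open>(exp (d / 2) - 1)\<^sup>2\<close> says that
    \<open>?c\<close> comes before the midpoint of \<open>b\<close> and \<open>s\<close>. Hence
    \<open>\<tau> - b < s - \<tau>\<close> for all times used, and the disc fits into the
    cone.\<close>
  have c_less: "2 * ?c < s + b"
  proof -
    have "0 < (exp (d / 2) - 1)\<^sup>2" using assms by simp
    also have "\<dots> = exp d + 1 - 2 * exp (d / 2)"
      by (simp add: power2_eq_square algebra_simps exp_add[symmetric])
    finally have "b * (2 * exp (d / 2)) < b * (exp d + 1)" using assms by simp
    then show ?thesis using assms by (simp add: algebra_simps)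
  qed
  have "0 \<le> K" using assms by (simp add: K_def)
  have a: "1 < ?a" "b < ?a" "?a < ?c"
  proof -
    show "b < ?a" using assms by simp
    then show "1 < ?a" using assms by linarith
    show "?a < ?c" using assms by simp
  qed
  have "ennreal (K * (d / 8)) = ennreal (K * (1 / 2 * ln ?c) - K * (1 / 2 * ln ?a))"
    using assms by (simp add: ln_mult algebra_simps)
  also have "\<dots> = (\<integral>\<^sup>+\<tau>. ennreal (K * (1 / (2 * \<tau>))) * indicator {?a..?c} \<tau> \<partial>lborel)"
  proof (rule nn_integral_FTC_Icc[symmetric])
    fix \<tau> assume "\<tau> \<in> {?a..?c}"
    then have "0 < \<tau>" using a by auto
    then show "((\<lambda>\<tau>. K * (1 / 2 * ln \<tau>)) has_real_derivative K * (1 / (2 * \<tau>))) (at \<tau>)"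
      by (auto intro!: derivative_eq_intros)
    show "0 \<le> K * (1 / (2 * \<tau>))" using \<open>0 < \<tau>\<close> \<open>0 \<le> K\<close> by simp
  qed (use a in auto)
  also have "\<dots> \<le> (\<integral>\<^sup>+\<tau>. ennreal (K / (1 + \<tau>) powr (2 - 1)) * indicator {?a..?c} \<tau> \<partial>lborel)"
  proof (rule nn_integral_mono)
    fix \<tau> :: real
    show "ennreal (K * (1 / (2 * \<tau>))) * indicator {?a..?c} \<tau> \<le>
        ennreal (K / (1 + \<tau>) powr (2 - 1)) * indicator {?a..?c} \<tau>"
    proof (cases "\<tau> \<in> {?a..?c}")
      case True
      then have "1 < \<tau>" using a by auto
      then have "K / (2 * \<tau>) \<le> K / (1 + \<tau>)" using \<open>0 \<le> K\<close> by (intro divide_left_mono) auto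
      then show ?thesis using True \<open>1 < \<tau>\<close> by (simp add: ennreal_leI)
    qed simp
  qed
  also have "\<dots> \<le> cone_mass 2 F s"
  proof (rule cone_mass_ge_slices)
    fix \<tau> assume \<tau>: "\<tau> \<in> {?a..?c}"
    define R where "R = \<tau> - b"
    have R: "0 \<le> R" "R < \<tau>" "R < s - \<tau>" "\<tau> \<le> s" "0 < \<tau>"
    proof -
      have "b < \<tau>" "2 * \<tau> < s + b" using \<tau> a c_less by (auto simp del: exp_gt_zero)
      then show "0 \<le> R" "R < \<tau>" "R < s - \<tau>" "\<tau> \<le> s" "0 < \<tau>"
        using assms(2) by (auto simp: R_def)
    qed
    have "min (d / 4) ((d / 4)\<^sup>2) / 4 \<le> - ln (1 - (1 - exp (- (d / 4)))\<^sup>2)"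
      using assms by (intro ln_kernel_ge) simp
    also have "\<dots> \<le> - ln (1 - (R / \<tau>)\<^sup>2)"
    proof -
      have "b / \<tau> \<le> exp (- (d / 4))"
        using \<tau> R by (simp add: exp_minus field_simps)
      then have "1 - exp (- (d / 4)) \<le> R / \<tau>" using R by (simp add: R_def diff_divide_distrib)
      then have "(1 - exp (- (d / 4)))\<^sup>2 \<le> (R / \<tau>)\<^sup>2" using assms by (intro power_mono) auto
      moreover have "(R / \<tau>)\<^sup>2 < 1" using R by (simp add: abs_square_less_1)
      ultimately show ?thesis by simp
    qed
    also have "\<dots> = ln (\<tau>\<^sup>2) - ln (\<tau>\<^sup>2 - R\<^sup>2)"
    proof -
      have "0 < \<tau>\<^sup>2 - R\<^sup>2" using R by (simp add: power_strict_mono)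
      moreover have "1 - (R / \<tau>)\<^sup>2 = (\<tau>\<^sup>2 - R\<^sup>2) / \<tau>\<^sup>2" using R by (simp add: field_simps)
      ultimately show ?thesis using R by (simp only: ln_div zero_less_power) simp
    qed
    finally have "K \<le> N\<^sup>2 * (pi * (ln (\<tau>\<^sup>2) - ln (\<tau>\<^sup>2 - R\<^sup>2)))"
      unfolding K_def by (intro mult_left_mono) auto
    then have "ennreal K \<le> ennreal (N\<^sup>2) * ennreal (pi * (ln (\<tau>\<^sup>2) - ln (\<tau>\<^sup>2 - R\<^sup>2)))"
      by (simp add: ennreal_mult'[symmetric] ennreal_leI)
    also have "\<dots> = (\<integral>\<^sup>+y. ennreal (N\<^sup>2) * (ennreal (1 / (\<tau>\<^sup>2 - (norm y)\<^sup>2)) * indicator (cball (0::real^2) R) y) \<partial>lborel)"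
    proof -
      have [measurable]: "cball (0::real^2) R \<in> sets borel" by simp
      show ?thesis
        unfolding nn_integral_cball_inverse[OF R(1,2), symmetric] by (rule nn_integral_cmult[symmetric]) measurable
    qed
    also have "\<dots> \<le> (\<integral>\<^sup>+y. ennreal (F (y, \<tau>)) * indicator (ball 0 (s - \<tau>)) y \<partial>lborel)"
    proof (rule nn_integral_mono)
      fix y :: "real^2"
      show "ennreal (N\<^sup>2) * (ennreal (1 / (\<tau>\<^sup>2 - (norm y)\<^sup>2)) * indicator (cball 0 R) y) \<le>
          ennreal (F (y, \<tau>)) * indicator (ball 0 (s - \<tau>)) y"
      proof (cases "norm y \<le> R")
        case True
        have "N\<^sup>2 / (\<tau>\<^sup>2 - (norm y)\<^sup>2) \<le> F (y, \<tau>)" using True R by (intro lower) (auto simp: R_def)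
        then show ?thesis using True R by (simp add: ennreal_mult'[symmetric] ennreal_leI)
      qed simp
    qed
    finally show "ennreal K \<le> (\<integral>\<^sup>+y. ennreal (F (y, \<tau>)) * indicator (ball 0 (s - \<tau>)) y \<partial>lborel)" .
  qed (use a \<open>0 \<le> K\<close> in auto)
  finally show ?thesis by (simp add: K_def mult_ac)
qed

section \<open>Growth along a bounded sequence of cone heights\<close>

text \<open>The ratio \<open>A = 8 powr (1 / (p - 1))\<close> satisfies
  \<open>A powr (p - 1) = 8\<close>, so \<open>(M * A ^ j) powr p\<close> carries a factor
  \<open>8 ^ j\<close> that cancels the loss \<open>1 / 8 ^ j\<close> of step \<open>j\<close>
  exactly. The condition on \<open>D * M powr (p - 1)\<close> then supplies one further factor
  \<open>A\<close> per step.\<close>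

lemma geometric_growth:
  fixes I :: "real \<Rightarrow> ennreal" and b :: "nat \<Rightarrow> real"
  assumes "1 < p" "0 < M" "0 \<le> D" and start: "8 powr (1 / (p - 1)) \<le> D * M powr (p - 1)"
    and base: "ennreal M \<le> I (b 0)"
    and step: "\<And>j N. \<lbrakk>0 < N; ennreal N \<le> I (b j)\<rbrakk> \<Longrightarrow> ennreal (D * N powr p / 8 ^ j) \<le> I (b (Suc j))"
  shows "ennreal (M * (8 powr (1 / (p - 1))) ^ j) \<le> I (b j)"
proof (induction j)
  case (Suc j)
  define A :: real where "A = 8 powr (1 / (p - 1))"
  have A: "0 < A" "A powr (p - 1) = 8" using \<open>1 < p\<close> by (auto simp: A_def powr_powr)
  have "M * A ^ Suc j = A * (M * A ^ j)" by simp
  also have "\<dots> \<le> D * M powr (p - 1) * (M * A ^ j)"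
    using start A \<open>0 < M\<close> by (intro mult_right_mono) (auto simp: A_def)
  also have "\<dots> = D * (M * A ^ j) powr p / 8 ^ j"
  proof -
    have "(A ^ j) powr p = A ^ j * (A ^ j) powr (p - 1)"
      using A powr_add[of "A ^ j" 1 "p - 1"] by simp
    also have "(A ^ j) powr (p - 1) = (A powr (p - 1)) powr real j"
      using A(1) by (simp add: powr_realpow[symmetric] powr_powr mult.commute)
    also have "\<dots> = 8 ^ j" using A(2) by (simp add: powr_realpow)
    finally have "(A ^ j) powr p = A ^ j * 8 ^ j" .
    moreover have "M powr p = M * M powr (p - 1)"
      using \<open>0 < M\<close> powr_add[of M 1 "p - 1"] by simp
    ultimately show ?thesis using A \<open>0 < M\<close> by (simp add: powr_mult)
  qed
  finally have "ennreal (M * A ^ Suc j) \<le> ennreal (D * (M * A ^ j) powr p / 8 ^ j)"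
    by (rule ennreal_leI)
  also have "\<dots> \<le> I (b (Suc j))"
    using Suc A \<open>0 < M\<close> by (intro step) (auto simp: A_def)
  finally show ?case by (simp add: A_def)
qed (use base in simp)

text \<open>The growth ratio exceeds 1, so the single real number \<open>v\<close> would have to lie
  above an unbounded sequence.\<close>

lemma no_solution_of_growth:
  assumes "1 < p" "0 < M" "0 < q" "0 < t"
    and growth: "\<And>j. ennreal (M * (8 powr (1 / (p - 1))) ^ j) \<le> cone_mass p F t"
    and lower: "\<And>N. \<lbrakk>0 \<le> N; ennreal N \<le> cone_mass p F t\<rbrakk> \<Longrightarrow> q * N / t \<le> v"
  shows False
proof -
  define A :: real where "A = 8 powr (1 / (p - 1))"
  have "1 < A" using \<open>1 < p\<close> by (simp add: A_def)
  then obtain j where j: "v / (q * M / t) < A ^ j" using real_arch_pow by blast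
  have "q * (M * A ^ j) / t \<le> v"
    using growth[of j] \<open>0 < M\<close> \<open>1 < A\<close> by (intro lower) (auto simp: A_def)
  with j show False using assms by (simp add: field_simps)
qed

text \<open>The heights \<open>b j\<close> have increments \<open>(S / 2) / 2 ^ j\<close>, and the
  cube in the iteration step turns the halving into precisely the loss \<open>8 ^ j\<close> that
  geometric growth can absorb. All heights stay below \<open>2 * S\<close>, so the contradiction
  occurs at the origin at time \<open>2 * S\<close>.\<close>

lemma no_solution_subcritical:
  assumes lower: "\<And>x t N. \<lbrakk>S \<le> t - norm x; t < T; 0 \<le> N; ennreal N \<le> cone_mass p (\<lambda>z. \<bar>u z\<bar> powr p) (t - norm x)\<rbrakk>
      \<Longrightarrow> q * N / sqrt (t\<^sup>2 - (norm x)\<^sup>2) \<le> u (x, t)"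
    and "1 < p" "1 \<le> S" "2 * S < T" "0 < q" "0 < M"
    and base: "ennreal M \<le> cone_mass p (\<lambda>z. \<bar>u z\<bar> powr p) S"
    and start: "8 powr (1 / (p - 1)) \<le> (q / (2 * S)) powr p * (pi / 64) * (S / 2) ^ 3 / (4 * S) powr (p - 1) * M powr (p - 1)"
  shows False
proof -
  define b where "b j = S * (2 - 1 / 2 ^ j)" for j :: nat
  let ?F = "\<lambda>z. \<bar>u z\<bar> powr p"
  have b: "S \<le> b j" "b j < 2 * S" "b j < b (Suc j)" "b (Suc j) - b j = (S / 2) / 2 ^ j" for j
  proof -
    show "S \<le> b j" using \<open>1 \<le> S\<close> by (simp add: b_def mult_le_cancel_left1 field_simps)
    show "b j < 2 * S" using \<open>1 \<le> S\<close> by (simp add: b_def field_simps)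
    show "b (Suc j) - b j = (S / 2) / 2 ^ j" by (simp add: b_def field_simps)
    moreover have "0 < (S / 2) / 2 ^ j" using \<open>1 \<le> S\<close> by simp
    ultimately show "b j < b (Suc j)" by linarith
  qed
  have growth: "ennreal (M * (8 powr (1 / (p - 1))) ^ j) \<le> cone_mass p ?F (b j)" for j
  proof (rule geometric_growth[OF \<open>1 < p\<close> \<open>0 < M\<close> _ start])
    show "ennreal M \<le> cone_mass p ?F (b 0)" using base by (simp add: b_def)
    fix j N assume N: "0 < (N::real)" "ennreal N \<le> cone_mass p ?F (b j)"
    have "ennreal ((q * N / (2 * S)) powr p * (pi / 64) * (b (Suc j) - b j) ^ 3 / (4 * S) powr (p - 1)) \<le>
        cone_mass p ?F (b (Suc j))"
    proof (rule cone_mass_step_subcritical)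
      fix y :: "real^2" and \<tau> assume y: "b j \<le> \<tau> - norm y" "\<tau> \<le> b (Suc j)"
      have "S \<le> \<tau> - norm y" "\<tau> < T" using y b(1)[of j] b(2)[of "Suc j"] \<open>2 * S < T\<close> by linarith+
      moreover have "ennreal N \<le> cone_mass p ?F (\<tau> - norm y)"
        using N(2) cone_mass_mono[OF y(1)] by (rule order_trans)
      ultimately have "q * N / sqrt (\<tau>\<^sup>2 - (norm y)\<^sup>2) \<le> u (y, \<tau>)"
        using N by (intro lower) auto
      moreover have "0 \<le> sqrt (\<tau>\<^sup>2 - (norm y)\<^sup>2)"
      proof -
        have "norm y \<le> \<tau>" using y b(1)[of j] \<open>1 \<le> S\<close> by linarith
        then show ?thesis by (simp add: power_mono)
      qed
      ultimately show "(q * N / sqrt (\<tau>\<^sup>2 - (norm y)\<^sup>2)) powr p \<le> \<bar>u (y, \<tau>)\<bar> powr p"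
        using N \<open>0 < q\<close> \<open>1 < p\<close> by (intro powr_mono2) auto
    qed (use b[of j] b(2)[of "Suc j"] \<open>1 < p\<close> \<open>1 \<le> S\<close> N \<open>0 < q\<close> in auto)
    also have "(q * N / (2 * S)) powr p * (pi / 64) * (b (Suc j) - b j) ^ 3 / (4 * S) powr (p - 1) =
        (q / (2 * S)) powr p * (pi / 64) * (S / 2) ^ 3 / (4 * S) powr (p - 1) * N powr p / 8 ^ j"
    proof -
      have "(q * N / (2 * S)) powr p = (q / (2 * S)) powr p * N powr p"
        using N \<open>0 < q\<close> \<open>1 \<le> S\<close> powr_mult[of "q / (2 * S)" N p] by simp
      moreover have "((S / 2) / 2 ^ j) ^ 3 = (S / 2) ^ 3 / 8 ^ j"
        by (simp add: power_divide power_mult[symmetric] mult.commute[of j]) (simp add: power_mult)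
      ultimately show ?thesis by (simp add: b(4) mult_ac)
    qed
    finally show "ennreal ((q / (2 * S)) powr p * (pi / 64) * (S / 2) ^ 3 / (4 * S) powr (p - 1) * N powr p / 8 ^ j) \<le>
        cone_mass p ?F (b (Suc j))" .
  qed (use \<open>1 \<le> S\<close> in auto)
  show False
  proof (rule no_solution_of_growth[where F="?F" and t="2 * S" and v="u (0, 2 * S)" and q=q and M=M and p=p])
    show "ennreal (M * (8 powr (1 / (p - 1))) ^ j) \<le> cone_mass p ?F (2 * S)" for j
      using growth[of j] cone_mass_mono[OF less_imp_le[OF b(2)[of j]]] by (rule order_trans)
    show "q * N / (2 * S) \<le> u (0, 2 * S)" if "0 \<le> N" "ennreal N \<le> cone_mass p ?F (2 * S)" for N
      using lower[of "2 * S" 0 N] that \<open>1 \<le> S\<close> \<open>2 * S < T\<close> by (simp add: power_mult_distrib real_sqrt_mult)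
  qed (use assms in auto)
qed

text \<open>The same scheme on a logarithmic scale: \<open>ln (b j)\<close> has increments
  \<open>\<Sigma> / 2 / 2 ^ j\<close>, which serve as the parameter \<open>d\<close> of the critical
  step.\<close>

lemma no_solution_critical:
  assumes lower: "\<And>x t N. \<lbrakk>exp \<Sigma> \<le> t - norm x; t < T; 0 \<le> N; ennreal N \<le> cone_mass 2 (\<lambda>z. \<bar>u z\<bar> powr 2) (t - norm x)\<rbrakk>
      \<Longrightarrow> q * N / sqrt (t\<^sup>2 - (norm x)\<^sup>2) \<le> u (x, t)"
    and "1 \<le> \<Sigma>" "exp (2 * \<Sigma>) < T" "0 < q" "0 < M"
    and base: "ennreal M \<le> cone_mass 2 (\<lambda>z. \<bar>u z\<bar> powr 2) (exp \<Sigma>)"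
    and start: "8 \<le> q\<^sup>2 * pi * \<Sigma>\<^sup>2 / 4096 * M"
  shows False
proof -
  define b where "b j = exp (\<Sigma> * (2 - 1 / 2 ^ j))" for j :: nat
  let ?F = "\<lambda>z. \<bar>u z\<bar> powr 2"
  have b: "exp \<Sigma> \<le> b j" "b j < exp (2 * \<Sigma>)" "b (Suc j) = b j * exp (\<Sigma> / 2 / 2 ^ j)" "1 \<le> b j" for j
  proof -
    show "exp \<Sigma> \<le> b j" using \<open>1 \<le> \<Sigma>\<close> by (simp add: b_def mult_le_cancel_left1 field_simps)
    then show "1 \<le> b j" using \<open>1 \<le> \<Sigma>\<close> one_le_exp_iff[of \<Sigma>] by linarith
    show "b j < exp (2 * \<Sigma>)" using \<open>1 \<le> \<Sigma>\<close> by (simp add: b_def field_simps)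
    show "b (Suc j) = b j * exp (\<Sigma> / 2 / 2 ^ j)" by (simp add: b_def exp_add[symmetric] field_simps)
  qed
  have growth: "ennreal (M * (8 powr (1 / (2 - 1))) ^ j) \<le> cone_mass 2 ?F (b j)" for j
  proof (rule geometric_growth[where D="q\<^sup>2 * pi * \<Sigma>\<^sup>2 / 4096"])
    show "ennreal M \<le> cone_mass 2 ?F (b 0)" using base by (simp add: b_def)
    show "8 powr (1 / (2 - 1)) \<le> q\<^sup>2 * pi * \<Sigma>\<^sup>2 / 4096 * M powr (2 - 1)" using start \<open>0 < M\<close> by simp
    fix j N assume N: "0 < (N::real)" "ennreal N \<le> cone_mass 2 ?F (b j)"
    define x where "x = \<Sigma> / 2 / 2 ^ j / 4"
    have "0 < x" using \<open>1 \<le> \<Sigma>\<close> by (simp add: x_def)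
    have step: "ennreal ((q * N)\<^sup>2 * pi * (min ((\<Sigma> / 2 / 2 ^ j) / 4) (((\<Sigma> / 2 / 2 ^ j) / 4)\<^sup>2) / 4) * ((\<Sigma> / 2 / 2 ^ j) / 8)) \<le>
        cone_mass 2 ?F (b (Suc j))"
    proof (rule cone_mass_step_critical)
      fix y :: "real^2" and \<tau> assume y: "b j \<le> \<tau> - norm y" "\<tau> \<le> b (Suc j)"
      have "exp \<Sigma> \<le> \<tau> - norm y" "\<tau> < T" using y b(1)[of j] b(2)[of "Suc j"] \<open>exp (2 * \<Sigma>) < T\<close> by linarith+
      moreover have "ennreal N \<le> cone_mass 2 ?F (\<tau> - norm y)"
        using N(2) cone_mass_mono[OF y(1)] by (rule order_trans)
      ultimately have le: "q * N / sqrt (\<tau>\<^sup>2 - (norm y)\<^sup>2) \<le> u (y, \<tau>)"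
        using N by (intro lower) auto
      have pos: "0 < \<tau>\<^sup>2 - (norm y)\<^sup>2"
      proof -
        have "norm y < \<tau>" using y b(4)[of j] by linarith
        then show ?thesis by (simp add: power_strict_mono)
      qed
      have "(q * N / sqrt (\<tau>\<^sup>2 - (norm y)\<^sup>2))\<^sup>2 \<le> (u (y, \<tau>))\<^sup>2"
        using le pos N \<open>0 < q\<close> by (intro power_mono) auto
      then show "(q * N)\<^sup>2 / (\<tau>\<^sup>2 - (norm y)\<^sup>2) \<le> \<bar>u (y, \<tau>)\<bar> powr 2"
        using pos by (simp add: power_divide)
    qed (use b(3)[of j] b(4)[of j] \<open>1 \<le> \<Sigma>\<close> in auto)
    \<comment> \<open>The gain of the step is 1/8 times the smaller of \<open>x\<^sup>2\<close> and
      \<open>x ^ 3\<close>. As \<open>x = \<Sigma> / (8 * 2 ^ j)\<close>, these are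
      \<open>\<Sigma>\<^sup>2 / (64 * 4 ^ j)\<close> and
      \<open>\<Sigma> ^ 3 / (512 * 8 ^ j)\<close>; by \<open>1 \<le> \<Sigma>\<close> both are at
      least \<open>\<Sigma>\<^sup>2 / (512 * 8 ^ j)\<close>, and
      \<open>4096 = 8 * 512\<close>.\<close>
    have "q\<^sup>2 * pi * \<Sigma>\<^sup>2 / 4096 * N powr 2 / 8 ^ j \<le> (q * N)\<^sup>2 * pi * (min x (x\<^sup>2) / 4) * (x / 2)"
    proof -
      have e: "\<Sigma> = 8 * 2 ^ j * x" by (simp add: x_def)
      have "\<Sigma>\<^sup>2 / (512 * 8 ^ j) \<le> x ^ 3"
      proof -
        have "\<Sigma>\<^sup>2 * 1 \<le> \<Sigma>\<^sup>2 * \<Sigma>" using \<open>1 \<le> \<Sigma>\<close> by (intro mult_left_mono) auto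
        also have "\<dots> = 512 * 8 ^ j * x ^ 3"
          unfolding e by (simp add: power_mult_distrib power2_eq_square power3_eq_cube power_mult[symmetric] mult.commute[of j])
             (simp add: power_mult power_mult_distrib[symmetric])
        finally show ?thesis by (simp add: field_simps)
      qed
      moreover have "\<Sigma>\<^sup>2 / (512 * 8 ^ j) \<le> x\<^sup>2"
      proof -
        have "\<Sigma>\<^sup>2 = 64 * 4 ^ j * x\<^sup>2"
          unfolding e by (simp add: power_mult_distrib power2_eq_square power_mult_distrib[symmetric])
        also have "\<dots> \<le> 512 * 8 ^ j * x\<^sup>2"
          by (intro mult_right_mono mult_mono power_mono) auto
        finally show ?thesis by (simp add: field_simps)
      qed
      ultimately have "\<Sigma>\<^sup>2 / (512 * 8 ^ j) \<le> min x (x\<^sup>2) * x"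
        by (simp add: min_def power2_eq_square power3_eq_cube)
      then have "(q * N)\<^sup>2 * pi / 8 * (\<Sigma>\<^sup>2 / (512 * 8 ^ j)) \<le> (q * N)\<^sup>2 * pi / 8 * (min x (x\<^sup>2) * x)"
        by (intro mult_left_mono) auto
      then show ?thesis using N by (simp add: power_mult_distrib field_simps)
    qed
    then have "ennreal (q\<^sup>2 * pi * \<Sigma>\<^sup>2 / 4096 * N powr 2 / 8 ^ j) \<le> ennreal ((q * N)\<^sup>2 * pi * (min x (x\<^sup>2) / 4) * (x / 2))"
      by (rule ennreal_leI)
    also have "\<dots> \<le> cone_mass 2 ?F (b (Suc j))"
      using step by (simp add: x_def)
    finally show "ennreal (q\<^sup>2 * pi * \<Sigma>\<^sup>2 / 4096 * N powr 2 / 8 ^ j) \<le> cone_mass 2 ?F (b (Suc j))" .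
  qed (use assms in auto)
  show False
  proof (rule no_solution_of_growth[where F="?F" and t="exp (2 * \<Sigma>)" and v="u (0, exp (2 * \<Sigma>))" and q=q and M=M and p=2])
    show "ennreal (M * (8 powr (1 / (2 - 1))) ^ j) \<le> cone_mass 2 ?F (exp (2 * \<Sigma>))" for j
      using growth[of j] cone_mass_mono[OF less_imp_le[OF b(2)[of j]]] by (rule order_trans)
    show "q * N / exp (2 * \<Sigma>) \<le> u (0, exp (2 * \<Sigma>))" if "0 \<le> N" "ennreal N \<le> cone_mass 2 ?F (exp (2 * \<Sigma>))" for N
      using lower[of "exp (2 * \<Sigma>)" 0 N] that \<open>1 \<le> \<Sigma>\<close> \<open>exp (2 * \<Sigma>) < T\<close> by simp
  qed (use assms in auto)
qed

section \<open>The free solution\<close>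

lemma wave_R_weight: "wave_R \<phi> x t = t / (2 * pi) * (LINT \<xi>|lborel. \<phi> (x + t *\<^sub>R \<xi>) * wave_weight \<xi>)"
  unfolding wave_R_def set_lebesgue_integral_def wave_weight_def
  by (intro arg_cong2[where f="(*)"] Bochner_Integration.integral_cong)
     (auto simp: indicator_def)

locale initial_profile =
  fixes f :: "real^2 \<Rightarrow> real" and f' :: "real^2 \<Rightarrow> (real^2) \<Rightarrow>\<^sub>L real" and B k :: real
  assumes der: "\<And>x. (f has_derivative blinfun_apply (f' x)) (at x)"
    and bound: "\<And>x. \<bar>f x\<bar> \<le> B" and bound': "\<And>x. norm (f' x) \<le> B"
    and outside: "\<And>x. k < norm x \<Longrightarrow> f x = 0"
    and k: "1 \<le> k"
begin

definition "mass = (LINT x|lborel. f x)"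

definition "W = (LINT \<xi>|lborel. wave_weight \<xi>)"

lemma W_nonneg: "0 \<le> W"
  by (simp add: W_def)

lemma B_nonneg: "0 \<le> B"
  using bound[of 0] by linarith

lemma continuous_f: "continuous_on A f"
  using der by (meson continuous_at_imp_continuous_on has_derivative_continuous)

lemma measurable_f [measurable]: "f \<in> borel_measurable borel"
  by (rule borel_measurable_continuous_onI[OF continuous_f])

lemma f_le_indicator: "\<bar>f y\<bar> \<le> B * indicator (cball 0 k) y"
  using bound[of y] outside[of y] by (auto simp: indicator_def)

lemma integrable_indicator_cball: "integrable lborel (\<lambda>x. C * indicator (cball (0::real^2) R) x :: real)"
  using emeasure_bounded_finite[of "cball (0::real^2) R"] by auto

lemma integrable_f: "integrable lborel f"
  by (rule Bochner_Integration.integrable_bound[OF integrable_indicator_cball[of B k]])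
     (use f_le_indicator in \<open>auto intro!: AE_I2 intro: order_trans[OF _ abs_ge_self]\<close>)

lemma integrable_f_weight: "integrable lborel (\<lambda>\<xi>. f (x + s *\<^sub>R \<xi>) * wave_weight \<xi>)"
  by (rule Bochner_Integration.integrable_bound[of _ "\<lambda>\<xi>. B * wave_weight \<xi>"])
     (use bound B_nonneg integrable_wave_weight in \<open>auto simp: abs_mult intro!: AE_I2 mult_right_mono\<close>)

lemma abs_integral_f_weight_le: "\<bar>LINT \<xi>|lborel. f (x + s *\<^sub>R \<xi>) * wave_weight \<xi>\<bar> \<le> B * W"
proof -
  have "\<bar>LINT \<xi>|lborel. f (x + s *\<^sub>R \<xi>) * wave_weight \<xi>\<bar> \<le> (LINT \<xi>|lborel. \<bar>f (x + s *\<^sub>R \<xi>) * wave_weight \<xi>\<bar>)"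
    by (rule integral_abs_bound)
  also have "\<dots> \<le> (LINT \<xi>|lborel. B * wave_weight \<xi>)"
    by (intro integral_mono integrable_abs integrable_f_weight)
       (use bound integrable_wave_weight in \<open>auto simp: abs_mult intro!: mult_right_mono\<close>)
  finally show ?thesis by (simp add: W_def)
qed

text \<open>The time derivative of \<open>wave_R f x\<close>, carried out under the integral. When
  \<open>f + g = 0\<close> it is the entire free solution.\<close>

definition "free x s = 1 / (2 * pi) * (LINT \<xi>|lborel. f (x + s *\<^sub>R \<xi>) * wave_weight \<xi>) +
   s / (2 * pi) * (LINT \<xi>|lborel. f' (x + s *\<^sub>R \<xi>) \<xi> * wave_weight \<xi>)"

lemma abs_f'_weight_le: "\<bar>f' (x + s *\<^sub>R \<xi>) \<xi> * wave_weight \<xi>\<bar> \<le> B * wave_weight \<xi>"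
proof (cases "norm \<xi> \<le> 1")
  case True
  have "\<bar>f' (x + s *\<^sub>R \<xi>) \<xi>\<bar> \<le> norm (f' (x + s *\<^sub>R \<xi>)) * norm \<xi>"
    by (metis norm_blinfun real_norm_def)
  also have "\<dots> \<le> B * 1" using True bound' B_nonneg by (intro mult_mono) auto
  finally show ?thesis by (simp add: abs_mult mult_right_mono)
next
  case False
  then have "wave_weight \<xi> = 0" by (simp add: wave_weight_def)
  then show ?thesis by simp
qed

text \<open>On the unit disc the directional derivative along \<open>\<xi>\<close> is bounded by
  \<open>B\<close>, so \<open>B * wave_weight \<xi>\<close> is an integrable majorant.\<close>

lemma has_derivative_integral_f_weight:
  "((\<lambda>s. LINT \<xi>|lborel. f (x + s *\<^sub>R \<xi>) * wave_weight \<xi>) has_real_derivative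
     (LINT \<xi>|lborel. f' (x + s *\<^sub>R \<xi>) \<xi> * wave_weight \<xi>)) (at s)"
  "integrable lborel (\<lambda>\<xi>. f' (x + s *\<^sub>R \<xi>) \<xi> * wave_weight \<xi>)"
proof -
  have *: "((\<lambda>s. f (x + s *\<^sub>R \<xi>) * wave_weight \<xi>) has_real_derivative f' (x + s *\<^sub>R \<xi>) \<xi> * wave_weight \<xi>) (at s)"
    for s \<xi>
  proof -
    have "((\<lambda>s. f (x + s *\<^sub>R \<xi>)) has_derivative (\<lambda>h. f' (x + s *\<^sub>R \<xi>) (h *\<^sub>R \<xi>))) (at s)"
      by (rule has_derivative_compose[OF _ der]) (auto intro!: derivative_eq_intros)
    then have "((\<lambda>s. f (x + s *\<^sub>R \<xi>)) has_real_derivative f' (x + s *\<^sub>R \<xi>) \<xi>) (at s)"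
      by (simp add: has_field_derivative_def blinfun.scaleR_right mult_commute_abs)
    then show ?thesis by (rule DERIV_cmult_right)
  qed
  show "((\<lambda>s. LINT \<xi>|lborel. f (x + s *\<^sub>R \<xi>) * wave_weight \<xi>) has_real_derivative
     (LINT \<xi>|lborel. f' (x + s *\<^sub>R \<xi>) \<xi> * wave_weight \<xi>)) (at s)"
    "integrable lborel (\<lambda>\<xi>. f' (x + s *\<^sub>R \<xi>) \<xi> * wave_weight \<xi>)"
    using * integrable_wave_weight
    by (auto intro!: has_real_derivative_integral_dominated[where d=1 and g="\<lambda>\<xi>. B * wave_weight \<xi>"
        and f="\<lambda>\<xi> s. f (x + s *\<^sub>R \<xi>) * wave_weight \<xi>" and f'="\<lambda>\<xi> s. f' (x + s *\<^sub>R \<xi>) \<xi> * wave_weight \<xi>"]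
        integrable_f_weight abs_f'_weight_le)
qed

lemma wave_R_has_derivative: "(wave_R f x has_real_derivative free x s) (at s)"
proof -
  have "((\<lambda>s. s / (2 * pi) * (LINT \<xi>|lborel. f (x + s *\<^sub>R \<xi>) * wave_weight \<xi>)) has_real_derivative free x s) (at s)"
    using DERIV_mult[OF DERIV_cdivide[OF DERIV_ident] has_derivative_integral_f_weight(1)]
    by (simp add: free_def mult.commute)
  then show ?thesis by (simp add: wave_R_weight[abs_def])
qed

lemma wave_free_eq: "(\<And>x. f x + g x = 0) \<Longrightarrow> wave_free f g x t = free x t"
  using wave_R_has_derivative[of x t] by (simp add: wave_free_def DERIV_imp_deriv wave_R_weight[of "\<lambda>x. 0"])

text \<open>A crude bound; it serves as a majorant when the spatial integral is differentiated in
  time.\<close>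

lemma abs_free_le: "\<bar>free x s\<bar> \<le> (1 + \<bar>s\<bar>) * (B * W / (2 * pi))"
proof -
  have "\<bar>LINT \<xi>|lborel. f' (x + s *\<^sub>R \<xi>) \<xi> * wave_weight \<xi>\<bar> \<le> (LINT \<xi>|lborel. \<bar>f' (x + s *\<^sub>R \<xi>) \<xi> * wave_weight \<xi>\<bar>)"
    by (rule integral_abs_bound)
  also have "\<dots> \<le> (LINT \<xi>|lborel. B * wave_weight \<xi>)"
    by (intro integral_mono integrable_abs has_derivative_integral_f_weight(2) abs_f'_weight_le)
       (use integrable_wave_weight in auto)
  finally have "\<bar>LINT \<xi>|lborel. f' (x + s *\<^sub>R \<xi>) \<xi> * wave_weight \<xi>\<bar> \<le> B * W" by (simp add: W_def)
  then have "\<bar>s / (2 * pi) * (LINT \<xi>|lborel. f' (x + s *\<^sub>R \<xi>) \<xi> * wave_weight \<xi>)\<bar> \<le> \<bar>s / (2 * pi)\<bar> * (B * W)"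
    unfolding abs_mult by (rule mult_left_mono) simp
  moreover have "\<bar>1 / (2 * pi) * (LINT \<xi>|lborel. f (x + s *\<^sub>R \<xi>) * wave_weight \<xi>)\<bar> \<le> \<bar>1 / (2 * pi)\<bar> * (B * W)"
    unfolding abs_mult[of "1 / (2 * pi)"] by (intro mult_left_mono abs_integral_f_weight_le) simp
  ultimately have "\<bar>free x s\<bar> \<le> \<bar>1 / (2 * pi)\<bar> * (B * W) + \<bar>s / (2 * pi)\<bar> * (B * W)"
    unfolding free_def by linarith
  also have "\<dots> = (1 + \<bar>s\<bar>) * (B * W / (2 * pi))"
    by (simp add: field_simps)
  finally show ?thesis .
qed

section \<open>Finite propagation and total mass of the free solution\<close>

lemma wave_R_outside:
  assumes "\<bar>s\<bar> + k < norm x" shows "wave_R f x s = 0"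
proof -
  have "f (x + s *\<^sub>R \<xi>) * wave_weight \<xi> = 0" for \<xi>
  proof (cases "norm \<xi> \<le> 1")
    case True
    have "norm x - \<bar>s\<bar> * norm \<xi> \<le> norm (x + s *\<^sub>R \<xi>)"
      using norm_diff_ineq[of x "s *\<^sub>R \<xi>"] by simp
    moreover have "\<bar>s\<bar> * norm \<xi> \<le> \<bar>s\<bar>" using True by (simp add: mult_left_le)
    ultimately show ?thesis using assms outside by simp
  qed (simp add: wave_weight_def)
  then show ?thesis unfolding wave_R_weight by (simp only:) simp
qed

text \<open>\<open>wave_R f x\<close> vanishes on a whole neighbourhood of \<open>t\<close>, hence
  so does its derivative at \<open>t\<close>.\<close>

lemma free_outside:
  assumes "\<bar>t\<bar> + k < norm x" shows "free x t = 0"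
proof -
  have "eventually (\<lambda>s. \<bar>s\<bar> + k < norm x) (nhds t)"
    using assms by (intro eventually_nhds_in_open[of "{s. \<bar>s\<bar> + k < norm x}", simplified] open_Collect_less continuous_intros)
  then have "eventually (\<lambda>s. wave_R f x s = 0) (nhds t)"
    by eventually_elim (rule wave_R_outside)
  then have "((\<lambda>s. 0) has_real_derivative free x t) (at t)"
    using wave_R_has_derivative[of x t] by (rule DERIV_cong_ev[OF refl _ refl, THEN iffD1])
  then show ?thesis using DERIV_unique[OF _ DERIV_const] by blast
qed

text \<open>Fubini reduces the integral to translates of \<open>f\<close>, each of which has the
  integral \<open>mass\<close>.\<close>

lemma wave_R_integral:
  assumes "s \<noteq> 0"
  shows "integrable lborel (\<lambda>x. wave_R f x s)" "(LINT x|lborel. wave_R f x s) = s * (W * mass / (2 * pi))"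
proof -
  have sh: "integrable lborel (\<lambda>x. h (x + s *\<^sub>R \<xi>))" "(LINT x|lborel. h (x + s *\<^sub>R \<xi>)) = (LINT x|lborel. h x)"
    if "integrable lborel h" for h :: "real^2 \<Rightarrow> real" and \<xi>
  proof -
    have *: "lborel = distr lborel borel (\<lambda>x. s *\<^sub>R \<xi> + x)"
      using lborel_affine[of 1 "s *\<^sub>R \<xi>"] by (simp add: density_1)
    have m: "h \<in> borel_measurable borel" using borel_measurable_integrable[OF that] by simp
    show "integrable lborel (\<lambda>x. h (x + s *\<^sub>R \<xi>))"
      using that m by (subst (asm) *) (simp add: integrable_distr_eq add.commute)
    show "(LINT x|lborel. h (x + s *\<^sub>R \<xi>)) = (LINT x|lborel. h x)"
      using m by (subst (2) *) (simp add: integral_distr add.commute)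
  qed
  have int: "integrable (lborel \<Otimes>\<^sub>M lborel) (\<lambda>(\<xi>, x). f (x + s *\<^sub>R \<xi>) * wave_weight \<xi>)"
  proof (rule lborel_pair.Fubini_integrable)
    show "integrable lborel (\<lambda>\<xi>. LINT x|lborel. norm (case (\<xi>, x) of (\<xi>, x) \<Rightarrow> f (x + s *\<^sub>R \<xi>) * wave_weight \<xi>))"
      using sh(2)[OF integrable_abs[OF integrable_f]] integrable_wave_weight by (simp add: abs_mult)
    show "AE \<xi> in lborel. integrable lborel (\<lambda>x. case (\<xi>, x) of (\<xi>, x) \<Rightarrow> f (x + s *\<^sub>R \<xi>) * wave_weight \<xi>)"
      using sh(1)[OF integrable_f] by simp
  qed measurable
  have "integrable lborel (\<lambda>x. LINT \<xi>|lborel. f (x + s *\<^sub>R \<xi>) * wave_weight \<xi>)"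
    using lborel_pair.integrable_snd[OF int] by simp
  then show "integrable lborel (\<lambda>x. wave_R f x s)"
    by (simp add: wave_R_weight)
  have "(LINT x|lborel. LINT \<xi>|lborel. f (x + s *\<^sub>R \<xi>) * wave_weight \<xi>) = W * mass"
    using lborel_pair.Fubini_integral[OF int] sh(2)[OF integrable_f] by (simp add: W_def mass_def)
  then show "(LINT x|lborel. wave_R f x s) = s * (W * mass / (2 * pi))"
    by (simp add: wave_R_weight)
qed

text \<open>The total mass is constant in time, being the derivative of the linear function of time
  found for \<open>wave_R\<close>. On \<open>(0, 2 t)\<close> finite propagation makes the crude
  bound a compactly supported majorant. For \<open>mass > 0\<close> the total is nonnegative, so
  negative mass in the interior must be balanced near the light cone.\<close>

lemma free_integral:
  assumes "0 < t"
  shows "integrable lborel (\<lambda>x. free x t)" "(LINT x|lborel. free x t) = W * mass / (2 * pi)"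
proof -
  define g where "g = (\<lambda>x. (1 + 2 * t) * (B * W / (2 * pi)) * indicator (cball (0::real^2) (2 * t + k)) x)"
  have bd: "\<bar>free x s\<bar> \<le> g x" if "s \<in> ball t t" for x s
  proof (cases "norm x \<le> 2 * t + k")
    case True
    have "\<bar>free x s\<bar> \<le> (1 + \<bar>s\<bar>) * (B * W / (2 * pi))" by (rule abs_free_le)
    also have "\<dots> \<le> (1 + 2 * t) * (B * W / (2 * pi))"
      using that B_nonneg W_nonneg by (intro mult_right_mono) (auto simp: dist_real_def)
    finally show ?thesis using True by (simp add: g_def)
  next
    case False
    then show ?thesis using that free_outside[of s x] by (auto simp: g_def dist_real_def)
  qed
  have int: "integrable lborel (\<lambda>x. wave_R f x s)" if "s \<in> ball t t" for s
    using that by (intro wave_R_integral) (auto simp: dist_real_def)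
  have g: "integrable lborel g" unfolding g_def by (rule integrable_indicator_cball)
  note * = has_real_derivative_integral_dominated[where f="wave_R f" and f'=free and M=lborel, OF assms int wave_R_has_derivative bd g]
  show "integrable lborel (\<lambda>x. free x t)" by (rule *(2))
  have "eventually (\<lambda>s. s \<in> ball t t) (nhds t)"
    using assms by (intro eventually_nhds_in_open) auto
  then have "eventually (\<lambda>s. (LINT x|lborel. wave_R f x s) = s * (W * mass / (2 * pi))) (nhds t)"
    by eventually_elim (rule wave_R_integral, auto simp: dist_real_def)
  then have "((\<lambda>s. s * (W * mass / (2 * pi))) has_real_derivative (LINT x|lborel. free x t)) (at t)"
    using *(1) by (rule DERIV_cong_ev[OF refl _ refl, THEN iffD1])
  moreover have "((\<lambda>s. s * (W * mass / (2 * pi))) has_real_derivative W * mass / (2 * pi)) (at t)"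
    by (auto intro!: derivative_eq_intros)
  ultimately show "(LINT x|lborel. free x t) = W * mass / (2 * pi)"
    by (rule DERIV_unique)
qed


section \<open>The free solution inside the light cone\<close>

text \<open>The support of \<open>f\<close> lies strictly inside the disc of radius \<open>s\<close>
  about \<open>x\<close>. Substituting \<open>y = x + s \<xi>\<close> therefore moves
  \<open>s\<close> out of the argument of \<open>f\<close> and into a kernel that is smooth on that
  support.\<close>

lemma wave_R_inside:
  assumes "norm x + k < s"
  shows "wave_R f x s = 1 / (2 * pi) * (LINT y|lborel. f y * (s\<^sup>2 - (norm (y - x))\<^sup>2) powr (- 1 / 2))"
proof -
  have s: "0 < s" using assms k norm_ge_zero[of x] by linarith
  have *: "f (x + s *\<^sub>R \<xi>) * wave_weight \<xi> = s * (f (x + s *\<^sub>R \<xi>) * (s\<^sup>2 - (norm (x + s *\<^sub>R \<xi> - x))\<^sup>2) powr (- 1 / 2))" for \<xi>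
  proof (cases "norm (x + s *\<^sub>R \<xi>) \<le> k")
    case True
    have "s * norm \<xi> = norm ((x + s *\<^sub>R \<xi>) - x)" using s by simp
    also have "\<dots> \<le> norm (x + s *\<^sub>R \<xi>) + norm x" by (rule norm_triangle_ineq4)
    also have "\<dots> < s" using True assms by simp
    finally have \<xi>: "norm \<xi> < 1" using s by simp
    then have "(norm \<xi>)\<^sup>2 < 1" by (simp add: abs_square_less_1)
    moreover have "s\<^sup>2 - (norm (x + s *\<^sub>R \<xi> - x))\<^sup>2 = s\<^sup>2 * (1 - (norm \<xi>)\<^sup>2)"
      using s by (simp add: power_mult_distrib algebra_simps)
    ultimately have "s * (s\<^sup>2 - (norm (x + s *\<^sub>R \<xi> - x))\<^sup>2) powr (- 1 / 2) = 1 / sqrt (1 - (norm \<xi>)\<^sup>2)"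
      using s by (simp add: powr_minus_divide powr_half_sqrt real_sqrt_mult)
    moreover have "wave_weight \<xi> = 1 / sqrt (1 - (norm \<xi>)\<^sup>2)" using \<xi> by (simp add: wave_weight_def)
    ultimately show ?thesis by (simp only: mult.left_commute[of s])
  next
    case False
    then show ?thesis using outside by simp
  qed
  have "(LINT y|lborel. f y * (s\<^sup>2 - (norm (y - x))\<^sup>2) powr (- 1 / 2)) =
      s\<^sup>2 * (LINT \<xi>|lborel. f (x + s *\<^sub>R \<xi>) * (s\<^sup>2 - (norm (x + s *\<^sub>R \<xi> - x))\<^sup>2) powr (- 1 / 2))"
    by (subst integral_affine[where c=s and x=x]) (use s in auto)
  then show ?thesis
    unfolding wave_R_weight * by (simp add: power2_eq_square)
qed

text \<open>Differentiating the power \<open>- 1 / 2\<close> of the kernel in \<open>s\<close>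
  yields \<open>- s\<close> times its power \<open>- 3 / 2\<close>, and the majorants come from
  staying away from the singularity.\<close>

lemma free_inside:
  assumes "norm x + k < t"
  shows "free x t = - t / (2 * pi) * (LINT y|lborel. f y * (t\<^sup>2 - (norm (y - x))\<^sup>2) powr (- 3 / 2))"
    and "integrable lborel (\<lambda>y. f y * (t\<^sup>2 - (norm (y - x))\<^sup>2) powr (- 3 / 2))"
proof -
  \<comment> \<open>Half of the distance from \<open>t\<close> to \<open>|x| + k\<close>: for
    \<open>s\<close> within \<open>d\<close> of \<open>t\<close> and \<open>|y| \<le> k\<close>,
    both \<open>s - |y - x|\<close> and \<open>s + |y - x|\<close> are at least
    \<open>d\<close>.\<close>
  define d where "d = (t - norm x - k) / 2"
  have d: "0 < d" using assms by (simp add: d_def)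
  have t: "0 < t" using assms k norm_ge_zero[of x] by linarith
  have ball: "norm x + k + d < s" "d < s" "0 < s" "\<bar>s\<bar> \<le> t + d" if "s \<in> ball t d" for s
  proof -
    have "t - d < s" using that by (simp add: dist_real_def)
    moreover have "2 * d = t - norm x - k" by (simp add: d_def)
    ultimately show "norm x + k + d < s" by linarith
    then show "d < s" "0 < s" using k d norm_ge_zero[of x] by linarith+
    then show "\<bar>s\<bar> \<le> t + d" using that by (simp add: dist_real_def)
  qed
  have lower: "d\<^sup>2 \<le> s\<^sup>2 - (norm (y - x))\<^sup>2" if s: "s \<in> ball t d" and "norm y \<le> k" for s y
  proof -
    have "norm (y - x) \<le> norm x + k" using norm_triangle_ineq4[of y x] that(2) by simp
    then have "d * d \<le> (s - norm (y - x)) * (s + norm (y - x))"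
      using ball[OF s] d by (intro mult_mono) (auto intro: add_increasing2)
    then show ?thesis by (simp add: power2_eq_square algebra_simps)
  qed
  have lower': "0 < s\<^sup>2 - (norm (y - x))\<^sup>2" if "s \<in> ball t d" "norm y \<le> k" for s y
    using lower[OF that] d by (meson less_le_trans zero_less_power)
  let ?F = "\<lambda>y s. f y * (s\<^sup>2 - (norm (y - x))\<^sup>2) powr (- 1 / 2)"
  let ?F' = "\<lambda>y s. - s * (f y * (s\<^sup>2 - (norm (y - x))\<^sup>2) powr (- 3 / 2))"
  have int: "integrable lborel (\<lambda>y. ?F y s)" if "s \<in> ball t d" for s
  proof (rule Bochner_Integration.integrable_bound[OF integrable_mult_left[OF integrable_f, of "(d\<^sup>2) powr (- 1 / 2)"]])
    show "AE y in lborel. norm (?F y s) \<le> norm (f y * (d\<^sup>2) powr (- 1 / 2))"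
    proof (intro AE_I2)
      fix y
      show "norm (?F y s) \<le> norm (f y * (d\<^sup>2) powr (- 1 / 2))"
      proof (cases "norm y \<le> k")
        case True
        have "(s\<^sup>2 - (norm (y - x))\<^sup>2) powr (- 1 / 2) \<le> (d\<^sup>2) powr (- 1 / 2)"
          using lower[OF that True] d by (intro powr_mono2') auto
        then show ?thesis by (simp add: abs_mult mult_left_mono)
      qed (use outside in auto)
    qed
  qed measurable
  have der: "(?F y has_real_derivative ?F' y s) (at s)" if "s \<in> ball t d" for y s
  proof (cases "norm y \<le> k")
    case True
    have "((\<lambda>s. (s\<^sup>2 - (norm (y - x))\<^sup>2) powr (- 1 / 2)) has_real_derivative
        (- 1 / 2) * (s\<^sup>2 - (norm (y - x))\<^sup>2) powr (- 1 / 2 - 1) * (2 * s)) (at s)"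
      using lower'[OF that True] by (auto intro!: derivative_eq_intros)
    then have "((\<lambda>s. f y * (s\<^sup>2 - (norm (y - x))\<^sup>2) powr (- 1 / 2)) has_real_derivative
        f y * ((- 1 / 2) * (s\<^sup>2 - (norm (y - x))\<^sup>2) powr (- 1 / 2 - 1) * (2 * s))) (at s)"
      by (rule DERIV_cmult)
    then show ?thesis by (simp add: mult_ac)
  qed (use outside in simp)
  have bd: "\<bar>?F' y s\<bar> \<le> (t + d) * (d\<^sup>2) powr (- 3 / 2) * \<bar>f y\<bar>" if "s \<in> ball t d" for y s
  proof (cases "norm y \<le> k")
    case True
    have "\<bar>s\<bar> * (s\<^sup>2 - (norm (y - x))\<^sup>2) powr (- 3 / 2) \<le> (t + d) * (d\<^sup>2) powr (- 3 / 2)"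
      using lower[OF that True] d t ball[OF that] by (intro mult_mono powr_mono2') auto
    then have "\<bar>s\<bar> * (s\<^sup>2 - (norm (y - x))\<^sup>2) powr (- 3 / 2) * \<bar>f y\<bar> \<le> (t + d) * (d\<^sup>2) powr (- 3 / 2) * \<bar>f y\<bar>"
      by (rule mult_right_mono) simp
    then show ?thesis by (simp add: abs_mult mult_ac)
  qed (use outside in simp)
  have gi: "integrable lborel (\<lambda>y. (t + d) * (d\<^sup>2) powr (- 3 / 2) * \<bar>f y\<bar>)"
    using integrable_f by simp
  note * = has_real_derivative_integral_dominated[where M=lborel and f="?F" and f'="?F'", OF d int der bd gi]
  have "integrable lborel (\<lambda>y. (- t) * (f y * (t\<^sup>2 - (norm (y - x))\<^sup>2) powr (- 3 / 2)))"
    using *(2) by simp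
  then show "integrable lborel (\<lambda>y. f y * (t\<^sup>2 - (norm (y - x))\<^sup>2) powr (- 3 / 2))"
    using t by simp
  have "eventually (\<lambda>s. s \<in> ball t d) (nhds t)"
    using d by (intro eventually_nhds_in_open) auto
  then have ev: "eventually (\<lambda>s. wave_R f x s = 1 / (2 * pi) * (LINT y|lborel. ?F y s)) (nhds t)"
  proof eventually_elim
    case (elim s)
    then show ?case using ball(1)[OF elim] d by (intro wave_R_inside) auto
  qed
  have "((\<lambda>s. 1 / (2 * pi) * (LINT y|lborel. ?F y s)) has_real_derivative free x t) (at t)"
    using wave_R_has_derivative[of x t] by (rule DERIV_cong_ev[OF refl ev refl, THEN iffD1])
  moreover have "((\<lambda>s. 1 / (2 * pi) * (LINT y|lborel. ?F y s)) has_real_derivative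
      1 / (2 * pi) * (LINT y|lborel. ?F' y t)) (at t)"
    by (rule DERIV_cmult[OF *(1)])
  ultimately have "free x t = 1 / (2 * pi) * (LINT y|lborel. ?F' y t)"
    by (rule DERIV_unique)
  then show "free x t = - t / (2 * pi) * (LINT y|lborel. f y * (t\<^sup>2 - (norm (y - x))\<^sup>2) powr (- 3 / 2))"
    by simp
qed

text \<open>The comparison term is the free solution generated by a point mass at the origin. The
  error allowed is half of its size, so \<open>free\<close> has the sign of \<open>- mass\<close>
  and a comparable magnitude at distance \<open>s0\<close> or more from the light cone, measured by
  \<open>t - |x|\<close>.\<close>

definition far_field :: "real \<Rightarrow> bool" where
  "far_field s0 \<longleftrightarrow> 2 * k \<le> s0 \<and> (\<forall>x t. s0 \<le> t - norm x \<longrightarrow>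
     \<bar>free x t + mass / (2 * pi) * t * (t\<^sup>2 - (norm x)\<^sup>2) powr (- 3 / 2)\<bar>
       \<le> \<bar>mass\<bar> / (4 * pi) * t * (t\<^sup>2 - (norm x)\<^sup>2) powr (- 3 / 2))"

text \<open>For \<open>|y| \<le> k\<close> the ratio \<open>q\<close> of
  \<open>t\<^sup>2 - |y - x|\<^sup>2\<close> to \<open>Q\<close> differs from 1 by at most
  \<open>2 k / (t - |x|)\<close>. Continuity of \<open>q powr (- 3 / 2)\<close> at 1 then allows the
  kernel to be replaced by its value at \<open>y = 0\<close>.\<close>

lemma far_field_exists:
  assumes "mass \<noteq> 0"
  shows "\<exists>s0. far_field s0"
proof -
  define A where "A = (LINT y|lborel. \<bar>f y\<bar>)"
  have A: "\<bar>mass\<bar> \<le> A" unfolding A_def mass_def by (rule integral_abs_bound)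
  then have "0 < A" using assms by linarith
  \<comment> \<open>Chosen so that \<open>\<delta> * A = |mass| / 2\<close>, half of the leading
    coefficient.\<close>
  define \<delta> where "\<delta> = \<bar>mass\<bar> / (2 * A)"
  have "0 < \<delta>" using assms \<open>0 < A\<close> by (simp add: \<delta>_def)
  have "isCont (\<lambda>q::real. q powr (- 3 / 2)) 1" by (intro continuous_intros) auto
  then obtain \<eta> where \<eta>: "0 < \<eta>" "\<And>q. \<bar>q - 1\<bar> < \<eta> \<Longrightarrow> \<bar>q powr (- 3 / 2) - 1\<bar> < \<delta>"
    using \<open>0 < \<delta>\<close> unfolding continuous_at_eps_delta by (auto simp: dist_real_def)
  \<comment> \<open>Taking \<open>4 * k\<close> where \<open>2 * k\<close> is the critical value
    leaves room for a strict inequality.\<close>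
  define s0 where "s0 = max (2 * k) (4 * k / \<eta>)"
  have s0: "2 * k \<le> s0" "2 * k < \<eta> * s0"
  proof -
    have "4 * k \<le> \<eta> * s0" using \<eta> by (simp add: s0_def max_def field_simps)
    then show "2 * k < \<eta> * s0" using k by simp
  qed (simp add: s0_def)
  have "\<bar>free x t + mass / (2 * pi) * t * (t\<^sup>2 - (norm x)\<^sup>2) powr (- 3 / 2)\<bar>
        \<le> \<bar>mass\<bar> / (4 * pi) * t * (t\<^sup>2 - (norm x)\<^sup>2) powr (- 3 / 2)" if "s0 \<le> t - norm x" for x t
  proof -
    define Q where "Q = t\<^sup>2 - (norm x)\<^sup>2"
    have xt: "norm x + k < t" "0 < t" "norm x < t" using that s0 k norm_ge_zero[of x] by linarith+
    have Q: "Q = (t - norm x) * (t + norm x)" by (simp add: Q_def power2_eq_square algebra_simps)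
    have "0 < Q" unfolding Q using xt norm_ge_zero[of x] by (intro mult_pos_pos) linarith+
    have pt: "\<bar>f y * ((t\<^sup>2 - (norm (y - x))\<^sup>2) powr (- 3 / 2) - Q powr (- 3 / 2))\<bar> \<le> \<delta> * Q powr (- 3 / 2) * \<bar>f y\<bar>" for y
    proof (cases "norm y \<le> k")
      case True
      define q where "q = (t\<^sup>2 - (norm (y - x))\<^sup>2) / Q"
      have r: "\<bar>norm (y - x) - norm x\<bar> \<le> k" "norm (y - x) + norm x \<le> 2 * norm x + k"
        using True norm_triangle_ineq4[of y x] norm_triangle_ineq3[of "y - x" "- x"] by auto
      have "\<bar>(norm x)\<^sup>2 - (norm (y - x))\<^sup>2\<bar> = \<bar>norm (y - x) - norm x\<bar> * (norm (y - x) + norm x)"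
      proof -
        have "(norm x)\<^sup>2 - (norm (y - x))\<^sup>2 = - ((norm (y - x) - norm x) * (norm (y - x) + norm x))"
          by (simp add: power2_eq_square algebra_simps)
        then show ?thesis by (simp only: abs_minus abs_mult) simp
      qed
      also have "\<dots> \<le> k * (2 * norm x + k)"
        using r k by (intro mult_mono) auto
      also have "\<dots> \<le> k * (2 * (t + norm x))"
      proof (rule mult_left_mono)
        have "k < t" using xt(1) norm_ge_zero[of x] by linarith
        then show "2 * norm x + k \<le> 2 * (t + norm x)" using xt(2) by (simp add: distrib_left)
      qed (use k in simp)
      also have "\<dots> < \<eta> * s0 * (t + norm x)" 
      proof -
        have "0 < t + norm x" using xt(2) norm_ge_zero[of x] by linarith
        from mult_strict_right_mono[OF s0(2) this] show ?thesis by (simp only: mult_ac)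
      qed
      also have "\<dots> \<le> \<eta> * ((t - norm x) * (t + norm x))"

      proof -
        have "0 \<le> t + norm x" using xt(2) norm_ge_zero[of x] by linarith
        from mult_right_mono[OF that this] show ?thesis using \<eta>(1) by (simp add: mult.assoc)
      qed
      finally have "\<bar>(norm x)\<^sup>2 - (norm (y - x))\<^sup>2\<bar> < \<eta> * Q" by (simp add: Q)
      moreover have "q - 1 = ((norm x)\<^sup>2 - (norm (y - x))\<^sup>2) / Q"
        using \<open>0 < Q\<close> by (simp add: q_def field_simps) (simp add: Q_def)
      ultimately have "\<bar>q - 1\<bar> < \<eta>" using \<open>0 < Q\<close> by (simp add: pos_divide_less_eq)
      then have "\<bar>q powr (- 3 / 2) - 1\<bar> \<le> \<delta>" using \<eta>(2) less_imp_le by blast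
      moreover have "0 \<le> t\<^sup>2 - (norm (y - x))\<^sup>2"
      proof -
        have "norm (y - x) \<le> t" using r xt by linarith
        then show ?thesis by (simp add: power_mono)
      qed
      then have "(t\<^sup>2 - (norm (y - x))\<^sup>2) powr (- 3 / 2) = q powr (- 3 / 2) * Q powr (- 3 / 2)"
        using \<open>0 < Q\<close> by (simp add: q_def powr_divide)
      then have "f y * ((t\<^sup>2 - (norm (y - x))\<^sup>2) powr (- 3 / 2) - Q powr (- 3 / 2)) =
          f y * Q powr (- 3 / 2) * (q powr (- 3 / 2) - 1)" by (simp add: algebra_simps)
      then have "\<bar>f y * ((t\<^sup>2 - (norm (y - x))\<^sup>2) powr (- 3 / 2) - Q powr (- 3 / 2))\<bar> =
          \<bar>f y\<bar> * Q powr (- 3 / 2) * \<bar>q powr (- 3 / 2) - 1\<bar>"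
        by (simp only: abs_mult abs_of_nonneg[OF powr_ge_zero])
      ultimately show ?thesis
        using mult_left_mono[of "\<bar>q powr (- 3 / 2) - 1\<bar>" \<delta> "\<bar>f y\<bar> * Q powr (- 3 / 2)"] by (simp add: mult_ac)
    qed (use outside in simp)
    have int: "integrable lborel (\<lambda>y. f y * ((t\<^sup>2 - (norm (y - x))\<^sup>2) powr (- 3 / 2) - Q powr (- 3 / 2)))"
      using free_inside(2)[OF xt(1)] integrable_f by (simp add: right_diff_distrib)
    have "free x t + mass / (2 * pi) * t * Q powr (- 3 / 2) =
        - t / (2 * pi) * (LINT y|lborel. f y * ((t\<^sup>2 - (norm (y - x))\<^sup>2) powr (- 3 / 2) - Q powr (- 3 / 2)))"
      unfolding free_inside(1)[OF xt(1)] right_diff_distrib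
      using free_inside(2)[OF xt(1)] integrable_f
      by (simp add: mass_def[symmetric] right_diff_distrib)
    then have "\<bar>free x t + mass / (2 * pi) * t * Q powr (- 3 / 2)\<bar> =
        t / (2 * pi) * \<bar>LINT y|lborel. f y * ((t\<^sup>2 - (norm (y - x))\<^sup>2) powr (- 3 / 2) - Q powr (- 3 / 2))\<bar>"
      using xt by (simp add: abs_mult)
    also have "\<dots> \<le> t / (2 * pi) * (LINT y|lborel. \<delta> * Q powr (- 3 / 2) * \<bar>f y\<bar>)"
    proof (intro mult_left_mono order_trans[OF integral_abs_bound] integral_mono pt)
      show "integrable lborel (\<lambda>y. \<bar>f y * ((t\<^sup>2 - (norm (y - x))\<^sup>2) powr (- 3 / 2) - Q powr (- 3 / 2))\<bar>)"
        by (rule integrable_abs[OF int])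
    qed (use xt integrable_f in auto)
    also have "\<dots> = \<bar>mass\<bar> / (4 * pi) * t * Q powr (- 3 / 2)"
      using \<open>0 < A\<close> by (simp add: A_def[symmetric] \<delta>_def)
    finally show ?thesis by (simp add: Q_def)
  qed
  with s0 show ?thesis unfolding far_field_def by blast
qed

section \<open>Lower bounds for the L^p norm at a fixed time\<close>

lemma emeasure_annulus:
  assumes "0 \<le> r" "r \<le> R"
  shows "measure lborel (cball (0::real^2) R - cball 0 r) = pi * (R\<^sup>2 - r\<^sup>2)"
    "emeasure lborel (cball (0::real^2) R - cball 0 r) < \<infinity>"
proof -
  have "measure lborel (cball (0::real^2) R - cball 0 r) = measure lborel (cball (0::real^2) R) - measure lborel (cball (0::real^2) r)"
    using assms emeasure_bounded_finite[of "cball (0::real^2) R"] by (intro measure_Diff) auto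
  then show "measure lborel (cball (0::real^2) R - cball 0 r) = pi * (R\<^sup>2 - r\<^sup>2)"
    using assms by (simp add: measure_def emeasure_cball_real2 algebra_simps)
  have "emeasure lborel (cball (0::real^2) R - cball 0 r) \<le> emeasure lborel (cball (0::real^2) R)"
    by (intro emeasure_mono) auto
  also have "\<dots> < \<infinity>" using assms by (simp add: emeasure_cball_real2)
  finally show "emeasure lborel (cball (0::real^2) R - cball 0 r) < \<infinity>" .
qed

text \<open>The exact area \<open>pi * s0 * (2 * t - 3 * s0)\<close> grows linearly in
  \<open>t\<close>, and \<open>s0 \<le> t / 2\<close>.\<close>

lemma annulus_ge:
  assumes "2 * s0 \<le> t" "0 < s0"
  shows "pi * s0 * t / 2 \<le> measure lborel (cball (0::real^2) (t - s0) - cball 0 (t - 2 * s0))"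
proof -
  have "measure lborel (cball (0::real^2) (t - s0) - cball 0 (t - 2 * s0)) = pi * ((t - s0)\<^sup>2 - (t - 2 * s0)\<^sup>2)"
    using assms by (intro emeasure_annulus) auto
  also have "\<dots> = pi * s0 * (2 * t - 3 * s0)" by (simp add: power2_eq_square algebra_simps)
  finally show ?thesis
    using mult_left_mono[of "t / 2" "2 * t - 3 * s0" "pi * s0"] assms by simp
qed

text \<open>On this annulus \<open>t - |x| \<le> 2 * s0\<close> and
  \<open>t + |x| \<le> 2 * t\<close>, so \<open>t\<^sup>2 - |x|\<^sup>2 \<le> 4 * s0 * t\<close>:
  the free solution has size at least of order \<open>t powr (- 1 / 2)\<close> there.\<close>

lemma point_source_ge:
  assumes "2 * s0 \<le> t" "0 < s0" "norm x \<le> t - s0" "t - 2 * s0 \<le> norm x"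
  shows "(4 * s0) powr (- 3 / 2) * t powr (- 1 / 2) \<le> t * (t\<^sup>2 - (norm x)\<^sup>2) powr (- 3 / 2)"
proof -
  have "0 < t" "0 < t - norm x" "0 < t + norm x" using assms norm_ge_zero[of x] by linarith+
  have Q: "t\<^sup>2 - (norm x)\<^sup>2 = (t - norm x) * (t + norm x)" by (simp add: power2_eq_square algebra_simps)
  also have "\<dots> \<le> (2 * s0) * (2 * t)"
    using assms norm_ge_zero[of x] by (intro mult_mono) auto
  finally have "t\<^sup>2 - (norm x)\<^sup>2 \<le> (4 * s0) * t" by simp
  moreover have "0 < t\<^sup>2 - (norm x)\<^sup>2" using Q \<open>0 < t - norm x\<close> \<open>0 < t + norm x\<close> by simp
  ultimately have "((4 * s0) * t) powr (- 3 / 2) \<le> (t\<^sup>2 - (norm x)\<^sup>2) powr (- 3 / 2)"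
    by (intro powr_mono2') auto
  then have "t * ((4 * s0) * t) powr (- 3 / 2) \<le> t * (t\<^sup>2 - (norm x)\<^sup>2) powr (- 3 / 2)"
    using \<open>0 < t\<close> by (intro mult_left_mono) auto
  moreover have "t * ((4 * s0) * t) powr (- 3 / 2) = (4 * s0) powr (- 3 / 2) * (t powr 1 * t powr (- 3 / 2))"
    using assms \<open>0 < t\<close> by (simp add: powr_mult)
  moreover have "t powr 1 * t powr (- 3 / 2) = t powr (- 1 / 2)"
    by (subst powr_add[symmetric]) simp
  ultimately show ?thesis by simp
qed

text \<open>Quantifying over every \<open>v\<close> above the free solution, and over
  \<open>\<epsilon>\<close> and \<open>t\<close>, fixes the constant \<open>c\<close> before any
  solution or amplitude is chosen.\<close>

definition Lp_growth :: "real \<Rightarrow> real \<Rightarrow> real \<Rightarrow> bool" where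
  "Lp_growth p s0 c \<longleftrightarrow> 0 < c \<and> (\<forall>v t \<epsilon>. 2 * s0 \<le> t \<longrightarrow> 0 < \<epsilon> \<longrightarrow> continuous_on UNIV v \<longrightarrow> (\<forall>x. \<epsilon> * free x t \<le> v x) \<longrightarrow>
     ennreal (c * \<epsilon> powr p * t powr (1 - p / 2)) \<le> (\<integral>\<^sup>+x. ennreal (\<bar>v x\<bar> powr p) * indicator (cball 0 (t + k)) x \<partial>lborel))"

text \<open>A pointwise bound of order \<open>\<epsilon> * t powr (- 1 / 2)\<close> on an annulus
  with area of order \<open>t\<close> produces the exponent \<open>1 - p / 2\<close>.\<close>

lemma Lp_growth_negative_mass:
  assumes "mass < 0" "1 \<le> p"
    and "far_field s0"
  shows "\<exists>c. Lp_growth p s0 c"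
proof -
  have s0: "2 * k \<le> s0" and asym: "\<And>x t. s0 \<le> t - norm x \<Longrightarrow>
      \<bar>free x t + mass / (2 * pi) * t * (t\<^sup>2 - (norm x)\<^sup>2) powr (- 3 / 2)\<bar>
        \<le> \<bar>mass\<bar> / (4 * pi) * t * (t\<^sup>2 - (norm x)\<^sup>2) powr (- 3 / 2)"
    using \<open>far_field s0\<close> by (auto simp: far_field_def)
  define c1 where "c1 = - mass / (4 * pi) * (4 * s0) powr (- 3 / 2)"
  have "0 < s0" using s0 k by linarith
  have "0 < c1" using assms \<open>0 < s0\<close> by (simp add: c1_def divide_neg_pos mult_neg_pos)
  have main: "ennreal (c1 powr p * (pi * s0 / 2) * \<epsilon> powr p * t powr (1 - p / 2)) \<le>
      (\<integral>\<^sup>+x. ennreal (\<bar>v x\<bar> powr p) * indicator (cball 0 (t + k)) x \<partial>lborel)"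
    if t: "2 * s0 \<le> t" and \<epsilon>: "0 < \<epsilon>" and v: "\<And>x. \<epsilon> * free x t \<le> v x" for v :: "real^2 \<Rightarrow> real" and t \<epsilon>
  proof -
    define N where "N = cball (0::real^2) (t - s0) - cball 0 (t - 2 * s0)"
    have "0 < t" using t \<open>0 < s0\<close> by linarith
    have Nfin: "emeasure lborel N < \<infinity>" unfolding N_def using t \<open>0 < s0\<close> by (intro emeasure_annulus) auto
    have "c1 powr p * (pi * s0 / 2) * \<epsilon> powr p * t powr (1 - p / 2) = (\<epsilon> * (c1 * t powr (- 1 / 2))) powr p * (pi * s0 * t / 2)"
    proof -
      have "(\<epsilon> * (c1 * t powr (- 1 / 2))) powr p = \<epsilon> powr p * c1 powr p * t powr (- p / 2)"
        using \<epsilon> \<open>0 < c1\<close> by (simp add: powr_mult powr_powr)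
      moreover have "t powr (1 - p / 2) = t powr (- p / 2) * t"
        using \<open>0 < t\<close> powr_add[of t "- p / 2" 1] by simp
      ultimately show ?thesis by simp
    qed
    also have "\<dots> \<le> (\<epsilon> * (c1 * t powr (- 1 / 2))) powr p * measure lborel N"
      unfolding N_def using t \<open>0 < s0\<close> by (intro mult_left_mono annulus_ge) auto
    finally have "ennreal (c1 powr p * (pi * s0 / 2) * \<epsilon> powr p * t powr (1 - p / 2)) \<le>
        ennreal ((\<epsilon> * (c1 * t powr (- 1 / 2))) powr p * measure lborel N)"
      by (rule ennreal_leI)
    also have "\<dots> = (\<integral>\<^sup>+x. ennreal ((\<epsilon> * (c1 * t powr (- 1 / 2))) powr p) * indicator N x \<partial>lborel)"
      using Nfin by (subst nn_integral_cmult_indicator) (auto simp: N_def ennreal_mult emeasure_eq_ennreal_measure)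
    also have "\<dots> \<le> (\<integral>\<^sup>+x. ennreal (\<bar>v x\<bar> powr p) * indicator (cball 0 (t + k)) x \<partial>lborel)"
    proof (rule nn_integral_mono)
      fix x :: "real^2"
      show "ennreal ((\<epsilon> * (c1 * t powr (- 1 / 2))) powr p) * indicator N x \<le>
          ennreal (\<bar>v x\<bar> powr p) * indicator (cball 0 (t + k)) x"
      proof (cases "x \<in> N")
        case True
        then have x: "norm x \<le> t - s0" "t - 2 * s0 \<le> norm x" by (auto simp: N_def)
        define Y where "Y = t * (t\<^sup>2 - (norm x)\<^sup>2) powr (- 3 / 2)"
        have "\<bar>free x t + mass / (2 * pi) * Y\<bar> \<le> \<bar>mass\<bar> / (4 * pi) * Y"
          using asym[of t x] x by (simp add: Y_def mult.assoc)
        have "- (mass / (4 * pi) * Y) \<le> free x t"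
        proof -
          have "mass / (2 * pi) * Y = 2 * (mass / (4 * pi) * Y)" "\<bar>mass\<bar> / (4 * pi) * Y = - (mass / (4 * pi) * Y)"
            using \<open>mass < 0\<close> by auto
          with \<open>\<bar>free x t + mass / (2 * pi) * Y\<bar> \<le> \<bar>mass\<bar> / (4 * pi) * Y\<close> show ?thesis by linarith
        qed
        moreover have "c1 * t powr (- 1 / 2) \<le> - (mass / (4 * pi) * Y)"
          using mult_left_mono[OF point_source_ge[OF t \<open>0 < s0\<close> x], of "- mass / (4 * pi)"] \<open>mass < 0\<close>
          by (simp add: c1_def Y_def mult.assoc divide_nonpos_pos)
        ultimately have "\<epsilon> * (c1 * t powr (- 1 / 2)) \<le> \<epsilon> * free x t"
          using \<epsilon> by (intro mult_left_mono) auto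
        also have "\<dots> \<le> v x" by (rule v)
        finally have "(\<epsilon> * (c1 * t powr (- 1 / 2))) powr p \<le> \<bar>v x\<bar> powr p"
          using \<epsilon> \<open>0 < c1\<close> \<open>1 \<le> p\<close> by (intro powr_mono2) auto
        then show ?thesis using True x k \<open>0 < s0\<close> by (simp add: ennreal_leI)
      qed simp
    qed
    finally show ?thesis .
  qed
  have "0 < c1 powr p * (pi * s0 / 2)" using \<open>0 < c1\<close> \<open>0 < s0\<close> by simp
  with main show ?thesis unfolding Lp_growth_def by blast
qed

text \<open>In the interior the free solution is negative, and a lower bound by it says nothing
  about \<open>|v|\<close>. The estimate uses the shell \<open>E\<close>, where the integral of the
  free solution is at least \<open>c2 * sqrt t\<close> while the area is at most
  \<open>c3 * t\<close>; comparing the two bounds the L^p norm from below.\<close>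

lemma Lp_growth_positive_mass:
  assumes "0 < mass" "1 \<le> p"
    and "far_field s0"
  shows "\<exists>c. Lp_growth p s0 c"
proof -
  have s0: "2 * k \<le> s0" and asym: "\<And>x t. s0 \<le> t - norm x \<Longrightarrow>
      \<bar>free x t + mass / (2 * pi) * t * (t\<^sup>2 - (norm x)\<^sup>2) powr (- 3 / 2)\<bar>
        \<le> \<bar>mass\<bar> / (4 * pi) * t * (t\<^sup>2 - (norm x)\<^sup>2) powr (- 3 / 2)"
    using \<open>far_field s0\<close> by (auto simp: far_field_def)
  define c1 where "c1 = mass / (4 * pi) * (4 * s0) powr (- 3 / 2)"
  define c2 where "c2 = c1 * (pi * s0 / 2)"
  define c3 where "c3 = 2 * pi * (k + s0)"
  have "0 < s0" using s0 k by linarith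
  have "0 < c1" using assms \<open>0 < s0\<close> by (simp add: c1_def)
  then have "0 < c2" "0 < c3" using \<open>0 < s0\<close> k by (auto simp: c2_def c3_def)
  have main: "ennreal ((c2 / (2 * c3)) powr (p - 1) * (c2 / 2) * \<epsilon> powr p * t powr (1 - p / 2)) \<le>
      (\<integral>\<^sup>+x. ennreal (\<bar>v x\<bar> powr p) * indicator (cball 0 (t + k)) x \<partial>lborel)"
    if t: "2 * s0 \<le> t" and \<epsilon>: "0 < \<epsilon>" and cont: "continuous_on UNIV v" and v: "\<And>x. \<epsilon> * free x t \<le> v x"
    for v :: "real^2 \<Rightarrow> real" and t \<epsilon>
  proof -
    define N where "N = cball (0::real^2) (t - s0) - cball 0 (t - 2 * s0)"
    define E where "E = cball (0::real^2) (t + k) - cball 0 (t - s0)"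
    have "0 < t" using t \<open>0 < s0\<close> by linarith
    have sets[measurable]: "N \<in> sets borel" "E \<in> sets borel" "cball (0::real^2) (t - s0) \<in> sets borel" by (auto simp: N_def E_def)
    have Nfin: "emeasure lborel N < \<infinity>" unfolding N_def using t \<open>0 < s0\<close> by (intro emeasure_annulus) auto
    have Efin: "emeasure lborel E < \<infinity>" unfolding E_def using t \<open>0 < s0\<close> k by (intro emeasure_annulus) auto
    have "measure lborel E = pi * ((t + k)\<^sup>2 - (t - s0)\<^sup>2)"
      unfolding E_def using t \<open>0 < s0\<close> k by (intro emeasure_annulus) auto
    also have "\<dots> = pi * (k + s0) * (2 * t + k - s0)" by (simp add: power2_eq_square algebra_simps)
    also have "\<dots> \<le> pi * (k + s0) * (2 * t)" using s0 k \<open>0 < s0\<close> by (intro mult_left_mono) auto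
    finally have E_le: "measure lborel E \<le> c3 * t" by (simp add: c3_def mult_ac)
    note int = free_integral(1)[OF \<open>0 < t\<close>]
    have split: "free x t = indicator E x * free x t + indicator (cball 0 (t - s0)) x * free x t" for x
      using free_outside[of t x] \<open>0 < t\<close> \<open>0 < s0\<close> k by (auto simp: E_def indicator_def)
    have intE: "integrable lborel (\<lambda>x. indicator E x * free x t)"
      "integrable lborel (\<lambda>x. indicator (cball 0 (t - s0)) x * free x t)"
      using integrable_mult_indicator[OF _ int, of E] integrable_mult_indicator[OF _ int, of "cball 0 (t - s0)"] sets by auto
    \<comment> \<open>The free solution is nonpositive on the entire inner disc; the quantitative
      bound is retained only on the annulus \<open>N\<close>.\<close>
    have inner: "indicator (cball 0 (t - s0)) x * free x t \<le> - (c1 * t powr (- 1 / 2)) * indicator N x" for x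
    proof (cases "norm x \<le> t - s0")
      case True
      define Y where "Y = t * (t\<^sup>2 - (norm x)\<^sup>2) powr (- 3 / 2)"
      have "0 \<le> Y" using \<open>0 < t\<close> by (simp add: Y_def)
      have "\<bar>free x t + mass / (2 * pi) * Y\<bar> \<le> \<bar>mass\<bar> / (4 * pi) * Y"
        using asym[of t x] True by (simp add: Y_def mult.assoc)
      moreover have "mass / (2 * pi) * Y = 2 * (mass / (4 * pi) * Y)" "\<bar>mass\<bar> / (4 * pi) * Y = mass / (4 * pi) * Y"
        using \<open>0 < mass\<close> by auto
      ultimately have le: "free x t \<le> - (mass / (4 * pi) * Y)" by linarith
      show ?thesis
      proof (cases "x \<in> N")
        case inN: True
        then have x: "norm x \<le> t - s0" "t - 2 * s0 \<le> norm x" by (auto simp: N_def)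
        have "c1 * t powr (- 1 / 2) \<le> mass / (4 * pi) * Y"
          using mult_left_mono[OF point_source_ge[OF t \<open>0 < s0\<close> x], of "mass / (4 * pi)"] \<open>0 < mass\<close>
          by (simp add: c1_def Y_def mult.assoc)
        then show ?thesis using le True inN by simp
      next
        case False
        have "0 \<le> mass / (4 * pi) * Y" using \<open>0 < mass\<close> \<open>0 \<le> Y\<close> by simp
        then show ?thesis using le True False by simp
      qed
    qed (auto simp: N_def)
    have "c2 * t powr (1 / 2) = c1 * t powr (- 1 / 2) * (pi * s0 * t / 2)"
    proof -
      have "t powr (1 / 2) = t powr (- 1 / 2) * t" using \<open>0 < t\<close> powr_add[of t "- 1 / 2" 1] by simp
      then show ?thesis by (simp add: c2_def)
    qed
    also have "\<dots> \<le> c1 * t powr (- 1 / 2) * measure lborel N"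
      unfolding N_def using t \<open>0 < s0\<close> \<open>0 < c1\<close> by (intro mult_left_mono annulus_ge) auto
    also have "\<dots> = - (LINT x|lborel. - (c1 * t powr (- 1 / 2)) * indicator N x)"
      using sets Nfin by simp
    also have "\<dots> \<le> - (LINT x|lborel. indicator (cball 0 (t - s0)) x * free x t)"
    proof -
      have "integrable lborel (\<lambda>x. - (c1 * t powr (- 1 / 2)) * indicator N x)"
        using sets Nfin by (intro integrable_mult_right) auto
      from integral_mono[OF intE(2) this inner] show ?thesis by simp
    qed
    also have "\<dots> \<le> (LINT x|lborel. indicator E x * free x t)"
    proof -
      have "(LINT x|lborel. free x t) = (LINT x|lborel. indicator E x * free x t) +
          (LINT x|lborel. indicator (cball 0 (t - s0)) x * free x t)"
        using Bochner_Integration.integral_add[OF intE] split by simp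
      moreover have "0 \<le> (LINT x|lborel. free x t)"
        using free_integral(2)[OF \<open>0 < t\<close>] W_nonneg \<open>0 < mass\<close> by simp
      ultimately show ?thesis by linarith
    qed
    finally have shell: "c2 * t powr (1 / 2) \<le> (LINT x|lborel. indicator E x * free x t)" .
    define P where "P = (\<lambda>x. indicator (cball (0::real^2) (t + k)) x *\<^sub>R (\<bar>v x\<bar> powr p))"
    have intP: "integrable lborel P"
      unfolding P_def using \<open>1 \<le> p\<close>
      by (intro borel_integrable_compact continuous_intros continuous_on_powr' continuous_on_subset[OF cont]) auto
    \<comment> \<open>Splitting \<open>|v|\<close> at the level \<open>\<mu>\<close> replaces the
      inequality of Hoelder. With this choice the term \<open>\<mu> * (c3 * t)\<close> for the small
      values is half of \<open>\<epsilon> * c2 * sqrt t\<close>.\<close>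
    define \<mu> where "\<mu> = \<epsilon> * c2 * t powr (- 1 / 2) / (2 * c3)"
    have "0 < \<mu>" using \<epsilon> \<open>0 < c2\<close> \<open>0 < c3\<close> \<open>0 < t\<close> by (simp add: \<mu>_def)
    have pt: "\<epsilon> * (indicator E x * free x t) \<le> \<mu> powr (1 - p) * P x + \<mu> * indicator E x" for x
    proof (cases "x \<in> E")
      case True
      have "\<bar>v x\<bar> \<le> \<mu> powr (1 - p) * \<bar>v x\<bar> powr p + \<mu>"
      proof (cases "\<bar>v x\<bar> \<le> \<mu>")
        case False
        have "\<bar>v x\<bar> = \<bar>v x\<bar> powr (1 - p) * \<bar>v x\<bar> powr p"
          using False \<open>0 < \<mu>\<close> by (subst powr_add[symmetric]) simp
        also have "\<dots> \<le> \<mu> powr (1 - p) * \<bar>v x\<bar> powr p"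
          using False \<open>0 < \<mu>\<close> \<open>1 \<le> p\<close> by (intro mult_right_mono powr_mono2') auto
        finally show ?thesis using \<open>0 < \<mu>\<close> by linarith
      qed (auto intro: add_increasing)
      then show ?thesis using True v[of x] by (simp add: P_def E_def)
    qed (auto simp: P_def)
    have "\<epsilon> * (c2 * t powr (1 / 2)) \<le> \<epsilon> * (LINT x|lborel. indicator E x * free x t)"
      using shell \<epsilon> by simp
    also have "\<dots> = (LINT x|lborel. \<epsilon> * (indicator E x * free x t))" by simp
    also have "\<dots> \<le> (LINT x|lborel. \<mu> powr (1 - p) * P x + \<mu> * indicator E x)"
      using intE(1) intP sets Efin by (intro integral_mono pt) auto
    also have "\<dots> = \<mu> powr (1 - p) * (LINT x|lborel. P x) + \<mu> * measure lborel E"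
      using intP sets Efin by simp
    also have "\<dots> \<le> \<mu> powr (1 - p) * (LINT x|lborel. P x) + \<mu> * (c3 * t)"
      using E_le \<open>0 < \<mu>\<close> by simp
    also have "\<mu> * (c3 * t) = \<epsilon> * (c2 * t powr (1 / 2)) / 2"
    proof -
      have "t powr (1 / 2) = t powr (- 1 / 2) * t" using \<open>0 < t\<close> powr_add[of t "- 1 / 2" 1] by simp
      then show ?thesis using \<open>0 < c3\<close> by (simp add: \<mu>_def)
    qed
    finally have "\<epsilon> * (c2 * t powr (1 / 2)) / 2 \<le> \<mu> powr (1 - p) * (LINT x|lborel. P x)" by simp
    then have "\<mu> powr (p - 1) * (\<epsilon> * (c2 * t powr (1 / 2)) / 2) \<le>
        \<mu> powr (p - 1) * (\<mu> powr (1 - p) * (LINT x|lborel. P x))"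
      by (intro mult_left_mono) auto
    also have "\<dots> = (LINT x|lborel. P x)"
      using \<open>0 < \<mu>\<close> by (simp add: mult.assoc[symmetric] powr_add[symmetric])
    finally have "\<mu> powr (p - 1) * (\<epsilon> * (c2 * t powr (1 / 2)) / 2) \<le> (LINT x|lborel. P x)" .
    moreover have "(c2 / (2 * c3)) powr (p - 1) * (c2 / 2) * \<epsilon> powr p * t powr (1 - p / 2) =
        \<mu> powr (p - 1) * (\<epsilon> * (c2 * t powr (1 / 2)) / 2)"
    proof -
      have "\<mu> = \<epsilon> * t powr (- 1 / 2) * (c2 / (2 * c3))" by (simp add: \<mu>_def)
      then have "\<mu> powr (p - 1) = \<epsilon> powr (p - 1) * t powr (- 1 / 2 * (p - 1)) * (c2 / (2 * c3)) powr (p - 1)"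
        using \<epsilon> \<open>0 < c2\<close> \<open>0 < c3\<close> by (simp only: powr_mult powr_powr)
      moreover have "\<epsilon> powr p = \<epsilon> powr (p - 1) * \<epsilon>" using \<epsilon> powr_add[of \<epsilon> "p - 1" 1] by simp
      moreover have "t powr (1 - p / 2) = t powr (- 1 / 2 * (p - 1)) * t powr (1 / 2)"
        by (subst powr_add[symmetric]) (simp add: field_simps)
      ultimately show ?thesis by (simp only:) simp
    qed
    ultimately have "ennreal ((c2 / (2 * c3)) powr (p - 1) * (c2 / 2) * \<epsilon> powr p * t powr (1 - p / 2)) \<le> ennreal (LINT x|lborel. P x)"
      by (intro ennreal_leI) (simp only:)
    also have "\<dots> = (\<integral>\<^sup>+x. ennreal (P x) \<partial>lborel)"
      using intP by (intro nn_integral_eq_integral[symmetric]) (auto simp: P_def)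
    also have "\<dots> = (\<integral>\<^sup>+x. ennreal (\<bar>v x\<bar> powr p) * indicator (cball 0 (t + k)) x \<partial>lborel)"
      by (intro nn_integral_cong) (auto simp: P_def split: split_indicator)
    finally show ?thesis .
  qed
  have "0 < (c2 / (2 * c3)) powr (p - 1) * (c2 / 2)" using \<open>0 < c2\<close> \<open>0 < c3\<close> by simp
  with main show ?thesis unfolding Lp_growth_def by blast
qed

end

section \<open>Solutions of the integral equation\<close>

text \<open>Only times between \<open>s / 8\<close> and \<open>s / 4\<close> are used:
  \<open>16 * s0 \<le> s\<close> gives \<open>\<tau> \<ge> 2 * s0\<close>, and
  \<open>2 * k < s\<close> fits the disc of radius \<open>\<tau> + k\<close> into the cone. Slice,
  duration and weight contribute the exponents \<open>1 - p / 2\<close>, \<open>1\<close> and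
  \<open>- (p - 1)\<close>.\<close>

lemma cone_mass_base_subcritical:
  assumes "1 \<le> p" "p \<le> 2" "0 < c" "0 < \<epsilon>" "0 \<le> k" "0 < s0"
    and lower: "\<And>t. \<lbrakk>2 * s0 \<le> t; t < s\<rbrakk> \<Longrightarrow>
      ennreal (c * \<epsilon> powr p * t powr (1 - p / 2)) \<le> (\<integral>\<^sup>+x. ennreal (F (x, t)) * indicator (cball 0 (t + k)) x \<partial>lborel)"
    and s: "16 * s0 \<le> s" "2 * k < s" "2 \<le> s"
  shows "ennreal (c * 8 powr (p / 2 - 2) * \<epsilon> powr p * s powr (3 - 3 * p / 2)) \<le> cone_mass p F s"
proof -
  define K where "K = c * \<epsilon> powr p * (s / 8) powr (1 - p / 2)"
  have "0 < s" using s by simp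
  have "ennreal (K / (1 + s / 4) powr (p - 1) * (s / 4 - s / 8)) \<le> cone_mass p F s"
  proof (rule cone_mass_ge_const)
    fix \<tau> assume \<tau>: "\<tau> \<in> {s / 8..s / 4}"
    then have \<tau>': "2 * s0 \<le> \<tau>" "\<tau> < s" "\<tau> + k < s - \<tau>" using s by auto
    have "K \<le> c * \<epsilon> powr p * \<tau> powr (1 - p / 2)"
      unfolding K_def using assms \<tau> s by (intro mult_left_mono powr_mono2) auto
    then have "ennreal K \<le> ennreal (c * \<epsilon> powr p * \<tau> powr (1 - p / 2))" by (rule ennreal_leI)
    also have "\<dots> \<le> (\<integral>\<^sup>+x. ennreal (F (x, \<tau>)) * indicator (cball 0 (\<tau> + k)) x \<partial>lborel)"
      by (intro lower \<tau>')
    also have "\<dots> \<le> (\<integral>\<^sup>+x. ennreal (F (x, \<tau>)) * indicator (ball 0 (s - \<tau>)) x \<partial>lborel)"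
      using \<tau>' by (intro nn_integral_mono mult_left_mono) (auto split: split_indicator)
    finally show "ennreal K \<le> (\<integral>\<^sup>+y. ennreal (F (y, \<tau>)) * indicator (ball 0 (s - \<tau>)) y \<partial>lborel)" .
  qed (use assms in \<open>auto simp: K_def\<close>)
  moreover have "c * 8 powr (p / 2 - 2) * \<epsilon> powr p * s powr (3 - 3 * p / 2) \<le>
      K / (1 + s / 4) powr (p - 1) * (s / 4 - s / 8)"
  proof -
    have "c * 8 powr (p / 2 - 2) * \<epsilon> powr p * s powr (3 - 3 * p / 2) = K / s powr (p - 1) * (s / 8)"
    proof -
      have "(s / 8) powr (1 - p / 2) * (s / 8) = (s / 8) powr (2 - p / 2)"
        using \<open>0 < s\<close> powr_add[of "s / 8" "1 - p / 2" 1] by simp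
      also have "\<dots> = s powr (2 - p / 2) * 8 powr (p / 2 - 2)"
        using \<open>0 < s\<close> powr_minus_divide[of 8 "2 - p / 2"] by (simp add: powr_divide)
      finally have "(s / 8) powr (1 - p / 2) * (s / 8) / s powr (p - 1) = 8 powr (p / 2 - 2) * (s powr (2 - p / 2) / s powr (p - 1))"
        by simp
      also have "s powr (2 - p / 2) / s powr (p - 1) = s powr (3 - 3 * p / 2)"
        by (subst powr_diff[symmetric]) (simp add: field_simps)
      finally have "(s / 8) powr (1 - p / 2) * (s / 8) / s powr (p - 1) = 8 powr (p / 2 - 2) * s powr (3 - 3 * p / 2)" .
      then have "c * \<epsilon> powr p * ((s / 8) powr (1 - p / 2) * (s / 8) / s powr (p - 1)) =
          c * \<epsilon> powr p * (8 powr (p / 2 - 2) * s powr (3 - 3 * p / 2))" by simp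
      then show ?thesis by (simp add: K_def mult_ac)
    qed
    also have "\<dots> \<le> K / (1 + s / 4) powr (p - 1) * (s / 8)"
      using assms by (intro mult_right_mono divide_left_mono powr_mono2 mult_pos_pos) (auto simp: K_def)
    finally show ?thesis by simp
  qed
  ultimately show ?thesis by (meson ennreal_leI order_trans)
qed

text \<open>For \<open>p = 2\<close> the slices are bounded below by a constant, and the weight, at
  least \<open>1 / (2 * \<tau>)\<close>, integrates to a logarithm. This logarithm raises the power
  of \<open>\<Sigma>\<close> in the starting condition from 2 to 3.\<close>

lemma cone_mass_base_critical:
  assumes "0 < c" "0 < \<epsilon>" "0 \<le> k" "1 \<le> s0"
    and lower: "\<And>t. \<lbrakk>2 * s0 \<le> t; t < s\<rbrakk> \<Longrightarrow>
      ennreal (c * \<epsilon>\<^sup>2) \<le> (\<integral>\<^sup>+x. ennreal (F (x, t)) * indicator (cball 0 (t + k)) x \<partial>lborel)"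
    and s: "8 * s0 \<le> s" "2 * k < s"
  shows "ennreal (c * \<epsilon>\<^sup>2 / 2 * (ln s - ln (8 * s0))) \<le> cone_mass 2 F s"
proof -
  define K where "K = c * \<epsilon>\<^sup>2"
  have "0 < K" using assms by (simp add: K_def)
  have "c * \<epsilon>\<^sup>2 / 2 * (ln s - ln (8 * s0)) = K / 2 * ln (s / 4) - K / 2 * ln (2 * s0)"
  proof -
    have "ln (8 * s0) = ln 4 + ln (2 * s0)" using \<open>1 \<le> s0\<close> ln_mult[of 4 "2 * s0"] by simp
    moreover have "ln (s / 4) = ln s - ln 4" using assms ln_div[of s 4] by simp
    ultimately show ?thesis by (simp add: K_def distrib_left right_diff_distrib)
  qed
  then have "ennreal (c * \<epsilon>\<^sup>2 / 2 * (ln s - ln (8 * s0))) = ennreal (K / 2 * ln (s / 4) - K / 2 * ln (2 * s0))"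
    by (rule arg_cong)
  also have "\<dots> = (\<integral>\<^sup>+\<tau>. ennreal (K / (2 * \<tau>)) * indicator {2 * s0..s / 4} \<tau> \<partial>lborel)"
  proof (rule nn_integral_FTC_Icc[symmetric])
    fix \<tau> assume "\<tau> \<in> {2 * s0..s / 4}"
    then have "0 < \<tau>" using assms by auto
    then show "((\<lambda>\<tau>. K / 2 * ln \<tau>) has_real_derivative K / (2 * \<tau>)) (at \<tau>)"
      by (auto intro!: derivative_eq_intros)
    show "0 \<le> K / (2 * \<tau>)" using \<open>0 < \<tau>\<close> \<open>0 < K\<close> by simp
  qed (use s in auto)
  also have "\<dots> \<le> (\<integral>\<^sup>+\<tau>. ennreal (K / (1 + \<tau>) powr (2 - 1)) * indicator {2 * s0..s / 4} \<tau> \<partial>lborel)"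
  proof (rule nn_integral_mono)
    fix \<tau> :: real
    show "ennreal (K / (2 * \<tau>)) * indicator {2 * s0..s / 4} \<tau> \<le>
        ennreal (K / (1 + \<tau>) powr (2 - 1)) * indicator {2 * s0..s / 4} \<tau>"
    proof (cases "\<tau> \<in> {2 * s0..s / 4}")
      case True
      then have "1 < \<tau>" using assms by auto
      then have "K / (2 * \<tau>) \<le> K / (1 + \<tau>)" using \<open>0 < K\<close> by (intro divide_left_mono) auto
      then show ?thesis using True \<open>1 < \<tau>\<close> by (simp add: ennreal_leI)
    qed simp
  qed
  also have "\<dots> \<le> cone_mass 2 F s"
  proof (rule cone_mass_ge_slices)
    fix \<tau> assume \<tau>: "\<tau> \<in> {2 * s0..s / 4}"
    then have \<tau>': "2 * s0 \<le> \<tau>" "\<tau> < s" "\<tau> + k < s - \<tau>" using s assms by auto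
    have "ennreal K \<le> (\<integral>\<^sup>+x. ennreal (F (x, \<tau>)) * indicator (cball 0 (\<tau> + k)) x \<partial>lborel)"
      unfolding K_def by (intro lower \<tau>')
    also have "\<dots> \<le> (\<integral>\<^sup>+x. ennreal (F (x, \<tau>)) * indicator (ball 0 (s - \<tau>)) x \<partial>lborel)"
      using \<tau>' by (intro nn_integral_mono mult_left_mono) (auto split: split_indicator)
    finally show "ennreal K \<le> (\<integral>\<^sup>+y. ennreal (F (y, \<tau>)) * indicator (ball 0 (s - \<tau>)) y \<partial>lborel)" .
  qed (use assms \<open>0 < K\<close> in auto)
  finally show ?thesis .
qed

section \<open>Contradiction for a given solution\<close>

locale integral_solution = initial_profile +
  fixes p \<epsilon> T :: real and u :: "(real^2) \<times> real \<Rightarrow> real"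
  assumes p: "1 < p" "p \<le> 2" and eps: "0 < \<epsilon>"
    and cont: "continuous_on (UNIV \<times> {0..<T}) u"
    and support: "\<And>x t. \<lbrakk>0 \<le> t; t < T; t + k < norm x\<rbrakk> \<Longrightarrow> u (x, t) = 0"
    and eq: "\<And>x t. \<lbrakk>0 \<le> t; t < T\<rbrakk> \<Longrightarrow> u (x, t) = \<epsilon> * free x t + wave_L p (\<lambda>z. \<bar>u z\<bar> powr p) x t"
begin

lemma wave_L_nonneg: "0 \<le> wave_L p (\<lambda>z. \<bar>u z\<bar> powr p) x t"
  unfolding wave_L_def set_lebesgue_integral_def
  by (intro mult_nonneg_nonneg Bochner_Integration.integral_nonneg)
     (auto simp: indicator_def power_le_one
        intro!: mult_nonneg_nonneg divide_nonneg_nonneg Bochner_Integration.integral_nonneg)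

lemma eps_free_le: "\<lbrakk>0 \<le> t; t < T\<rbrakk> \<Longrightarrow> \<epsilon> * free x t \<le> u (x, t)"
  using eq wave_L_nonneg by simp

lemma continuous_slice: "\<lbrakk>0 \<le> t; t < T\<rbrakk> \<Longrightarrow> continuous_on UNIV (\<lambda>x. u (x, t))"
  by (intro continuous_on_compose2[OF cont] continuous_intros) auto

lemma wave_L_lower:
  assumes "norm x < t" "k \<le> t - norm x" "t < T" "0 \<le> N" "ennreal N \<le> cone_mass p (\<lambda>z. \<bar>u z\<bar> powr p) (t - norm x)"
  shows "N / (4 * pi * sqrt (t\<^sup>2 - (norm x)\<^sup>2)) \<le> wave_L p (\<lambda>z. \<bar>u z\<bar> powr p) x t"
proof (rule wave_L_ge[where k=k])
  show "continuous_on (UNIV \<times> {0..t}) (\<lambda>z. \<bar>u z\<bar> powr p)"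
    using p \<open>t < T\<close> by (intro continuous_intros continuous_on_powr' continuous_on_subset[OF cont]) auto
qed (use assms support in auto)

text \<open>Condition \<open>S1\<close> keeps the negative free solution below half of the nonlinear
  lower bound, and \<open>S2\<close> starts the iteration from the base mass at height
  \<open>S\<close>.\<close>

lemma no_solution_positive_mass:
  assumes "0 < mass"
    and "far_field s0" "Lp_growth p s0 c"
    and c': "c' = c * 8 powr (p / 2 - 2)"
    and S: "16 * s0 \<le> S" "2 * S < T"
    and S1: "6 * mass * \<epsilon> \<le> c' * \<epsilon> powr p * S powr (4 - 3 * p / 2)"
    and S2: "8 powr (1 / (p - 1)) \<le> (1 / (8 * pi) / (2 * S)) powr p * (pi / 64) * (S / 2) ^ 3 / (4 * S) powr (p - 1) *
      (c' * \<epsilon> powr p * S powr (3 - 3 * p / 2)) powr (p - 1)"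
  shows False
proof -
  have s0: "2 * k \<le> s0" and asym: "\<And>x t. s0 \<le> t - norm x \<Longrightarrow>
      \<bar>free x t + mass / (2 * pi) * t * (t\<^sup>2 - (norm x)\<^sup>2) powr (- 3 / 2)\<bar>
        \<le> \<bar>mass\<bar> / (4 * pi) * t * (t\<^sup>2 - (norm x)\<^sup>2) powr (- 3 / 2)"
    using \<open>far_field s0\<close> by (auto simp: far_field_def)
  have "0 < c" and Lp: "\<And>v t \<epsilon>. \<lbrakk>2 * s0 \<le> t; 0 < \<epsilon>; continuous_on UNIV v; \<And>x. \<epsilon> * free x t \<le> v x\<rbrakk> \<Longrightarrow>
      ennreal (c * \<epsilon> powr p * t powr (1 - p / 2)) \<le> (\<integral>\<^sup>+x. ennreal (\<bar>v x\<bar> powr p) * indicator (cball 0 (t + k)) x \<partial>lborel)"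
    using \<open>Lp_growth p s0 c\<close> by (auto simp: Lp_growth_def)
  let ?F = "\<lambda>z. \<bar>u z\<bar> powr p"
  have "2 \<le> s0" using s0 k by linarith
  then have "1 \<le> S" using S by linarith
  have "0 < c'" using \<open>0 < c\<close> by (simp add: c')
  have base: "ennreal (c' * \<epsilon> powr p * s powr (3 - 3 * p / 2)) \<le> cone_mass p ?F s" if "S \<le> s" "s < T" for s
    unfolding c'
  proof (rule cone_mass_base_subcritical)
    show "ennreal (c * \<epsilon> powr p * t powr (1 - p / 2)) \<le> (\<integral>\<^sup>+x. ennreal (\<bar>u (x, t)\<bar> powr p) * indicator (cball 0 (t + k)) x \<partial>lborel)"
      if "2 * s0 \<le> t" "t < s" for t
      using that \<open>s < T\<close> \<open>2 \<le> s0\<close> eps continuous_slice eps_free_le by (intro Lp) auto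
  qed (use p \<open>0 < c\<close> eps k s0 S that in auto)
  have lower: "1 / (8 * pi) * N / sqrt (t\<^sup>2 - (norm x)\<^sup>2) \<le> u (x, t)"
    if s: "S \<le> t - norm x" "t < T" and N: "0 \<le> N" "ennreal N \<le> cone_mass p ?F (t - norm x)" for x t N
  proof -
    define s where "s = t - norm x"
    define \<rho> where "\<rho> = sqrt (t\<^sup>2 - (norm x)\<^sup>2)"
    \<comment> \<open>The given \<open>N\<close> may be arbitrarily small, so the base mass is used
      whenever it is larger. This alone guarantees that the free solution is dominated.\<close>
    define N' where "N' = max N (c' * \<epsilon> powr p * s powr (3 - 3 * p / 2))"
    have st: "1 \<le> s" "S \<le> s" "s < T" "0 < t" "norm x < t" "s0 \<le> s" "k \<le> s" "0 < s"
      using s S s0 k \<open>1 \<le> S\<close> norm_ge_zero[of x] unfolding s_def by linarith+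
    have Q: "t\<^sup>2 - (norm x)\<^sup>2 = s * (t + norm x)" by (simp add: s_def power2_eq_square algebra_simps)
    have "0 < t + norm x" using st(4) norm_ge_zero[of x] by linarith
    then have Qpos: "0 < t\<^sup>2 - (norm x)\<^sup>2" using Q st by simp
    then have "0 < \<rho>" by (simp add: \<rho>_def)
    have N': "0 \<le> N'" "N \<le> N'" "c' * \<epsilon> powr p * s powr (3 - 3 * p / 2) \<le> N'" using N by (auto simp: N'_def)
    have "ennreal N' \<le> cone_mass p ?F s"
      using N(2) base[OF st(2,3)] by (simp add: N'_def s_def max_def)
    then have L: "N' / (4 * pi * \<rho>) \<le> wave_L p ?F x t"
      unfolding \<rho>_def using st s N' by (intro wave_L_lower) (auto simp: s_def)
    \<comment> \<open>Condition \<open>S1\<close> passes from \<open>S\<close> to every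
      \<open>s \<ge> S\<close> because the exponent \<open>4 - 3 * p / 2\<close> is
      positive.\<close>
    have "6 * mass * \<epsilon> \<le> N' * s"
    proof -
      have "6 * mass * \<epsilon> \<le> c' * \<epsilon> powr p * S powr (4 - 3 * p / 2)" by (rule S1)
      also have "\<dots> \<le> c' * \<epsilon> powr p * s powr (4 - 3 * p / 2)"
        using st \<open>1 \<le> S\<close> p \<open>0 < c'\<close> by (intro mult_left_mono powr_mono2) auto
      also have "s powr (4 - 3 * p / 2) = s powr (3 - 3 * p / 2) * s"
        using st powr_add[of s "3 - 3 * p / 2" 1] by simp
      also have "c' * \<epsilon> powr p * (s powr (3 - 3 * p / 2) * s) \<le> N' * s"
        using mult_right_mono[OF N'(3), of s] st by (simp add: mult.assoc)
      finally show ?thesis .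
    qed
    define Y where "Y = t * (t\<^sup>2 - (norm x)\<^sup>2) powr (- 3 / 2)"
    \<comment> \<open>Here \<open>\<rho>\<^sup>2 = s (t + |x|)\<close> and
      \<open>t \<le> t + |x|\<close>. The extra factor \<open>1 / s\<close> is the decay by which
      the free solution loses to the nonlinear term.\<close>
    have Y: "Y \<le> 1 / (s * \<rho>)"
    proof -
      have "(t\<^sup>2 - (norm x)\<^sup>2) powr (- 3 / 2) = 1 / ((t\<^sup>2 - (norm x)\<^sup>2) * \<rho>)"
      proof -
        have "(t\<^sup>2 - (norm x)\<^sup>2) powr (3 / 2) = (t\<^sup>2 - (norm x)\<^sup>2) powr (1 + 1 / 2)" by simp
        also have "\<dots> = (t\<^sup>2 - (norm x)\<^sup>2) * \<rho>"
          unfolding powr_add using Qpos by (simp add: \<rho>_def powr_half_sqrt)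
        finally show ?thesis using powr_minus_divide[of "t\<^sup>2 - (norm x)\<^sup>2" "3 / 2"] by simp
      qed
      then have "Y = (t / (t + norm x)) * (1 / (s * \<rho>))" by (simp add: Y_def Q)
      also have "\<dots> \<le> 1 * (1 / (s * \<rho>))"
        using \<open>0 < t + norm x\<close> st \<open>0 < \<rho>\<close> by (intro mult_right_mono) (auto simp: field_simps)
      finally show ?thesis by simp
    qed
    have "\<bar>free x t + mass / (2 * pi) * Y\<bar> \<le> \<bar>mass\<bar> / (4 * pi) * Y"
      using asym[of t x] st(6) by (simp add: Y_def mult.assoc s_def)
    moreover have "mass / (2 * pi) * Y = 2 * (mass / (4 * pi) * Y)" "\<bar>mass\<bar> / (4 * pi) * Y = mass / (4 * pi) * Y"
      using \<open>0 < mass\<close> by auto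
    ultimately have "- (3 * (mass / (4 * pi) * Y)) \<le> free x t" by linarith
    moreover have "3 * (mass / (4 * pi) * Y) \<le> 3 * (mass / (4 * pi) * (1 / (s * \<rho>)))"
      using Y \<open>0 < mass\<close> by (intro mult_left_mono) auto
    ultimately have "- (3 * (mass / (4 * pi) * (1 / (s * \<rho>)))) \<le> free x t" by linarith
    then have "\<epsilon> * - (3 * (mass / (4 * pi) * (1 / (s * \<rho>)))) \<le> \<epsilon> * free x t"
      using eps by (intro mult_left_mono) auto
    also have "\<epsilon> * - (3 * (mass / (4 * pi) * (1 / (s * \<rho>)))) = - ((6 * mass * \<epsilon>) / s) / (8 * pi * \<rho>)"
      using st \<open>0 < \<rho>\<close> by (simp add: field_simps)
    finally have "- ((6 * mass * \<epsilon>) / s) / (8 * pi * \<rho>) \<le> \<epsilon> * free x t" .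
    \<comment> \<open>The free solution consumes at most half of
      \<open>N' / (4 * pi * \<rho>)\<close>, which explains the constant
      \<open>8 * pi\<close>.\<close>
    moreover have "- N' / (8 * pi * \<rho>) \<le> - ((6 * mass * \<epsilon>) / s) / (8 * pi * \<rho>)"
      using \<open>6 * mass * \<epsilon> \<le> N' * s\<close> st \<open>0 < \<rho>\<close> by (intro divide_right_mono) (auto simp: pos_divide_le_eq)
    moreover have "N' / (4 * pi * \<rho>) = 2 * (N' / (8 * pi * \<rho>))" by simp
    ultimately have "N' / (8 * pi * \<rho>) \<le> \<epsilon> * free x t + wave_L p ?F x t"
      using L by (simp only: minus_divide_left[symmetric])
    also have "\<dots> = u (x, t)" using eq st s by simp
    finally have "N' / (8 * pi * \<rho>) \<le> u (x, t)" .
    moreover have "N / (8 * pi * \<rho>) \<le> N' / (8 * pi * \<rho>)"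
      using N' \<open>0 < \<rho>\<close> by (intro divide_right_mono) auto
    ultimately show ?thesis by (simp add: \<rho>_def)
  qed
  show False
  proof (rule no_solution_subcritical[where T=T and u=u, OF lower p(1) \<open>1 \<le> S\<close> S(2) _ _ _ S2])
    show "ennreal (c' * \<epsilon> powr p * S powr (3 - 3 * p / 2)) \<le> cone_mass p ?F S"
      using base[of S] S \<open>1 \<le> S\<close> by simp
    show "0 < c' * \<epsilon> powr p * S powr (3 - 3 * p / 2)" using eps \<open>0 < c'\<close> \<open>1 \<le> S\<close> by simp
  qed auto
qed

text \<open>The far field is now nonnegative, so \<open>u\<close> is bounded below by the nonlinear
  term alone.\<close>

lemma no_solution_negative_mass:
  assumes "mass < 0" "p = 2"
    and "far_field s0" "Lp_growth p s0 c"
    and \<Sigma>: "1 \<le> \<Sigma>" "2 * ln (8 * s0) \<le> \<Sigma>" "exp (2 * \<Sigma>) < T"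
    and \<Sigma>1: "8 \<le> (1 / (8 * pi))\<^sup>2 * pi * \<Sigma>\<^sup>2 / 4096 * (c * \<epsilon>\<^sup>2 / 4 * \<Sigma>)"
  shows False
proof -
  have s0: "2 * k \<le> s0" and asym: "\<And>x t. s0 \<le> t - norm x \<Longrightarrow>
      \<bar>free x t + mass / (2 * pi) * t * (t\<^sup>2 - (norm x)\<^sup>2) powr (- 3 / 2)\<bar>
        \<le> \<bar>mass\<bar> / (4 * pi) * t * (t\<^sup>2 - (norm x)\<^sup>2) powr (- 3 / 2)"
    using \<open>far_field s0\<close> by (auto simp: far_field_def)
  have "0 < c" and Lp: "\<And>v t \<epsilon>. \<lbrakk>2 * s0 \<le> t; 0 < \<epsilon>; continuous_on UNIV v; \<And>x. \<epsilon> * free x t \<le> v x\<rbrakk> \<Longrightarrow>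
      ennreal (c * \<epsilon> powr p * t powr (1 - p / 2)) \<le> (\<integral>\<^sup>+x. ennreal (\<bar>v x\<bar> powr p) * indicator (cball 0 (t + k)) x \<partial>lborel)"
    using \<open>Lp_growth p s0 c\<close> by (auto simp: Lp_growth_def)
  let ?F = "\<lambda>z. \<bar>u z\<bar> powr 2"
  have "2 \<le> s0" using s0 k by linarith
  have "ln (8 * s0) \<le> \<Sigma>" using \<Sigma> by linarith
  then have "exp (ln (8 * s0)) \<le> exp \<Sigma>" by simp
  then have "8 * s0 \<le> exp \<Sigma>" using \<open>2 \<le> s0\<close> by simp
  have "exp \<Sigma> \<le> exp (2 * \<Sigma>)" using \<Sigma> by simp
  have base: "ennreal (c * \<epsilon>\<^sup>2 / 4 * \<Sigma>) \<le> cone_mass 2 ?F (exp \<Sigma>)"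
  proof -
    \<comment> \<open>As \<open>ln (8 * s0) \<le> \<Sigma> / 2\<close>, at least half of the
      logarithm survives.\<close>
    have "ennreal (c * \<epsilon>\<^sup>2 / 4 * \<Sigma>) \<le> ennreal (c * \<epsilon>\<^sup>2 / 2 * (ln (exp \<Sigma>) - ln (8 * s0)))"
      using mult_left_mono[of "\<Sigma> / 2" "\<Sigma> - ln (8 * s0)" "c * \<epsilon>\<^sup>2 / 2"] \<Sigma> \<open>0 < c\<close> by (intro ennreal_leI) simp
    also have "\<dots> \<le> cone_mass 2 ?F (exp \<Sigma>)"
    proof (rule cone_mass_base_critical)
      show "ennreal (c * \<epsilon>\<^sup>2) \<le> (\<integral>\<^sup>+x. ennreal (\<bar>u (x, t)\<bar> powr 2) * indicator (cball 0 (t + k)) x \<partial>lborel)"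
        if "2 * s0 \<le> t" "t < exp \<Sigma>" for t
        using Lp[of t \<epsilon> "\<lambda>x. u (x, t)"] that \<open>2 \<le> s0\<close> eps continuous_slice eps_free_le \<Sigma>(3) \<open>exp \<Sigma> \<le> exp (2 * \<Sigma>)\<close>
        by (simp add: \<open>p = 2\<close>)
    qed (use \<open>0 < c\<close> eps k s0 \<open>8 * s0 \<le> exp \<Sigma>\<close> in auto)
    finally show ?thesis .
  qed
  have lower: "1 / (8 * pi) * N / sqrt (t\<^sup>2 - (norm x)\<^sup>2) \<le> u (x, t)"
    if s: "exp \<Sigma> \<le> t - norm x" "t < T" and N: "0 \<le> N" "ennreal N \<le> cone_mass 2 ?F (t - norm x)" for x t N
  proof -
    have st: "0 < t" "norm x < t" "s0 \<le> t - norm x" "k \<le> t - norm x"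
      using s \<open>8 * s0 \<le> exp \<Sigma>\<close> s0 k norm_ge_zero[of x] by linarith+
    define \<rho> where "\<rho> = sqrt (t\<^sup>2 - (norm x)\<^sup>2)"
    have "0 < \<rho>" using st by (simp add: \<rho>_def power_strict_mono)
    define Y where "Y = t * (t\<^sup>2 - (norm x)\<^sup>2) powr (- 3 / 2)"
    have "0 \<le> Y" using st by (simp add: Y_def)
    have "\<bar>free x t + mass / (2 * pi) * Y\<bar> \<le> \<bar>mass\<bar> / (4 * pi) * Y"
      using asym[OF st(3)] by (simp add: Y_def mult.assoc)
    moreover have "mass / (2 * pi) * Y = 2 * (mass / (4 * pi) * Y)" "\<bar>mass\<bar> / (4 * pi) * Y = - (mass / (4 * pi) * Y)"
      using \<open>mass < 0\<close> by auto
    moreover have "mass / (4 * pi) * Y \<le> 0"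
      using \<open>mass < 0\<close> \<open>0 \<le> Y\<close> by (simp add: mult_nonpos_nonneg divide_nonpos_pos)
    ultimately have "0 \<le> free x t" by linarith
    then have "wave_L p ?F x t \<le> u (x, t)" using eq[of t x] st s eps by (simp add: \<open>p = 2\<close>)
    moreover have "N / (4 * pi * \<rho>) \<le> wave_L p ?F x t"
      unfolding \<rho>_def using wave_L_lower[of x t N] st s N by (simp add: \<open>p = 2\<close>)
    moreover have "N / (8 * pi * \<rho>) \<le> N / (4 * pi * \<rho>)"
      using N \<open>0 < \<rho>\<close> by (intro divide_left_mono) auto
    ultimately show ?thesis by (simp add: \<rho>_def)
  qed
  show False
  proof (rule no_solution_critical[where T=T and u=u, OF lower \<Sigma>(1) \<Sigma>(3) _ _ base \<Sigma>1])
    show "0 < c * \<epsilon>\<^sup>2 / 4 * \<Sigma>" using eps \<open>0 < c\<close> \<Sigma> by simp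
  qed auto
qed

end

section \<open>The lifespan bounds\<close>

lemma strauss_gamma_4: "strauss_gamma p 4 = 2 + 5 * p - 3 * p\<^sup>2"
  by (simp add: strauss_gamma_def)

text \<open>After collecting the powers of \<open>S = T / 3\<close>, the last condition reads
  \<open>A \<le> c4 * \<epsilon> powr (p * (p - 1)) * S powr (\<gamma> / 2)\<close>. Solving it for
  \<open>S\<close> gives the lifespan exponent \<open>2 * p * (p - 1) / \<gamma>\<close>.\<close>

lemma subcritical_threshold:
  assumes p: "1 < p" "p < 2" and "0 < c" "0 < m"
  obtains C where "0 < C"
    "\<And>\<epsilon> T. \<lbrakk>0 < \<epsilon>; \<epsilon> \<le> 1; C * \<epsilon> powr (- 2 * p * (p - 1) / strauss_gamma p 4) \<le> T\<rbrakk> \<Longrightarrow>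
      16 * s0 \<le> T / 3 \<and> 2 * (T / 3) < T \<and>
      6 * m * \<epsilon> \<le> c * \<epsilon> powr p * (T / 3) powr (4 - 3 * p / 2) \<and>
      8 powr (1 / (p - 1)) \<le> (1 / (8 * pi) / (2 * (T / 3))) powr p * (pi / 64) * (T / 3 / 2) ^ 3 / (4 * (T / 3)) powr (p - 1) *
        (c * \<epsilon> powr p * (T / 3) powr (3 - 3 * p / 2)) powr (p - 1)"
proof -
  define \<gamma> where "\<gamma> = strauss_gamma p 4"
  \<comment> \<open>The factorization shows where \<open>p < 2\<close> enters:
    \<open>\<gamma>\<close> is then positive.\<close>
  have "\<gamma> = (2 - p) * (1 + 3 * p)" by (simp add: \<gamma>_def strauss_gamma_4 power2_eq_square algebra_simps)
  then have "0 < \<gamma>" using p by simp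
  define \<kappa> where "\<kappa> = 2 * p * (p - 1) / \<gamma>"
  define e where "e = 4 - 3 * p / 2"
  have "1 \<le> e" using p by (simp add: e_def)
  have "0 < \<kappa>" using p \<open>0 < \<gamma>\<close> by (simp add: \<kappa>_def)
  \<comment> \<open>This makes the domination of the free solution follow from the same lower bound
    on \<open>S\<close>. It amounts to \<open>\<gamma> \<le> 8 p - 3 p\<^sup>2\<close>, that is
    \<open>2 \<le> 3 p\<close>.\<close>
  have \<kappa>e: "p - 1 \<le> \<kappa> * e"
  proof -
    have "\<gamma> \<le> 2 * p * e" using p by (simp add: \<gamma>_def strauss_gamma_4 e_def power2_eq_square algebra_simps)
    then have "(p - 1) * \<gamma> \<le> (p - 1) * (2 * p * e)" using p by (intro mult_left_mono) auto
    then show ?thesis using \<open>0 < \<gamma>\<close> by (simp add: \<kappa>_def field_simps)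
  qed
  define c4 where "c4 = (1 / (16 * pi)) powr p * (pi / 512) / 4 powr (p - 1) * c powr (p - 1)"
  have "0 < c4" using \<open>0 < c\<close> by (simp add: c4_def)
  define A :: real where "A = 8 powr (1 / (p - 1))"
  have "0 < A" by (simp add: A_def)
  \<comment> \<open>The entry 1 is for monotonicity of powers, and each other entry for one of the
    required inequalities; the last one solves \<open>A \<le> c4 * R powr (\<gamma> / 2)\<close>
    with equality.\<close>
  define R where "R = Max {1, 16 * s0, 6 * m / c, (A / c4) powr (2 / \<gamma>)}"
  have R: "1 \<le> R" "16 * s0 \<le> R" "6 * m / c \<le> R" "(A / c4) powr (2 / \<gamma>) \<le> R" by (auto simp: R_def)
  show ?thesis
  proof (rule that[of "3 * R"])
    show "0 < 3 * R" using R by simp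
    fix \<epsilon> T assume \<epsilon>: "0 < (\<epsilon>::real)" "\<epsilon> \<le> 1" and T: "3 * R * \<epsilon> powr (- 2 * p * (p - 1) / strauss_gamma p 4) \<le> T"
    define S where "S = T / 3"
    have S: "R * \<epsilon> powr (- \<kappa>) \<le> S"
      using T by (simp add: S_def \<kappa>_def \<gamma>_def)
    have "1 \<le> \<epsilon> powr (- \<kappa>)"
      using powr_mono'[of "- \<kappa>" 0 \<epsilon>] \<epsilon> \<open>0 < \<kappa>\<close> by simp
    then have "R \<le> R * \<epsilon> powr (- \<kappa>)" using R by simp
    then have RS: "R \<le> S" using S by linarith
    then have "0 < S" using R by linarith
    have "6 * m * \<epsilon> \<le> c * \<epsilon> powr p * S powr e"
    proof -
      have "R * \<epsilon> powr (1 - p) \<le> R powr e * \<epsilon> powr (- \<kappa> * e)"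
      proof (intro mult_mono)
        show "R \<le> R powr e" using powr_mono[OF \<open>1 \<le> e\<close> R(1)] R(1) by simp
        show "\<epsilon> powr (1 - p) \<le> \<epsilon> powr (- \<kappa> * e)"
          using \<kappa>e \<epsilon> by (intro powr_mono') auto
      qed (use R in auto)
      also have "\<dots> = (R * \<epsilon> powr (- \<kappa>)) powr e" using R by (simp add: powr_mult powr_powr)
      also have "\<dots> \<le> S powr e" using S R \<open>1 \<le> e\<close> by (intro powr_mono2) auto
      finally have "c * \<epsilon> powr p * (R * \<epsilon> powr (1 - p)) \<le> c * \<epsilon> powr p * S powr e"
        using \<open>0 < c\<close> by (intro mult_left_mono) auto
      moreover have "\<epsilon> powr p * \<epsilon> powr (1 - p) = \<epsilon>" using \<epsilon> by (simp add: powr_add[symmetric])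
      then have "c * \<epsilon> powr p * (R * \<epsilon> powr (1 - p)) = c * R * \<epsilon>" by simp
      moreover have "6 * m * \<epsilon> \<le> c * R * \<epsilon>"
        using R(3) \<open>0 < c\<close> \<epsilon> by (intro mult_right_mono) (auto simp: field_simps)
      ultimately show ?thesis by simp
    qed
    moreover have "A \<le> (1 / (8 * pi) / (2 * S)) powr p * (pi / 64) * (S / 2) ^ 3 / (4 * S) powr (p - 1) *
        (c * \<epsilon> powr p * S powr (3 - 3 * p / 2)) powr (p - 1)" (is "_ \<le> ?rhs")
    proof -
      have "?rhs = c4 * \<epsilon> powr (p * (p - 1)) * S powr (\<gamma> / 2)"
      proof -
        have "(1 / (8 * pi) / (2 * S)) powr p = (1 / (16 * pi)) powr p * S powr (- p)"
        proof -
          have "1 / (8 * pi) / (2 * S) = 1 / (16 * pi) * (1 / S)" by simp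
          moreover have "(1 / S) powr p = S powr (- p)"
            using \<open>0 < S\<close> by (simp add: powr_minus_divide powr_divide)
          ultimately show ?thesis by (simp only: powr_mult)
        qed
        moreover have "(S / 2) ^ 3 = S powr 3 / 8" using \<open>0 < S\<close> by (simp add: power_divide)
        moreover have "1 / (4 * S) powr (p - 1) = 1 / 4 powr (p - 1) * S powr (1 - p)"
          using \<open>0 < S\<close> powr_minus_divide[of S "p - 1"] by (simp add: powr_mult)
        moreover have "(c * \<epsilon> powr p * S powr (3 - 3 * p / 2)) powr (p - 1) =
            c powr (p - 1) * \<epsilon> powr (p * (p - 1)) * S powr ((3 - 3 * p / 2) * (p - 1))"
          using \<open>0 < c\<close> by (simp add: powr_mult powr_powr)
        moreover have "S powr (- p) * S powr 3 * S powr (1 - p) * S powr ((3 - 3 * p / 2) * (p - 1)) = S powr (\<gamma> / 2)"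
        proof -
          have "- p + 3 + (1 - p) + (3 - 3 * p / 2) * (p - 1) = \<gamma> / 2"
            by (simp add: \<gamma>_def strauss_gamma_4 power2_eq_square field_simps)
          then show ?thesis by (simp only: powr_add[symmetric])
        qed
        moreover have "?rhs = (1 / (8 * pi) / (2 * S)) powr p * (pi / 64) * (S / 2) ^ 3 * (1 / (4 * S) powr (p - 1)) *
          (c * \<epsilon> powr p * S powr (3 - 3 * p / 2)) powr (p - 1)" by simp
        ultimately have "?rhs = ((1 / (16 * pi)) powr p * S powr (- p)) * (pi / 64) * (S powr 3 / 8) *
            (1 / 4 powr (p - 1) * S powr (1 - p)) *
            (c powr (p - 1) * \<epsilon> powr (p * (p - 1)) * S powr ((3 - 3 * p / 2) * (p - 1)))"
          by (simp only:)
        also have "\<dots> = c4 * \<epsilon> powr (p * (p - 1)) *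
            (S powr (- p) * S powr 3 * S powr (1 - p) * S powr ((3 - 3 * p / 2) * (p - 1)))"
          by (simp add: c4_def)
        also have "S powr (- p) * S powr 3 * S powr (1 - p) * S powr ((3 - 3 * p / 2) * (p - 1)) = S powr (\<gamma> / 2)"
          by fact
        finally show ?thesis .
      qed
      moreover have "A \<le> c4 * \<epsilon> powr (p * (p - 1)) * S powr (\<gamma> / 2)"
      proof -
        have "A / c4 = ((A / c4) powr (2 / \<gamma>)) powr (\<gamma> / 2)"
          using \<open>0 < A\<close> \<open>0 < c4\<close> \<open>0 < \<gamma>\<close> by (simp add: powr_powr)
        also have "\<dots> \<le> R powr (\<gamma> / 2)" using R \<open>0 < \<gamma>\<close> by (intro powr_mono2) auto
        also have "\<dots> = \<epsilon> powr (p * (p - 1)) * (R powr (\<gamma> / 2) * \<epsilon> powr (- (p * (p - 1))))"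
          using \<epsilon> by (simp add: powr_minus_divide)
        also have "R powr (\<gamma> / 2) * \<epsilon> powr (- (p * (p - 1))) = (R * \<epsilon> powr (- \<kappa>)) powr (\<gamma> / 2)"
          using R \<open>0 < \<gamma>\<close> by (simp add: powr_mult powr_powr \<kappa>_def)
        also have "\<epsilon> powr (p * (p - 1)) * (R * \<epsilon> powr (- \<kappa>)) powr (\<gamma> / 2) \<le> \<epsilon> powr (p * (p - 1)) * S powr (\<gamma> / 2)"
          using S R \<open>0 < \<gamma>\<close> by (intro mult_left_mono powr_mono2) auto
        finally show ?thesis using \<open>0 < c4\<close> by (simp add: field_simps)
      qed
      ultimately show ?thesis by simp
    qed
    ultimately show "16 * s0 \<le> T / 3 \<and> 2 * (T / 3) < T \<and>
      6 * m * \<epsilon> \<le> c * \<epsilon> powr p * (T / 3) powr (4 - 3 * p / 2) \<and>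
      8 powr (1 / (p - 1)) \<le> (1 / (8 * pi) / (2 * (T / 3))) powr p * (pi / 64) * (T / 3 / 2) ^ 3 / (4 * (T / 3)) powr (p - 1) *
        (c * \<epsilon> powr p * (T / 3) powr (3 - 3 * p / 2)) powr (p - 1)"
      using R(2) RS \<open>0 < S\<close> unfolding S_def e_def A_def by simp
  qed
qed

text \<open>With \<open>S = ln T / 3\<close> the starting condition is
  \<open>8 \<le> d * S ^ 3 * \<epsilon>\<^sup>2\<close>, so \<open>S\<close> of order
  \<open>\<epsilon> powr (- 2 / 3)\<close> is enough.\<close>

lemma critical_threshold:
  assumes "0 < c"
  obtains C where "0 < C"
    "\<And>\<epsilon> T. \<lbrakk>0 < \<epsilon>; \<epsilon> \<le> 1; exp (C * \<epsilon> powr (- 2 / 3)) \<le> T\<rbrakk> \<Longrightarrow>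
      1 \<le> ln T / 3 \<and> L \<le> ln T / 3 \<and> exp (2 * (ln T / 3)) < T \<and>
      8 \<le> (1 / (8 * pi))\<^sup>2 * pi * (ln T / 3)\<^sup>2 / 4096 * (c * \<epsilon>\<^sup>2 / 4 * (ln T / 3))"
proof -
  define d where "d = (1 / (8 * pi))\<^sup>2 * pi / 4096 * (c / 4)"
  have "0 < d" using \<open>0 < c\<close> by (simp add: d_def)
  define R where "R = Max {1, L, 8 / d}"
  have R: "1 \<le> R" "L \<le> R" "8 / d \<le> R" by (auto simp: R_def)
  show ?thesis
  proof (rule that[of "3 * R"])
    show "0 < 3 * R" using R by simp
    fix \<epsilon> T assume \<epsilon>: "0 < (\<epsilon>::real)" "\<epsilon> \<le> 1" and T: "exp (3 * R * \<epsilon> powr (- 2 / 3)) \<le> T"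
    define S where "S = ln T / 3"
    have "0 < T" using T by (meson exp_gt_zero less_le_trans)
    have "3 * R * \<epsilon> powr (- 2 / 3) \<le> ln T"
      using T \<open>0 < T\<close> by (simp add: ln_ge_iff)
    then have S: "R * \<epsilon> powr (- 2 / 3) \<le> S" by (simp add: S_def)
    have "1 \<le> \<epsilon> powr (- 2 / 3)"
      using powr_mono'[of "- 2 / 3" 0 \<epsilon>] \<epsilon> by simp
    then have "R * 1 \<le> R * \<epsilon> powr (- 2 / 3)" using R by (intro mult_left_mono) auto
    then have RS: "R \<le> S" using S by linarith
    have "exp (2 * S) < exp (3 * S)" using RS R by simp
    also have "exp (3 * S) = T" using \<open>0 < T\<close> by (simp add: S_def)
    finally have "exp (2 * S) < T" .
    moreover have "8 \<le> (1 / (8 * pi))\<^sup>2 * pi * S\<^sup>2 / 4096 * (c * \<epsilon>\<^sup>2 / 4 * S)"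
    proof -
      have "R \<le> R ^ 3" using power_increasing[of 1 3 R] R by simp
      have "(\<epsilon> powr (- 2 / 3)) ^ 3 * \<epsilon>\<^sup>2 = 1"
      proof -
        have "(\<epsilon> powr (- 2 / 3)) ^ 3 = \<epsilon> powr (- 2)"
          using \<epsilon> by (simp add: powr_power)
        then show ?thesis using \<epsilon> by (simp add: powr_minus powr_realpow)
      qed
      then have "d * R ^ 3 = d * (R * \<epsilon> powr (- 2 / 3)) ^ 3 * \<epsilon>\<^sup>2"
        by (simp add: power_mult_distrib)
      also have "\<dots> \<le> d * S ^ 3 * \<epsilon>\<^sup>2"
        using S R \<open>0 < d\<close> by (intro mult_left_mono mult_right_mono power_mono) auto
      also have "\<dots> = (1 / (8 * pi))\<^sup>2 * pi * S\<^sup>2 / 4096 * (c * \<epsilon>\<^sup>2 / 4 * S)"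
        by (simp add: d_def power2_eq_square power3_eq_cube)
      finally have "d * R ^ 3 \<le> (1 / (8 * pi))\<^sup>2 * pi * S\<^sup>2 / 4096 * (c * \<epsilon>\<^sup>2 / 4 * S)" .
      moreover have "8 \<le> d * R" using R(3) \<open>0 < d\<close> by (simp add: field_simps)
      moreover have "d * R \<le> d * R ^ 3" using \<open>R \<le> R ^ 3\<close> \<open>0 < d\<close> by simp
      ultimately show ?thesis by linarith
    qed
    ultimately show "1 \<le> ln T / 3 \<and> L \<le> ln T / 3 \<and> exp (2 * (ln T / 3)) < T \<and>
      8 \<le> (1 / (8 * pi))\<^sup>2 * pi * (ln T / 3)\<^sup>2 / 4096 * (c * \<epsilon>\<^sup>2 / 4 * (ln T / 3))"
      using R RS unfolding S_def by auto
  qed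
qed

section \<open>Reduction of the stated hypotheses to the abstract setting\<close>

lemma initial_profile_exists:
  fixes f :: "real^2 \<Rightarrow> real"
  assumes "C2_compact_supp f" "supp f UNIV \<subseteq> {x. norm x \<le> k}" "1 \<le> k"
  obtains f' B where "initial_profile f f' B k"
proof -
  from assms(1) obtain f' :: "real^2 \<Rightarrow> (real^2) \<Rightarrow>\<^sub>L real"
    where der: "\<And>x. (f has_derivative blinfun_apply (f' x)) (at x)" and "C1_on f' UNIV"
    by (auto simp: C2_compact_supp_def C2_on_def)
  then have cont': "continuous_on A f'" for A
    unfolding C1_on_def by (metis UNIV_I continuous_at_imp_continuous_on has_derivative_continuous)
  have cont: "continuous_on A f" for A
    using der by (meson continuous_at_imp_continuous_on has_derivative_continuous)
  have "support_on UNIV f \<subseteq> supp f UNIV" unfolding supp_def by (rule closure_subset)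
  then have outside: "f x = 0" if "k < norm x" for x
    using that assms(2) by (force simp: support_on_def)
  \<comment> \<open>\<open>f\<close> is 0 on the open exterior of the disc, so its derivative
    vanishes there as well, and bounds on the compact disc become global.\<close>
  have outside': "f' x = 0" if x: "k < norm x" for x
  proof -
    have "open {y::real^2. k < norm y}" by (intro open_Collect_less continuous_intros)
    then have "((\<lambda>y. 0) has_derivative blinfun_apply (f' x)) (at x)"
      using x outside by (intro has_derivative_transform_within_open[OF der, where s="{y. k < norm y}"]) auto
    then have "blinfun_apply (f' x) = (\<lambda>h. 0)"
      by (rule has_derivative_unique) (rule has_derivative_const)
    then show ?thesis by (intro blinfun_eqI) simp
  qed
  have "bounded (f ` cball 0 k)" "bounded (f' ` cball 0 k)"
    by (intro compact_imp_bounded compact_continuous_image cont cont' compact_cball)+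
  then obtain B1 B2 where "\<forall>x\<in>cball 0 k. norm (f x) \<le> B1" "\<forall>x\<in>cball 0 k. norm (f' x) \<le> B2"
    by (auto simp: bounded_iff)
  then have B: "\<And>x. norm x \<le> k \<Longrightarrow> norm (f x) \<le> B1" "\<And>x. norm x \<le> k \<Longrightarrow> norm (f' x) \<le> B2"
    by auto
  have "initial_profile f f' (max 0 (max B1 B2)) k"
  proof
    fix x
    show "\<bar>f x\<bar> \<le> max 0 (max B1 B2)"
      using B(1)[of x] outside[of x] by (cases "norm x \<le> k") auto
    show "norm (f' x) \<le> max 0 (max B1 B2)"
      using B(2)[of x] outside'[of x] by (cases "norm x \<le> k") auto
  qed (use der outside assms in auto)
  then show ?thesis by (rule that)
qed

text \<open>By continuity \<open>f\<close> is at least \<open>f a / 2\<close> on a ball of positive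
  area around \<open>a\<close>.\<close>

lemma (in initial_profile) mass_pos:
  assumes "\<And>x. 0 \<le> f x" "f a \<noteq> 0"
  shows "0 < mass"
proof -
  have "0 < f a" using assms by (simp add: order_less_le)
  have "isCont f a" using continuous_f[of UNIV] by (simp add: continuous_on_eq_continuous_at)
  then obtain d where d: "0 < d" "\<And>x. dist x a < d \<Longrightarrow> dist (f x) (f a) < f a / 2"
    using \<open>0 < f a\<close> unfolding continuous_at_eps_delta by (metis half_gt_zero)
  have fin: "emeasure lborel (ball a d) < \<infinity>" by (rule emeasure_bounded_finite) simp
  have "0 < f a / 2 * measure lborel (ball a d)"
    using \<open>0 < f a\<close> \<open>0 < d\<close> content_ball_pos[of d a] by simp
  also have "\<dots> = (LINT x|lborel. f a / 2 * indicator (ball a d) x)" using fin by simp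
  also have "\<dots> \<le> (LINT x|lborel. f x)"
  proof (rule integral_mono[OF _ integrable_f])
    show "integrable lborel (\<lambda>x. f a / 2 * indicator (ball a d) x)" using fin by simp
    show "f a / 2 * indicator (ball a d) x \<le> f x" for x
    proof (cases "x \<in> ball a d")
      case True
      then have "\<bar>f x - f a\<bar> < f a / 2" using d(2)[of x] by (simp add: dist_commute dist_real_def abs_minus_commute)
      then have "f a / 2 \<le> f x" unfolding abs_diff_less_iff by simp
      then show ?thesis using True by simp
    qed (simp add: assms(1))
  qed
  finally show ?thesis by (simp add: mass_def)
qed

lemma integral_solutionI:
  assumes "initial_profile f f' B k" "1 < p" "p \<le> 2" "0 < \<epsilon>" "\<forall>x. f x + g x = 0"
    and u: "C1_on u (UNIV \<times> {0..<T})"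
      "supp u (UNIV \<times> {0..<T}) \<subseteq> {(x, t). 0 \<le> t \<and> norm x \<le> t + k}"
      "solves_integral_equation p \<epsilon> f g T u"
  shows "integral_solution f f' B k p \<epsilon> T u"
proof -
  interpret initial_profile f f' B k by fact
  show ?thesis
  proof
    show "continuous_on (UNIV \<times> {0..<T}) u"
      using u(1) unfolding C1_on_def by (meson has_derivative_continuous_on)
    have "support_on (UNIV \<times> {0..<T}) u \<subseteq> supp u (UNIV \<times> {0..<T})" unfolding supp_def by (rule closure_subset)
    then show "u (x, t) = 0" if "0 \<le> t" "t < T" "t + k < norm x" for x t
      using that u(2) by (force simp: support_on_def)
    show "u (x, t) = \<epsilon> * free x t + wave_L p (\<lambda>z. \<bar>u z\<bar> powr p) x t" if "0 \<le> t" "t < T" for x t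
      using that u(3) wave_free_eq[of g x t] assms(5) by (simp add: solves_integral_equation_def)
  qed fact+
qed

theorem theorem2p4:
  fixes p k :: real and f g :: "real^2 \<Rightarrow> real"
  assumes "1 < p" and "p \<le> 2" and "1 \<le> k"
    and "C2_compact_supp f" and "C1_compact_supp g"
    and "supp f UNIV \<union> supp g UNIV \<subseteq> {x. norm x \<le> k}"
    and "\<forall>x. f x + g x = 0"
    and "(1 < p \<and> p < 2 \<and> (\<forall>x. 0 \<le> f x) \<and> (\<exists>x. f x \<noteq> 0)) \<or>
         (p = 2 \<and> (LINT x|lborel. f x) < 0)"
  shows "\<exists>\<epsilon>\<^sub>1>0. \<exists>c>0. \<forall>\<epsilon> T :: real. 0 < \<epsilon> \<and> \<epsilon> \<le> \<epsilon>\<^sub>1 \<and>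
           T \<ge> (if p < 2 then c * \<epsilon> powr (- 2 * p * (p - 1) / strauss_gamma p 4)
                 else exp (c * \<epsilon> powr (- 2 / 3))) \<longrightarrow>
           \<not> (\<exists>u :: (real^2) \<times> real \<Rightarrow> real.
                C1_on u (UNIV \<times> {0..<T}) \<and>
                supp u (UNIV \<times> {0..<T}) \<subseteq> {(x, t). 0 \<le> t \<and> norm x \<le> t + k} \<and>
                solves_integral_equation p \<epsilon> f g T u)"
proof -
  have "supp f UNIV \<subseteq> {x. norm x \<le> k}" using assms(6) by blast
  then obtain f' B where prof: "initial_profile f f' B k"
    using assms(3,4) initial_profile_exists by blast
  interpret initial_profile f f' B k by (rule prof)
  note solI = integral_solutionI[OF prof \<open>1 < p\<close> \<open>p \<le> 2\<close> _ assms(7)]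
  from assms(8) show ?thesis
  proof (elim disjE conjE exE)
    fix a assume "p < 2" "\<forall>x. 0 \<le> f x" "f a \<noteq> 0"
    then have "0 < mass" by (intro mass_pos[of a]) auto
    then obtain s0 where s0: "far_field s0" using far_field_exists by auto
    then obtain c where c: "Lp_growth p s0 c"
      using Lp_growth_positive_mass[OF \<open>0 < mass\<close>] \<open>1 < p\<close> less_imp_le by blast
    then have "0 < c" by (simp add: Lp_growth_def)
    from \<open>0 < c\<close> have c8: "0 < c * 8 powr (p / 2 - 2)" by simp
    obtain C where C: "0 < C" "\<And>\<epsilon> T. \<lbrakk>0 < \<epsilon>; \<epsilon> \<le> 1; C * \<epsilon> powr (- 2 * p * (p - 1) / strauss_gamma p 4) \<le> T\<rbrakk> \<Longrightarrow>
      16 * s0 \<le> T / 3 \<and> 2 * (T / 3) < T \<and>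
      6 * mass * \<epsilon> \<le> c * 8 powr (p / 2 - 2) * \<epsilon> powr p * (T / 3) powr (4 - 3 * p / 2) \<and>
      8 powr (1 / (p - 1)) \<le> (1 / (8 * pi) / (2 * (T / 3))) powr p * (pi / 64) * (T / 3 / 2) ^ 3 / (4 * (T / 3)) powr (p - 1) *
        (c * 8 powr (p / 2 - 2) * \<epsilon> powr p * (T / 3) powr (3 - 3 * p / 2)) powr (p - 1)"
      by (rule subcritical_threshold[OF \<open>1 < p\<close> \<open>p < 2\<close> c8 \<open>0 < mass\<close>]) (rule that)
    have "False" if "0 < \<epsilon>" "\<epsilon> \<le> 1" "C * \<epsilon> powr (- 2 * p * (p - 1) / strauss_gamma p 4) \<le> T"
      "C1_on u (UNIV \<times> {0..<T})" "supp u (UNIV \<times> {0..<T}) \<subseteq> {(x, t). 0 \<le> t \<and> norm x \<le> t + k}"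
      "solves_integral_equation p \<epsilon> f g T u" for \<epsilon> T u
    proof -
      interpret integral_solution f f' B k p \<epsilon> T u by (rule solI) fact+
      \<comment> \<open>The iteration runs with \<open>S = T / 3\<close>, whose final height
        \<open>2 * S\<close> is still below \<open>T\<close>.\<close>
      from C(2)[OF that(1-3)] show False
        using no_solution_positive_mass[OF \<open>0 < mass\<close> s0 c refl, of "T / 3"] by blast
    qed
    \<comment> \<open>The choice \<open>\<epsilon>\<^sub>1 = 1\<close> works: smallness of
      \<open>\<epsilon>\<close> only serves to make its negative powers at least 1.\<close>
    then show ?thesis
      using \<open>p < 2\<close> \<open>0 < C\<close> by (intro exI[of _ 1] conjI exI[of _ C]) auto
  next
    assume "p = 2" "(LINT x|lborel. f x) < 0"
    then have "mass < 0" by (simp add: mass_def)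
    then obtain s0 where s0: "far_field s0" using far_field_exists by auto
    then obtain c where c: "Lp_growth p s0 c"
      using Lp_growth_negative_mass[OF \<open>mass < 0\<close>] \<open>1 < p\<close> less_imp_le by blast
    then have "0 < c" by (simp add: Lp_growth_def)
    obtain C where C: "0 < C" "\<And>\<epsilon> T. \<lbrakk>0 < \<epsilon>; \<epsilon> \<le> 1; exp (C * \<epsilon> powr (- 2 / 3)) \<le> T\<rbrakk> \<Longrightarrow>
      1 \<le> ln T / 3 \<and> 2 * ln (8 * s0) \<le> ln T / 3 \<and> exp (2 * (ln T / 3)) < T \<and>
      8 \<le> (1 / (8 * pi))\<^sup>2 * pi * (ln T / 3)\<^sup>2 / 4096 * (c * \<epsilon>\<^sup>2 / 4 * (ln T / 3))"
      by (rule critical_threshold[OF \<open>0 < c\<close>]) (rule that)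
    have "False" if "0 < \<epsilon>" "\<epsilon> \<le> 1" "exp (C * \<epsilon> powr (- 2 / 3)) \<le> T"
      "C1_on u (UNIV \<times> {0..<T})" "supp u (UNIV \<times> {0..<T}) \<subseteq> {(x, t). 0 \<le> t \<and> norm x \<le> t + k}"
      "solves_integral_equation p \<epsilon> f g T u" for \<epsilon> T u
    proof -
      interpret integral_solution f f' B k p \<epsilon> T u by (rule solI) fact+
      \<comment> \<open>Here \<open>\<Sigma> = ln T / 3\<close>, so that
        \<open>exp (2 * \<Sigma>) < T\<close>.\<close>
      from C(2)[OF that(1-3)] show False
        using no_solution_negative_mass[OF \<open>mass < 0\<close> \<open>p = 2\<close> s0 c, of "ln T / 3"] by blast
    qed
    then show ?thesis
      using \<open>p = 2\<close> \<open>0 < C\<close> by (intro exI[of _ 1] conjI exI[of _ C]) auto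
  qed
qed

end
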